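(* Let $d\ge1$, let $\gamma_d$ be the standard Gaussian measure on $\mathbb{R}^d$, and let $\varepsilon>0$. Let $\mu$ be a probability measure on $\mathbb{R}^d$ of the form $\mu(dx)=e^{V(x)}\gamma_d(dx)$ with a finite second moment, and let $\nu$ be a compactly supported probability measure on $\mathbb{R}^d$ of the form $\nu(dx)=e^{-W(x)}\gamma_d(dx)$, where $V,W:\mathbb{R}^d\to\mathbb{R}\cup\{+\infty\}$ are convex and $V$ is bounded from below. Then there exist a log-convex function $f^\varepsilon:\mathbb{R}^d\to[1,+\infty)$ and a log-concave function $g^\varepsilon:\mathbb{R}^d\to[0,+\infty)$ such that the unique optimal coupling $\pi^\varepsilon\in C(\mu,\nu)$ (the unique element of $C(\mu,\nu)$ attaining the infimum defining $\mathcal{T}_H^\varepsilon(\mu,\nu)$) is of the form \[ \pi^\varepsilon(dxdy)=f^\varepsilon(x)g^\varepsilon(y)\,R^\varepsilon(dxdy). \] Moreover, $\log f^\varepsilon$ is integrable with respect to $\mu$, $\log g^\varepsilon$ is integrable with respect to $\nu$, and \[ \mathcal{T}_H^\varepsilon(\mu,\nu)=H(\pi^\varepsilon|R^\varepsilon)=\int\log f^\varepsilon\,d\mu+\int\log g^\varepsilon\,d\nu. \]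
   Context: Convex functions are allowed to take the value $+\infty$ (with $e^{-\infty}=0$). A function $f\geq 0$ is log-convex (resp. log-concave) if $\log f$ is convex (resp. concave, with $\log 0=-\infty$ allowed). Reference measure: $R^\varepsilon$ is the probability measure on $\mathbb{R}^d\times\mathbb{R}^d$ given by $R^\varepsilon=\mathrm{Law}\left(X,\,e^{-\varepsilon/2}X+\sqrt{1-e^{-\varepsilon}}\,Y\right)$ with $X,Y$ independent standard Gaussian vectors on $\mathbb{R}^d$; equivalently $R^\varepsilon(dxdy)=\gamma_d(dx)\,r_x^\varepsilon(dy)$ with $r_x^\varepsilon=\mathcal{N}(e^{-\varepsilon/2}x,(1-e^{-\varepsilon})I_d)$. Relative entropy: $H(\alpha|\beta)=\int\log\left(\frac{d\alpha}{d\beta}\right)d\alpha$ if $\alpha$ is absolutely continuous with respect to $\beta$, and $H(\alpha|\beta)=+\infty$ otherwise. Entropic transport cost: $\mathcal{T}_H^\varepsilon(\mu,\nu)=\inf_{\pi\in C(\mu,\nu)}H(\pi|R^\varepsilon)$, where $C(\mu,\nu)$ is the set of couplings of $\mu$ and $\nu$, i.e. probability measures on $\mathbb{R}^d\times\mathbb{R}^d$ with first marginal $\mu$ and second marginal $\nu$. *)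

theory Defs
  imports "HOL-Probability.Probability"
begin

(* For convex V, exp_ereal (V x) need not be Borel measurable on the boundary of the domain of V,
   which is a Lebesgue null set.  By nn_integral_completion the nn_integral of an arbitrary integrand
   agrees with the one over the completed measure, so density std_gaussian (\<lambda>x. exp_ereal (V x)) is
   the intended Borel measure without a separate measurability assumption on V. *)
definition exp_ereal :: "ereal \<Rightarrow> ennreal" where
  "exp_ereal z = (case z of ereal r \<Rightarrow> ennreal (exp r) | PInfty \<Rightarrow> \<infinity> | MInfty \<Rightarrow> 0)"

(* Logarithm of a nonnegative real with log 0 = -\<infinity> (the library has ln 0 = 0). *)
definition ln_ereal :: "real \<Rightarrow> ereal" where
  "ln_ereal r = (if r = 0 then -\<infinity> else ereal (ln r))"

(* The library's convex_on is for real-valued functions only.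
   In ereal, 0 * \<infinity> = 0, so the endpoints u = 0 and v = 0 impose no condition. *)
definition convex_ereal :: "('a::real_vector \<Rightarrow> ereal) \<Rightarrow> bool" where
  "convex_ereal F \<longleftrightarrow> (\<forall>x y. \<forall>u\<ge>0. \<forall>v\<ge>0. u + v = 1 \<longrightarrow>
     F (u *\<^sub>R x + v *\<^sub>R y) \<le> ereal u * F x + ereal v * F y)"

definition log_convex :: "('a::real_vector \<Rightarrow> real) \<Rightarrow> bool" where
  "log_convex f \<longleftrightarrow> (\<forall>x. 0 \<le> f x) \<and> convex_ereal (\<lambda>x. ln_ereal (f x))"

definition log_concave :: "('a::real_vector \<Rightarrow> real) \<Rightarrow> bool" where
  "log_concave f \<longleftrightarrow> (\<forall>x. 0 \<le> f x) \<and> convex_ereal (\<lambda>x. - ln_ereal (f x))"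

definition std_gaussian :: "'a::euclidean_space measure" where
  "std_gaussian = density lborel (\<lambda>x. ennreal (\<Prod>b\<in>Basis. std_normal_density (x \<bullet> b)))"

definition reference_measure :: "real \<Rightarrow> ('a::euclidean_space \<times> 'a) measure" where
  "reference_measure \<epsilon> = distr (std_gaussian \<Otimes>\<^sub>M std_gaussian) borel
     (\<lambda>(x, y). (x, exp (- \<epsilon> / 2) *\<^sub>R x + sqrt (1 - exp (- \<epsilon>)) *\<^sub>R y))"

(* entropy_density (exp 1) \<beta> \<alpha> is the natural logarithm of the Radon-Nikodym derivative of \<alpha>
   with respect to \<beta>.  Its integral is taken in [-\<infinity>, \<infinity>], as positive part minus negative part:
   the Bochner integral behind KL_divergence would give 0 when the entropy is infinite.
   For probability measures the negative part has a finite integral. *)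
definition relative_entropy :: "'a measure \<Rightarrow> 'a measure \<Rightarrow> ereal" where
  "relative_entropy \<alpha> \<beta> =
     (if absolutely_continuous \<beta> \<alpha>
      then enn2ereal (\<integral>\<^sup>+ z. ennreal (entropy_density (exp 1) \<beta> \<alpha> z) \<partial>\<alpha>)
         - enn2ereal (\<integral>\<^sup>+ z. ennreal (- entropy_density (exp 1) \<beta> \<alpha> z) \<partial>\<alpha>)
      else \<infinity>)"

definition couplings ::
  "'a::euclidean_space measure \<Rightarrow> 'a measure \<Rightarrow> ('a \<times> 'a) measure set" where
  "couplings \<mu> \<nu> = {\<pi>. prob_space \<pi> \<and> sets \<pi> = sets borel \<and>
     distr \<pi> borel fst = \<mu> \<and> distr \<pi> borel snd = \<nu>}"

definition entropic_cost ::
  "real \<Rightarrow> 'a::euclidean_space measure \<Rightarrow> 'a measure \<Rightarrow> ereal" where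
  "entropic_cost \<epsilon> \<mu> \<nu> = (INF \<pi>\<in>couplings \<mu> \<nu>. relative_entropy \<pi> (reference_measure \<epsilon>))"

definition optimal_coupling ::
  "real \<Rightarrow> 'a::euclidean_space measure \<Rightarrow> 'a measure \<Rightarrow> ('a \<times> 'a) measure \<Rightarrow> bool" where
  "optimal_coupling \<epsilon> \<mu> \<nu> \<pi> \<longleftrightarrow>
     \<pi> \<in> couplings \<mu> \<nu> \<and> relative_entropy \<pi> (reference_measure \<epsilon>) = entropic_cost \<epsilon> \<mu> \<nu>"

definition compactly_supported :: "'a::euclidean_space measure \<Rightarrow> bool" where
  "compactly_supported \<nu> \<longleftrightarrow> (\<exists>K. compact K \<and> emeasure \<nu> (- K) = 0)"

end

theory Submission
  imports Defs
begin

text \<open>Let \<open>\<gamma>\<close> be the standard Gaussian measure, \<open>r(x,y)\<close> the density of the reference measure \<open>R\<close> with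
respect to \<open>\<gamma> \<times> \<gamma>\<close> (the Mehler kernel, which is symmetric) and \<open>P h (x) = \<integral> r(x,y) h(y) \<gamma>(dy)\<close> the
Ornstein-Uhlenbeck operator.  The measure \<open>f(x) g(y) R(dx dy)\<close> has the prescribed marginals iff \<open>f\<close>
and \<open>g\<close> solve the Schroedinger system \<open>f P g = exp V\<close>, \<open>g P f = exp (- W)\<close> almost everywhere, that is,
iff \<open>g = exp (- W) / P f\<close> and \<open>f\<close> is, almost everywhere, a fixed point of the increasing map \<open>T f = exp V / P (exp (- W) / P f)\<close>.

Existence follows Fortet.  Starting from \<open>f\<^sub>0 = 1\<close>, the iterates of \<open>f \<mapsto> max 1 (T f)\<close> increase, so they
converge to a fixed point of this truncated map as soon as they do not blow up.  Put
\<open>g\<^sub>n = exp (- W) / P f\<^sub>n\<close>.  If \<open>T f\<^sub>n > 1\<close> everywhere, then the conservation of mass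
\<open>\<integral> f\<^sub>n P g\<^sub>n d\<gamma> = \<integral> g\<^sub>n P f\<^sub>n d\<gamma> = 1\<close> forces \<open>f\<^sub>n\<^sub>+\<^sub>1 = f\<^sub>n\<close> almost everywhere, and the scheme is stationary
(\<open>iter_stationary\<close>).  Otherwise some point \<open>x\<close> satisfies \<open>exp V(x) \<le> P g\<^sub>n (x)\<close>.  Since \<open>V\<close> is bounded
below and \<open>r\<close> is bounded on \<open>\<real>\<^sup>d \<times> K\<close>, where the compact set \<open>K\<close> carries \<open>\<nu>\<close>, this bounds the mass of
\<open>g\<^sub>n\<close> from below uniformly in \<open>n\<close>, so the limit of the \<open>g\<^sub>n\<close> is not null (\<open>dual_limit_mass\<close>).  At a fixed
point of the truncated map, conservation of mass shows once more that the truncation is inactive almost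
everywhere (\<open>fixed_marginals\<close>).

The shape of \<open>f\<close> and \<open>g\<close> is read off the scheme: \<open>P\<close> preserves log-convexity by Hoelder's inequality and
log-concavity by the Prekopa-Leindler inequality (\<open>prekopa_leindler\<close>, proved below by induction on the
dimension), so every iterate is log-convex, and so is their supremum.

Optimality and uniqueness are Gibbs' inequality (\<open>gibbs_inequality\<close>): for any coupling \<open>\<pi>'\<close> the integral
of \<open>ln (f(x) g(y))\<close> against \<open>\<pi>'\<close> depends on the marginals only, once \<open>ln f\<close> is \<open>\<mu>\<close>-integrable and \<open>ln g\<close>
is \<open>\<nu>\<close>-integrable.  For \<open>f\<close> this holds because a log-convex function with a finite Gaussian average grows
at most like \<open>exp (B \<bar>x\<bar>\<^sup>2)\<close> (\<open>ln_f_growth\<close>), and \<open>\<mu>\<close> has a second moment.  For \<open>ln g = - W - ln (P f)\<close>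
the inequality \<open>ln t \<le> t\<close> is applied to \<open>t = P f(y) P g(x) / r(x,y)\<close>, whose integral against the plan is
\<open>(\<integral> f P g d\<gamma>) (\<integral> g P f d\<gamma>) = 1\<close> (\<open>nn_integral_ln_Pf\<close>).\<close>

section \<open>Facts on extended nonnegative reals and integrals\<close>

lemma ennreal_divide_mult_cancel: "0 < b \<Longrightarrow> b < \<infinity> \<Longrightarrow> (a::ennreal) / b * b = a"
  by (simp add: ennreal_divide_times)

lemma ennreal_divide_mult_le: "(a::ennreal) / b * b \<le> a"
proof -
  consider "b = 0" | "b = \<infinity>" | "0 < b" "b < \<infinity>"
    by (metis ennreal_zero_less_top less_top infinity_ennreal_def not_gr_zero)
  then show ?thesis
  proof cases
    case 2 then show ?thesis by (simp add: divide_ennreal_def)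
  next
    case 3 then show ?thesis by (simp add: ennreal_divide_mult_cancel)
  qed simp
qed

lemma ennreal_inverse_antimono: "b \<le> c \<Longrightarrow> inverse c \<le> inverse (b::ennreal)"
proof (cases "b = 0 \<or> c = \<infinity>")
  case False
  assume "b \<le> c"
  obtain s where s: "c = ennreal s" "0 \<le> s" using False by (cases c) auto
  then have "b \<noteq> \<infinity>" using \<open>b \<le> c\<close> by (auto simp: top_unique)
  then obtain r where r: "b = ennreal r" "0 \<le> r" by (cases b) auto
  have "0 < r" using False r by (cases "r = 0") auto
  moreover have "r \<le> s" using \<open>b \<le> c\<close> r s by (simp add: ennreal_le_iff)
  ultimately have "inverse s \<le> inverse r" "0 < s" by (simp_all add: le_imp_inverse_le)
  then show ?thesis using r s \<open>0 < r\<close> by (simp add: inverse_ennreal ennreal_leI)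
qed auto

lemma ennreal_enn2real_le: "ennreal (enn2real x) \<le> x"
  by (cases x) auto

lemma decseq_pointwise: "decseq F \<Longrightarrow> decseq (\<lambda>n. F n y)"
  by (rule decseq_SucI, rule le_funD, erule decseq_SucD)

lemma ennreal_divide_antimono: "b \<le> c \<Longrightarrow> (a::ennreal) / c \<le> a / b"
  unfolding divide_ennreal_def by (intro mult_left_mono ennreal_inverse_antimono) auto

lemma ennreal_tendsto_divide_const:
  fixes a :: ennreal
  assumes "a < \<infinity>" "(X \<longlongrightarrow> L) F"
  shows "((\<lambda>n. a / X n) \<longlongrightarrow> a / L) F"
  unfolding divide_ennreal_def using assms(1)
  by (intro ennreal_tendsto_cmult continuous_on_tendsto_compose[OF continuous_on_inverse_ennreal[OF continuous_on_id] assms(2), of UNIV]) auto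

lemma AE_eq_of_nn_integral_le:
  fixes f g :: "'a \<Rightarrow> ennreal"
  assumes [measurable]: "f \<in> borel_measurable M" "g \<in> borel_measurable M"
    and le: "AE x in M. f x \<le> g x" and int: "(\<integral>\<^sup>+x. g x \<partial>M) \<le> (\<integral>\<^sup>+x. f x \<partial>M)"
    and fin: "(\<integral>\<^sup>+x. f x \<partial>M) < \<infinity>"
  shows "AE x in M. f x = g x"
proof -
  have "(\<integral>\<^sup>+x. g x - f x \<partial>M) = (\<integral>\<^sup>+x. g x \<partial>M) - (\<integral>\<^sup>+x. f x \<partial>M)"
    using fin le by (intro nn_integral_diff) auto
  also have "\<dots> = 0" using int fin by (auto simp: diff_eq_0_iff_ennreal less_top)
  finally have "AE x in M. g x - f x = 0"
    by (subst (asm) nn_integral_0_iff_AE) auto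
  then show ?thesis using le
    by eventually_elim (auto simp: diff_eq_0_iff_ennreal)
qed

lemma one_le_ennreal_iff: "1 \<le> ennreal r \<longleftrightarrow> 1 \<le> r"
proof (cases "0 \<le> r")
  case True
  have "ennreal 1 \<le> ennreal r \<longleftrightarrow> 1 \<le> r" using True by (rule ennreal_le_iff)
  then show ?thesis by simp
qed (simp add: ennreal_neg)

text \<open>The densities are arbitrary functions, so one that fails to be Borel on a null set can
be replaced by a Borel one.\<close>

lemma density_cong_AE:
  assumes "AE x in M. f x = g x"
  shows "density M f = density M g"
proof -
  have "(\<integral>\<^sup>+x. f x * indicator A x \<partial>M) = (\<integral>\<^sup>+x. g x * indicator A x \<partial>M)" for A
    using assms by (intro nn_integral_cong_AE) auto
  then show ?thesis by (simp add: density_def)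
qed

lemma nn_integral_lborel_translate:
  fixes h :: "'a::euclidean_space \<Rightarrow> ennreal"
  assumes [measurable]: "h \<in> borel_measurable borel"
  shows "(\<integral>\<^sup>+z. h (x + z) \<partial>lborel) = (\<integral>\<^sup>+z. h z \<partial>lborel)"
    and "(\<integral>\<^sup>+z. h (x - z) \<partial>lborel) = (\<integral>\<^sup>+z. h z \<partial>lborel)"
proof -
  show "(\<integral>\<^sup>+z. h (x + z) \<partial>lborel) = (\<integral>\<^sup>+z. h z \<partial>lborel)"
    by (subst (2) lborel_affine[of 1 x]) (simp_all add: nn_integral_density nn_integral_distr)
  show "(\<integral>\<^sup>+z. h (x - z) \<partial>lborel) = (\<integral>\<^sup>+z. h z \<partial>lborel)"
    by (subst (2) lborel_affine[of "-1" x]) (simp_all add: nn_integral_density nn_integral_distr)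
qed

section \<open>The Prekopa-Leindler inequality\<close>

text \<open>The inequality \<open>p\<^sup>u q\<^sup>v \<le> r\<close> for extended nonnegative numbers, expressed through real numbers below \<open>p\<close> and
\<open>q\<close>.  This avoids powers of \<open>\<infinity>\<close>, and the strict bounds make the relation compatible with truncation and
monotone limits.\<close>

definition geo_mean_le :: "real \<Rightarrow> real \<Rightarrow> ennreal \<Rightarrow> ennreal \<Rightarrow> ennreal \<Rightarrow> bool" where
  "geo_mean_le u v p q r \<longleftrightarrow>
     (\<forall>A B. 0 < A \<longrightarrow> 0 < B \<longrightarrow> ennreal A < p \<longrightarrow> ennreal B < q \<longrightarrow>
        ennreal (A powr u * B powr v) \<le> r)"

lemma geo_mean_leD:
  "geo_mean_le u v p q r \<Longrightarrow> 0 < A \<Longrightarrow> 0 < B \<Longrightarrow> ennreal A < p \<Longrightarrow> ennreal B < q \<Longrightarrow>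
    ennreal (A powr u * B powr v) \<le> r"
  by (auto simp: geo_mean_le_def)

lemma powr_mult_powr_scale:
  fixes t :: real
  assumes "0 < t" "0 < A" "0 < B" "u + v = 1"
  shows "(t * A) powr u * (t * B) powr v = t * (A powr u * B powr v)"
proof -
  have "(t * A) powr u * (t * B) powr v = (t powr u * t powr v) * (A powr u * B powr v)"
    using assms by (simp add: powr_mult)
  also have "t powr u * t powr v = t"
    using assms by (simp add: powr_add[symmetric])
  finally show ?thesis .
qed

lemma emeasure_vimage_affine_real:
  fixes X :: "real set"
  assumes [measurable]: "X \<in> sets borel" and u: "u > 0"
  shows "emeasure lborel {z. (z - c) / u \<in> X} = ennreal u * emeasure lborel X"
proof -
  have "emeasure lborel {z. (z - c) / u \<in> X} = (\<integral>\<^sup>+z. indicator {z. (z - c) / u \<in> X} z \<partial>lborel)"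
    by simp
  also have "\<dots> = ennreal \<bar>u\<bar> * (\<integral>\<^sup>+z. indicator {z. (z - c) / u \<in> X} (c + u * z) \<partial>lborel)"
    using u by (intro nn_integral_real_affine) auto
  also have "(\<integral>\<^sup>+z. indicator {z. (z - c) / u \<in> X} (c + u * z) \<partial>lborel) = (\<integral>\<^sup>+z. indicator X z \<partial>lborel)"
    using u by (intro nn_integral_cong) (auto simp: indicator_def)
  finally show ?thesis using u by simp
qed

text \<open>Let \<open>p\<close> be almost the supremum of \<open>X\<close> and \<open>q\<close> almost the infimum of \<open>Y\<close>.  Then \<open>u X + v q\<close> and \<open>u p + v Y\<close>
are affine copies of \<open>X\<close> and \<open>Y\<close> inside \<open>S\<close> that overlap in an arbitrarily short interval only.\<close>

lemma brunn_minkowski_real_bounded: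
  fixes X Y S :: "real set"
  assumes [measurable]: "X \<in> sets borel" "Y \<in> sets borel" "S \<in> sets borel"
    and uv: "0 < u" "0 < v"
    and ne: "X \<noteq> {}" "Y \<noteq> {}" and bd: "bounded X" "bounded Y"
    and sub: "\<And>x y. x \<in> X \<Longrightarrow> y \<in> Y \<Longrightarrow> u * x + v * y \<in> S"
  shows "ennreal u * emeasure lborel X + ennreal v * emeasure lborel Y \<le> emeasure lborel S"
proof (rule ennreal_le_epsilon)
  fix e :: real assume "0 < e"
  define d where "d = e / (u + v)"
  have d: "0 < d" using \<open>0 < e\<close> uv by (simp add: d_def)
  have bX: "bdd_above X" "bdd_below X" and bY: "bdd_above Y" "bdd_below Y"
    using bd bounded_imp_bdd_above bounded_imp_bdd_below by auto
  obtain p where p: "p \<in> X" "Sup X - d < p"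
    using less_cSup_iff[OF ne(1) bX(1), of "Sup X - d"] d by auto
  obtain q where q: "q \<in> Y" "q < Inf Y + d"
    using cInf_less_iff[OF ne(2) bY(2), of "Inf Y + d"] d by auto
  let ?X = "{z. (z - v * q) / u \<in> X}" and ?Y = "{z. (z - u * p) / v \<in> Y}"
  let ?I = "{u * p + v * Inf Y .. u * Sup X + v * q}"
  have [measurable]: "?X \<in> sets borel" "?Y \<in> sets borel" by measurable
  have XS: "?X \<subseteq> S"
  proof
    fix z assume "z \<in> ?X"
    then have "u * ((z - v * q) / u) + v * q \<in> S" using sub q by blast
    moreover have "u * ((z - v * q) / u) + v * q = z" using uv by simp
    ultimately show "z \<in> S" by simp
  qed
  have YS: "?Y \<subseteq> S"
  proof
    fix z assume "z \<in> ?Y"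
    then have "u * p + v * ((z - u * p) / v) \<in> S" using sub p by blast
    moreover have "u * p + v * ((z - u * p) / v) = z" using uv by simp
    ultimately show "z \<in> S" by simp
  qed
  have int: "?X \<inter> ?Y \<subseteq> ?I"
  proof
    fix z assume z: "z \<in> ?X \<inter> ?Y"
    have "(z - v * q) / u \<le> Sup X" using z bX by (auto intro: cSup_upper)
    moreover have "Inf Y \<le> (z - u * p) / v" using z bY by (auto intro: cInf_lower)
    ultimately show "z \<in> ?I" using uv by (simp add: field_simps)
  qed
  have "u * Sup X + v * q - (u * p + v * Inf Y) = u * (Sup X - p) + v * (q - Inf Y)"
    by (simp add: algebra_simps)
  also have "\<dots> \<le> u * d + v * d"
    using p q uv by (intro add_mono mult_left_mono) auto
  also have "\<dots> = (u + v) * d" by (simp add: distrib_right)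
  also have "\<dots> = e" using uv by (simp add: d_def)
  finally have len: "u * Sup X + v * q - (u * p + v * Inf Y) \<le> e" .
  have "emeasure lborel ?I \<le> ennreal e"
    using len \<open>0 < e\<close> by (cases "u * p + v * Inf Y \<le> u * Sup X + v * q") (auto intro: ennreal_leI)
  moreover have "emeasure lborel (?X \<inter> ?Y) \<le> emeasure lborel ?I"
    using int by (intro emeasure_mono) auto
  ultimately have small: "emeasure lborel (?X \<inter> ?Y) \<le> ennreal e" by (rule order_trans[rotated])
  have "ennreal u * emeasure lborel X + ennreal v * emeasure lborel Y = emeasure lborel ?X + emeasure lborel ?Y"
    using uv by (simp add: emeasure_vimage_affine_real)
  also have "\<dots> = emeasure lborel (?X \<union> ?Y) + emeasure lborel (?X \<inter> ?Y)"
    by (rule emeasure_Un_Int) auto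
  also have "\<dots> \<le> emeasure lborel S + ennreal e"
    using XS YS by (intro add_mono small emeasure_mono) auto
  finally show "ennreal u * emeasure lborel X + ennreal v * emeasure lborel Y \<le> emeasure lborel S + ennreal e" .
qed

text \<open>Exhaustion by bounded windows, which are started large enough to meet both sets.\<close>

lemma brunn_minkowski_real:
  fixes X Y S :: "real set"
  assumes [measurable]: "X \<in> sets borel" "Y \<in> sets borel" "S \<in> sets borel"
    and uv: "0 < u" "0 < v" and ne: "X \<noteq> {}" "Y \<noteq> {}"
    and sub: "\<And>x y. x \<in> X \<Longrightarrow> y \<in> Y \<Longrightarrow> u * x + v * y \<in> S"
  shows "ennreal u * emeasure lborel X + ennreal v * emeasure lborel Y \<le> emeasure lborel S"
proof -
  obtain x0 y0 where xy: "x0 \<in> X" "y0 \<in> Y" using ne by auto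
  obtain N :: nat where N: "\<bar>x0\<bar> + \<bar>y0\<bar> \<le> real N" using real_arch_simple by blast
  define Z where "Z A n = A \<inter> {- real (N + n) .. real (N + n)}" for A n
  have [measurable]: "A \<in> sets borel \<Longrightarrow> Z A n \<in> sets borel" for A n
    by (simp add: Z_def)
  have inc: "incseq (Z A)" for A
    by (auto simp: incseq_def Z_def)
  have UN: "(\<Union>n. Z A n) = A" for A
  proof
    show "A \<subseteq> (\<Union>n. Z A n)"
    proof
      fix x assume "x \<in> A"
      obtain n :: nat where "\<bar>x\<bar> \<le> real n" using real_arch_simple by blast
      then show "x \<in> (\<Union>n. Z A n)" using \<open>x \<in> A\<close> by (auto simp: Z_def intro!: exI[of _ n])
    qed
  qed (auto simp: Z_def)
  have lim: "(\<lambda>n. emeasure lborel (Z A n)) \<longlonglongrightarrow> emeasure lborel A" if "A \<in> sets borel" for A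
    using Lim_emeasure_incseq[of "Z A" lborel] that inc UN by (auto simp: image_subset_iff)
  have "(\<lambda>n. ennreal u * emeasure lborel (Z X n) + ennreal v * emeasure lborel (Z Y n))
      \<longlonglongrightarrow> ennreal u * emeasure lborel X + ennreal v * emeasure lborel Y"
    by (intro tendsto_add ennreal_tendsto_cmult lim) (auto simp: less_top)
  moreover have "ennreal u * emeasure lborel (Z X n) + ennreal v * emeasure lborel (Z Y n) \<le> emeasure lborel S" for n
  proof (rule brunn_minkowski_real_bounded)
    have "x0 \<in> Z X n" "y0 \<in> Z Y n" using xy N by (auto simp: Z_def)
    then show "Z X n \<noteq> {}" "Z Y n \<noteq> {}" by auto
    show "bounded (Z X n)" "bounded (Z Y n)"
      unfolding Z_def by (auto intro: bounded_subset[OF bounded_closed_interval])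
    show "u * x + v * y \<in> S" if "x \<in> Z X n" "y \<in> Z Y n" for x y
      using that sub by (auto simp: Z_def)
  qed (use uv in auto)
  ultimately show ?thesis
    by (intro LIMSEQ_le_const2) auto
qed

lemma emeasure_lborel_Collect:
  assumes "{x. p x} \<in> sets borel"
  shows "emeasure lborel {x. p x} = (\<integral>\<^sup>+x. (if p x then 1 else 0) \<partial>lborel)"
proof -
  have "emeasure lborel {x. p x} = (\<integral>\<^sup>+x. indicator {x. p x} x \<partial>lborel)" using assms by simp
  also have "\<dots> = (\<integral>\<^sup>+x. (if p x then 1 else 0) \<partial>lborel)"
    by (intro nn_integral_cong) (simp add: indicator_def)
  finally show ?thesis .
qed

text \<open>Used for the upper half of a layer-cake decomposition: the levels below \<open>p\<close> that lie in the unit interval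
occupy at most \<open>p / c\<close>.\<close>

lemma emeasure_levels_le:
  "emeasure lborel {t::real. 0 < t \<and> t < 1 \<and> ennreal t * ennreal c \<le> p} \<le> p / ennreal c"
  if "c > 0"
proof (cases "p = \<infinity>")
  case True then show ?thesis using that by (simp add: ennreal_top_divide)
next
  case False
  then obtain r where r: "p = ennreal r" "r \<ge> 0" by (cases p) auto
  have "{t::real. 0 < t \<and> t < 1 \<and> ennreal t * ennreal c \<le> p} \<subseteq> {0 .. r / c}"
    using that r by (auto simp: ennreal_mult[symmetric] field_simps)
  then have "emeasure lborel {t::real. 0 < t \<and> t < 1 \<and> ennreal t * ennreal c \<le> p} \<le> emeasure lborel {0 .. r / c}"
    by (rule emeasure_mono) simp
  also have "\<dots> = p / ennreal c"
    using that r by (simp add: divide_ennreal)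
  finally show ?thesis .
qed

text \<open>Fubini's theorem for the region below the graph of \<open>f / F\<close>.  Restricting the levels to the unit interval
is what allows the same levels to be used for two functions with different suprema.\<close>

lemma layer_cake_normalized:
  fixes f :: "real \<Rightarrow> ennreal"
  assumes [measurable]: "f \<in> borel_measurable borel" and F: "F > 0" and le: "\<And>x. f x \<le> ennreal F"
  shows "(\<integral>\<^sup>+x. f x \<partial>lborel) / ennreal F
    = (\<integral>\<^sup>+t. emeasure lborel {x. ennreal (t * F) < f x} * indicator {0<..<1} t \<partial>lborel)"
proof -
  have "(\<integral>\<^sup>+t. emeasure lborel {x. ennreal (t * F) < f x} * indicator {0<..<1} t \<partial>lborel)
      = (\<integral>\<^sup>+t. \<integral>\<^sup>+x. indicator {x. ennreal (t * F) < f x} x * indicator {0<..<1} t \<partial>lborel \<partial>lborel)"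
    by (simp add: nn_integral_multc)
  also have "\<dots> = (\<integral>\<^sup>+t. \<integral>\<^sup>+x. (if ennreal (t * F) < f x then 1 else 0) * indicator {0<..<1} t \<partial>lborel \<partial>lborel)"
    by (auto simp: indicator_def intro!: nn_integral_cong)
  also have "\<dots> = (\<integral>\<^sup>+x. \<integral>\<^sup>+t. (if ennreal (t * F) < f x then 1 else 0) * indicator {0<..<1} t \<partial>lborel \<partial>lborel)"
    by (rule lborel_pair.Fubini') measurable
  also have "\<dots> = (\<integral>\<^sup>+x. f x / ennreal F \<partial>lborel)"
  proof (rule nn_integral_cong)
    fix x
    obtain r where r: "f x = ennreal r" "r \<ge> 0" "r \<le> F"
      using le[of x] by (cases "f x") (auto simp: ennreal_le_iff2 F less_imp_le top_unique)
    have "(\<integral>\<^sup>+t. (if ennreal (t * F) < f x then 1 else 0) * indicator {0<..<1} t \<partial>lborel)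
       = (\<integral>\<^sup>+t. indicator {0<..<r / F} t \<partial>lborel)"
    proof (rule nn_integral_cong)
      fix t
      have "0 < t \<Longrightarrow> t < 1 \<Longrightarrow> (ennreal (t * F) < ennreal r) = (t < r / F)"
        using F r by (subst ennreal_less_iff) (auto simp: field_simps)
      moreover have "r / F \<le> 1" using F r by simp
      ultimately show "(if ennreal (t * F) < f x then 1 else 0) * indicator {0<..<1} t = (indicator {0<..<r / F} t :: ennreal)"
        by (auto simp: r indicator_def)
    qed
    also have "\<dots> = f x / ennreal F"
      using F r by (simp add: divide_ennreal)
    finally show "(\<integral>\<^sup>+t. (if ennreal (t * F) < f x then 1 else 0) * indicator {0<..<1} t \<partial>lborel) = f x / ennreal F" .
  qed
  also have "\<dots> = (\<integral>\<^sup>+x. f x \<partial>lborel) / ennreal F"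
    by (rule nn_integral_divide) simp
  finally show ?thesis by simp
qed

lemma nn_integral_min_SUP:
  fixes f :: "'a \<Rightarrow> ennreal"
  assumes [measurable]: "f \<in> borel_measurable M"
  shows "(\<integral>\<^sup>+x. f x \<partial>M) = (SUP n::nat. \<integral>\<^sup>+x. min (f x) (of_nat n) \<partial>M)"
proof -
  have "(SUP n::nat. min (f x) (of_nat n)) = f x" for x
  proof (rule antisym)
    show "(SUP n::nat. min (f x) (of_nat n)) \<le> f x" by (auto intro: SUP_least)
    show "f x \<le> (SUP n::nat. min (f x) (of_nat n))"
    proof (cases "f x")
      case (real r)
      obtain n :: nat where "r \<le> real n" using real_arch_simple by blast
      then have "f x \<le> min (f x) (of_nat n)"
        using real by (simp add: ennreal_of_nat_eq_real_of_nat ennreal_leI)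
      then show ?thesis by (rule SUP_upper2[OF UNIV_I])
    next
      case top
      have "(SUP n::nat. of_nat n :: ennreal) = top" by (rule ennreal_SUP_of_nat_eq_top)
      moreover have "(SUP n::nat. min (f x) (of_nat n)) = (SUP n::nat. of_nat n :: ennreal)"
        by (simp add: top)
      ultimately show ?thesis by (metis top_greatest)
    qed
  qed
  then have "(\<integral>\<^sup>+x. f x \<partial>M) = (\<integral>\<^sup>+x. (SUP n::nat. min (f x) (of_nat n)) \<partial>M)" by simp
  also have "\<dots> = (SUP n::nat. \<integral>\<^sup>+x. min (f x) (of_nat n) \<partial>M)"
    by (rule nn_integral_monotone_convergence_SUP)
       (auto simp: incseq_def le_fun_def intro!: min.coboundedI2 of_nat_mono)
  finally show ?thesis .
qed

text \<open>After truncation, \<open>f\<close> and \<open>g\<close> have finite suprema \<open>F\<close> and \<open>H\<close>.  For \<open>0 < t < 1\<close> the level sets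
\<open>{f > t F}\<close> and \<open>{g > t H}\<close> are nonempty, and the hypothesis puts their weighted Minkowski sum into
\<open>{h \<ge> t F\<^sup>u H\<^sup>v}\<close>.  One-dimensional Brunn-Minkowski at each level, integration over \<open>t\<close> and Young's
inequality \<open>(A/F)\<^sup>u (B/H)\<^sup>v \<le> u A/F + v B/H\<close> give the claim.\<close>

lemma prekopa_leindler_real:
  fixes f g h :: "real \<Rightarrow> ennreal"
  assumes [measurable]: "f \<in> borel_measurable borel" "g \<in> borel_measurable borel" "h \<in> borel_measurable borel"
    and uv: "0 < u" "0 < v" "u + v = 1"
    and le: "\<And>x y. geo_mean_le u v (f x) (g y) (h (u * x + v * y))"
  shows "geo_mean_le u v (\<integral>\<^sup>+x. f x \<partial>lborel) (\<integral>\<^sup>+x. g x \<partial>lborel) (\<integral>\<^sup>+x. h x \<partial>lborel)"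
  unfolding geo_mean_le_def
proof (intro allI impI)
  fix A B :: real
  assume AB: "0 < A" "0 < B" and Af: "ennreal A < (\<integral>\<^sup>+x. f x \<partial>lborel)" and Bg: "ennreal B < (\<integral>\<^sup>+x. g x \<partial>lborel)"
  obtain n1 where n1: "ennreal A < (\<integral>\<^sup>+x. min (f x) (of_nat n1) \<partial>lborel)"
    using Af by (subst (asm) nn_integral_min_SUP) (auto simp: less_SUP_iff)
  obtain n2 where n2: "ennreal B < (\<integral>\<^sup>+x. min (g x) (of_nat n2) \<partial>lborel)"
    using Bg by (subst (asm) nn_integral_min_SUP) (auto simp: less_SUP_iff)
  define f' where "f' x = min (f x) (of_nat n1)" for x
  define g' where "g' x = min (g x) (of_nat n2)" for x
  have [measurable]: "f' \<in> borel_measurable borel" "g' \<in> borel_measurable borel"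
    unfolding f'_def g'_def by measurable
  have sup_real: "\<exists>F>0. (SUP x. k x) = ennreal F"
    if "\<And>x. k x \<le> of_nat n" "ennreal C < (\<integral>\<^sup>+x. k x \<partial>lborel)" for k :: "real \<Rightarrow> ennreal" and n C
  proof -
    have "(SUP x. k x) \<le> of_nat n" using that by (auto intro: SUP_least)
    then have "(SUP x. k x) < top" using of_nat_less_top by (rule le_less_trans)
    then obtain F where F: "(SUP x. k x) = ennreal F" "F \<ge> 0" by (cases "SUP x. k x") auto
    have "F \<noteq> 0"
    proof
      assume "F = 0"
      then have "k x = 0" for x using SUP_upper[of x UNIV k] F by simp
      then show False using that(2) by simp
    qed
    then show ?thesis using F by (intro exI[of _ F]) auto
  qed
  obtain F where F: "F > 0" "(SUP x. f' x) = ennreal F" using sup_real[of f' n1 A] n1 by (auto simp: f'_def)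
  obtain H where H: "H > 0" "(SUP x. g' x) = ennreal H" using sup_real[of g' n2 B] n2 by (auto simp: g'_def)
  have f'F: "f' x \<le> ennreal F" for x using F(2) SUP_upper[of x UNIV f'] by simp
  have g'H: "g' x \<le> ennreal H" for x using H(2) SUP_upper[of x UNIV g'] by simp
  define c where "c = F powr u * H powr v"
  have c: "c > 0" using F H by (simp add: c_def)
  let ?X = "\<lambda>t. {x. ennreal (t * F) < f' x}" and ?Y = "\<lambda>t. {x. ennreal (t * H) < g' x}"
  let ?S = "\<lambda>t. {z. ennreal t * ennreal c \<le> h z}"
  \<comment> \<open>Both level sets are cut at the same relative height \<open>t\<close>, so the level of \<open>h\<close> is \<open>t\<close> times \<open>c\<close>.\<close>
  have BM: "ennreal u * emeasure lborel (?X t) + ennreal v * emeasure lborel (?Y t) \<le> emeasure lborel (?S t)"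
    if t: "0 < t" "t < 1" for t
  proof (rule brunn_minkowski_real)
    have "ennreal (t * F) < (SUP x. f' x)" using F t by (simp add: ennreal_less_iff)
    then show "?X t \<noteq> {}" by (auto simp: less_SUP_iff)
    have "ennreal (t * H) < (SUP x. g' x)" using H t by (simp add: ennreal_less_iff)
    then show "?Y t \<noteq> {}" by (auto simp: less_SUP_iff)
    fix x y assume "x \<in> ?X t" "y \<in> ?Y t"
    then have "ennreal (t * F) < f x" "ennreal (t * H) < g y" by (auto simp: f'_def g'_def)
    from geo_mean_leD[OF le _ _ this] t F H
    have "ennreal ((t * F) powr u * (t * H) powr v) \<le> h (u * x + v * y)" by simp
    then show "u * x + v * y \<in> ?S t"
      using t F H c uv by (simp add: powr_mult_powr_scale c_def[symmetric] ennreal_mult)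
  qed (use uv in auto)
  have mX[measurable]: "(\<lambda>t. emeasure lborel (?X t)) \<in> borel_measurable borel"
    and mY[measurable]: "(\<lambda>t. emeasure lborel (?Y t)) \<in> borel_measurable borel"
  proof -
    show "(\<lambda>t. emeasure lborel (?X t)) \<in> borel_measurable borel"
      by (subst emeasure_lborel_Collect) measurable
    show "(\<lambda>t. emeasure lborel (?Y t)) \<in> borel_measurable borel"
      by (subst emeasure_lborel_Collect) measurable
  qed
  have young: "A powr u * B powr v / c \<le> u * (A / F) + v * (B / H)"
    using Youngs_inequality_0[of u v "A / F" "B / H"] uv AB F H by (simp add: powr_divide c_def)
  have "ennreal (A powr u * B powr v / c) \<le> ennreal (u * (A / F) + v * (B / H))"
    using young by (rule ennreal_leI)
  also have "\<dots> = ennreal u * (ennreal A / ennreal F) + ennreal v * (ennreal B / ennreal H)"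
    using uv AB F H by (simp add: ennreal_plus[symmetric] ennreal_mult[symmetric] divide_ennreal del: ennreal_plus)
  also have "\<dots> \<le> ennreal u * ((\<integral>\<^sup>+x. f' x \<partial>lborel) / ennreal F) + ennreal v * ((\<integral>\<^sup>+x. g' x \<partial>lborel) / ennreal H)"
    using n1 n2 by (intro add_mono mult_left_mono divide_right_mono_ennreal) (auto simp: f'_def g'_def)
  also have "\<dots> = ennreal u * (\<integral>\<^sup>+t. emeasure lborel (?X t) * indicator {0<..<1} t \<partial>lborel)
      + ennreal v * (\<integral>\<^sup>+t. emeasure lborel (?Y t) * indicator {0<..<1} t \<partial>lborel)"
    using F H f'F g'H by (simp add: layer_cake_normalized)
  also have "\<dots> = (\<integral>\<^sup>+t. (ennreal u * emeasure lborel (?X t) + ennreal v * emeasure lborel (?Y t)) * indicator {0<..<1} t \<partial>lborel)"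
    by (simp add: nn_integral_cmult[symmetric] nn_integral_add[symmetric] algebra_simps)
  also have "\<dots> \<le> (\<integral>\<^sup>+t. emeasure lborel (?S t) * indicator {0<..<1} t \<partial>lborel)"
    using BM by (intro nn_integral_mono) (auto simp: indicator_def)
  also have "\<dots> = (\<integral>\<^sup>+t. \<integral>\<^sup>+z. (if 0 < t \<and> t < 1 \<and> ennreal t * ennreal c \<le> h z then 1 else 0) \<partial>lborel \<partial>lborel)"
  proof (rule nn_integral_cong)
    fix t
    have "?S t \<in> sets borel" by measurable
    note S = emeasure_lborel_Collect[OF this]
    show "emeasure lborel (?S t) * indicator {0<..<1} t
        = (\<integral>\<^sup>+z. (if 0 < t \<and> t < 1 \<and> ennreal t * ennreal c \<le> h z then 1 else 0) \<partial>lborel)"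
      unfolding S by (cases "0 < t \<and> t < 1") auto
  qed
  also have "\<dots> = (\<integral>\<^sup>+z. \<integral>\<^sup>+t. (if 0 < t \<and> t < 1 \<and> ennreal t * ennreal c \<le> h z then 1 else 0) \<partial>lborel \<partial>lborel)"
    by (rule lborel_pair.Fubini') measurable
  also have "\<dots> = (\<integral>\<^sup>+z. emeasure lborel {t::real. 0 < t \<and> t < 1 \<and> ennreal t * ennreal c \<le> h z} \<partial>lborel)"
    by (intro nn_integral_cong emeasure_lborel_Collect[symmetric]) measurable
  also have "\<dots> \<le> (\<integral>\<^sup>+z. h z / ennreal c \<partial>lborel)"
    using c by (intro nn_integral_mono emeasure_levels_le)
  also have "\<dots> = (\<integral>\<^sup>+z. h z \<partial>lborel) / ennreal c"
    by (rule nn_integral_divide) simp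
  finally have "ennreal (A powr u * B powr v / c) * ennreal c \<le> (\<integral>\<^sup>+z. h z \<partial>lborel) / ennreal c * ennreal c"
    by (rule mult_right_mono) simp
  also have "\<dots> = (\<integral>\<^sup>+z. h z \<partial>lborel)"
    using c by (intro ennreal_divide_mult_cancel) auto
  finally show "ennreal (A powr u * B powr v) \<le> (\<integral>\<^sup>+z. h z \<partial>lborel)"
    using c by (simp add: ennreal_mult[symmetric])
qed

text \<open>By induction on the number of coordinates: for fixed remaining coordinates, the one-dimensional inequality
shows that the integrals over the new coordinate satisfy the hypothesis again.\<close>

lemma prekopa_leindler_PiM:
  fixes I :: "'i set" and f g h :: "('i \<Rightarrow> real) \<Rightarrow> ennreal"
  assumes "finite I" and uv: "0 < u" "0 < v" "u + v = 1"
    and "f \<in> borel_measurable (Pi\<^sub>M I (\<lambda>_. lborel))" "g \<in> borel_measurable (Pi\<^sub>M I (\<lambda>_. lborel))"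
      "h \<in> borel_measurable (Pi\<^sub>M I (\<lambda>_. lborel))"
    and "\<And>x y. x \<in> space (Pi\<^sub>M I (\<lambda>_. lborel :: real measure)) \<Longrightarrow> y \<in> space (Pi\<^sub>M I (\<lambda>_. lborel :: real measure)) \<Longrightarrow>
      geo_mean_le u v (f x) (g y) (h (\<lambda>i\<in>I. u * x i + v * y i))"
  shows "geo_mean_le u v (integral\<^sup>N (Pi\<^sub>M I (\<lambda>_. lborel)) f) (integral\<^sup>N (Pi\<^sub>M I (\<lambda>_. lborel)) g)
    (integral\<^sup>N (Pi\<^sub>M I (\<lambda>_. lborel)) h)"
  using assms(1,5-)
proof (induction I arbitrary: f g h rule: finite_induct)
  case empty
  interpret product_sigma_finite "\<lambda>_::'i. lborel :: real measure" by standard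
  show ?case
    using empty.prems(4)[of "\<lambda>_. undefined" "\<lambda>_. undefined"]
    by (simp add: nn_integral_empty space_PiM restrict_def)
next
  case (insert i I)
  interpret product_sigma_finite "\<lambda>_::'i. lborel :: real measure" by standard
  note [measurable] = insert.prems(1-3)
  note meas = insert.prems(1-3)
  have up[measurable]: "(\<lambda>s. x(i := s)) \<in> borel \<rightarrow>\<^sub>M Pi\<^sub>M (insert i I) (\<lambda>_. lborel)"
    if "x \<in> space (Pi\<^sub>M I (\<lambda>_. lborel))" for x :: "'i \<Rightarrow> real"
  proof -
    have "(\<lambda>s. x(i := s)) \<in> lborel \<rightarrow>\<^sub>M Pi\<^sub>M (insert i I) (\<lambda>_. lborel)"
      using that by (intro measurable_fun_upd[where J=I]) auto
    then show ?thesis by simp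
  qed
  have sp: "x(i := s) \<in> space (Pi\<^sub>M (insert i I) (\<lambda>_. lborel))"
    if "x \<in> space (Pi\<^sub>M I (\<lambda>_. lborel))" for x :: "'i \<Rightarrow> real" and s
    using that by (auto simp: space_PiM PiE_def extensional_def)
  have m2: "(\<lambda>x. \<integral>\<^sup>+s. k (x(i := s)) \<partial>lborel) \<in> borel_measurable (Pi\<^sub>M I (\<lambda>_. lborel))"
    if [measurable]: "k \<in> borel_measurable (Pi\<^sub>M (insert i I) (\<lambda>_. lborel))" for k :: "('i \<Rightarrow> real) \<Rightarrow> ennreal"
    by measurable
  show ?case
    unfolding product_nn_integral_insert[OF insert.hyps meas(1)] product_nn_integral_insert[OF insert.hyps meas(2)]
      product_nn_integral_insert[OF insert.hyps meas(3)]
  proof (rule insert.IH)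
    fix x y :: "'i \<Rightarrow> real"
    assume xy: "x \<in> space (Pi\<^sub>M I (\<lambda>_. lborel))" "y \<in> space (Pi\<^sub>M I (\<lambda>_. lborel))"
    define z where "z = (\<lambda>i\<in>I. u * x i + v * y i)"
    have z: "z \<in> space (Pi\<^sub>M I (\<lambda>_. lborel))" by (auto simp: z_def space_PiM)
    show "geo_mean_le u v (\<integral>\<^sup>+s. f (x(i := s)) \<partial>lborel) (\<integral>\<^sup>+s. g (y(i := s)) \<partial>lborel) (\<integral>\<^sup>+s. h (z(i := s)) \<partial>lborel)"
    proof (rule prekopa_leindler_real)
      fix s t :: real
      have "(\<lambda>j\<in>insert i I. u * (x(i := s)) j + v * (y(i := t)) j) = z(i := u * s + v * t)"
        using insert.hyps by (auto simp: z_def fun_eq_iff restrict_def)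
      with insert.prems(4)[OF sp[OF xy(1), of s] sp[OF xy(2), of t]]
      show "geo_mean_le u v (f (x(i := s))) (g (y(i := t))) (h (z(i := u * s + v * t)))" by (simp only:)
    next
      show "(\<lambda>s. f (x(i := s))) \<in> borel_measurable borel"
        by (rule measurable_compose[OF up[OF xy(1)] meas(1)])
      show "(\<lambda>s. g (y(i := s))) \<in> borel_measurable borel"
        by (rule measurable_compose[OF up[OF xy(2)] meas(2)])
      show "(\<lambda>s. h (z(i := s))) \<in> borel_measurable borel"
        by (rule measurable_compose[OF up[OF z] meas(3)])
    qed (use uv in auto)
  qed (rule m2[OF meas(1)] m2[OF meas(2)] m2[OF meas(3)])+
qed

theorem prekopa_leindler:
  fixes f g h :: "'a::euclidean_space \<Rightarrow> ennreal"
  assumes [measurable]: "f \<in> borel_measurable borel" "g \<in> borel_measurable borel" "h \<in> borel_measurable borel"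
    and uv: "0 < u" "0 < v" "u + v = 1"
    and le: "\<And>x y. geo_mean_le u v (f x) (g y) (h (u *\<^sub>R x + v *\<^sub>R y))"
  shows "geo_mean_le u v (\<integral>\<^sup>+x. f x \<partial>lborel) (\<integral>\<^sup>+x. g x \<partial>lborel) (\<integral>\<^sup>+x. h x \<partial>lborel)"
proof -
  let ?P = "Pi\<^sub>M (Basis::'a set) (\<lambda>_. lborel :: real measure)"
  let ?e = "\<lambda>x. \<Sum>b\<in>(Basis::'a set). x b *\<^sub>R b"
  have [measurable]: "?e \<in> ?P \<rightarrow>\<^sub>M borel" by measurable
  have eq: "(\<integral>\<^sup>+x. k x \<partial>lborel) = integral\<^sup>N ?P (\<lambda>x. k (?e x))" if [measurable]: "k \<in> borel_measurable borel" for k :: "'a \<Rightarrow> ennreal"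
    by (subst lborel_eq) (simp add: nn_integral_distr)
  have comb: "?e (\<lambda>b\<in>Basis. u * x b + v * y b) = u *\<^sub>R ?e x + v *\<^sub>R ?e y" for x y
    by (simp add: scaleR_sum_right sum.distrib[symmetric] scaleR_add_left)
  show ?thesis
    unfolding eq[OF assms(1)] eq[OF assms(2)] eq[OF assms(3)]
    by (rule prekopa_leindler_PiM[OF finite_Basis uv], measurable, unfold comb, rule le)
qed

section \<open>Fortet's monotone scheme for the Schroedinger system\<close>

text \<open>An abstract form of the system \<open>f P g = E\<close>, \<open>g P f = G\<close> for a symmetric Markov kernel.  The last
assumption is the one that prevents blow-up: a function below \<open>G\<close> whose average reaches \<open>E\<close> somewhere
cannot have small mass.\<close>

locale schroedinger = prob_space M for M :: "'a measure" +
  fixes k :: "'a \<Rightarrow> 'a \<Rightarrow> ennreal" and E G :: "'a \<Rightarrow> ennreal" and \<delta> :: ennreal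
  assumes space_UNIV: "space M = UNIV"
    and k_measurable[measurable]: "case_prod k \<in> borel_measurable (M \<Otimes>\<^sub>M M)"
    and k_sym: "k x y = k y x"
    and k_pos: "0 < k x y"
    and k_markov: "(\<integral>\<^sup>+y. k x y \<partial>M) = 1"
    and E_measurable[measurable]: "E \<in> borel_measurable M"
    and G_measurable[measurable]: "G \<in> borel_measurable M"
    and E_pos: "0 < E x" and E_finite: "E x < \<infinity>" and G_finite: "G y < \<infinity>"
    and E_mass: "(\<integral>\<^sup>+x. E x \<partial>M) = 1" and G_mass: "(\<integral>\<^sup>+y. G y \<partial>M) = 1"
    and kG_finite: "(\<integral>\<^sup>+y. k x y * G y \<partial>M) < \<infinity>"
    and \<delta>_pos: "0 < \<delta>"
    and confined: "h \<in> borel_measurable M \<Longrightarrow> (\<And>y. h y \<le> G y) \<Longrightarrow>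
      E x \<le> (\<integral>\<^sup>+y. k x y * h y \<partial>M) \<Longrightarrow> \<delta> \<le> (\<integral>\<^sup>+y. h y \<partial>M)"
begin

definition P :: "('a \<Rightarrow> ennreal) \<Rightarrow> 'a \<Rightarrow> ennreal" where
  "P h x = (\<integral>\<^sup>+y. k x y * h y \<partial>M)"

text \<open>The second potential determined by the first one through the second equation of the system.  A point
where \<open>P f\<close> is infinite gets the value \<open>0\<close>.\<close>

definition dual :: "('a \<Rightarrow> ennreal) \<Rightarrow> 'a \<Rightarrow> ennreal" where
  "dual f y = G y / P f y"

definition step :: "('a \<Rightarrow> ennreal) \<Rightarrow> 'a \<Rightarrow> ennreal" where
  "step f x = max 1 (E x / P (dual f) x)"

definition iter :: "nat \<Rightarrow> 'a \<Rightarrow> ennreal" where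
  "iter n = (step ^^ n) (\<lambda>_. 1)"

lemma iter_0: "iter 0 = (\<lambda>_. 1)" and iter_Suc: "iter (Suc n) = step (iter n)"
  by (simp_all add: iter_def)

lemma k_measurable1[measurable]: "k x \<in> borel_measurable M"
  using measurable_compose[OF measurable_Pair1' k_measurable, of x] by (simp add: space_UNIV)

lemma P_measurable[measurable]:
  assumes [measurable]: "h \<in> borel_measurable M" shows "P h \<in> borel_measurable M"
  unfolding P_def[abs_def] by measurable

lemma dual_measurable[measurable]:
  assumes [measurable]: "f \<in> borel_measurable M" shows "dual f \<in> borel_measurable M"
  unfolding dual_def[abs_def] by measurable

lemma step_measurable[measurable]:
  assumes [measurable]: "f \<in> borel_measurable M" shows "step f \<in> borel_measurable M"
  unfolding step_def[abs_def] by measurable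

lemma iter_measurable[measurable]: "iter n \<in> borel_measurable M"
  by (induction n) (simp_all add: iter_0 iter_Suc step_measurable)

lemma P_mono: "(\<And>y. f y \<le> h y) \<Longrightarrow> P f x \<le> P h x"
  unfolding P_def by (intro nn_integral_mono mult_left_mono) auto

lemma P_cong_AE: "AE y in M. f y = h y \<Longrightarrow> P f = P h"
  unfolding P_def fun_eq_iff by (intro allI nn_integral_cong_AE) auto

lemma P_one: "P (\<lambda>_. 1) x = 1"
  by (simp add: P_def k_markov)

lemma P_ge_1: "(\<And>y. 1 \<le> f y) \<Longrightarrow> 1 \<le> P f x"
  using P_mono[of "\<lambda>_. 1" f x] by (simp add: P_one)

lemma nn_integral_P_swap:
  assumes [measurable]: "f \<in> borel_measurable M" "g \<in> borel_measurable M"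
  shows "(\<integral>\<^sup>+x. f x * P g x \<partial>M) = (\<integral>\<^sup>+y. g y * P f y \<partial>M)"
proof -
  interpret pair_sigma_finite M M ..
  have "(\<integral>\<^sup>+x. f x * P g x \<partial>M) = (\<integral>\<^sup>+x. \<integral>\<^sup>+y. f x * (k x y * g y) \<partial>M \<partial>M)"
    unfolding P_def by (intro nn_integral_cong nn_integral_cmult[symmetric]) measurable
  also have "\<dots> = (\<integral>\<^sup>+y. \<integral>\<^sup>+x. f x * (k x y * g y) \<partial>M \<partial>M)"
    by (rule Fubini'[symmetric]) measurable
  also have "\<dots> = (\<integral>\<^sup>+y. \<integral>\<^sup>+x. g y * (k y x * f x) \<partial>M \<partial>M)"
    by (simp add: k_sym mult_ac)
  also have "\<dots> = (\<integral>\<^sup>+y. g y * P f y \<partial>M)"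
    unfolding P_def by (intro nn_integral_cong nn_integral_cmult) measurable
  finally show ?thesis .
qed

lemma P_SUP:
  assumes "incseq F" and [measurable]: "\<And>n. F n \<in> borel_measurable M"
  shows "P (\<lambda>y. SUP n. F n y) x = (SUP n. P (F n) x)"
proof -
  have "P (\<lambda>y. SUP n. F n y) x = (\<integral>\<^sup>+y. (SUP n. k x y * F n y) \<partial>M)"
    unfolding P_def by (simp add: SUP_mult_left_ennreal)
  also have "\<dots> = (SUP n. P (F n) x)"
    unfolding P_def using assms(1)
    by (intro nn_integral_monotone_convergence_SUP)
       (auto simp: incseq_def le_fun_def intro!: mult_left_mono)
  finally show ?thesis .
qed

text \<open>Domination by \<open>G\<close>, whose average is finite, allows monotone convergence from above.\<close>

lemma P_INF:
  assumes "decseq F" and [measurable]: "\<And>n. F n \<in> borel_measurable M"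
    and le: "\<And>n y. F n y \<le> G y"
  shows "P (\<lambda>y. INF n. F n y) x = (INF n. P (F n) x)"
proof -
  have kfin: "AE y in M. k x y < \<infinity>"
  proof -
    have "(\<integral>\<^sup>+y. k x y \<partial>M) \<noteq> \<infinity>" by (simp add: k_markov)
    then have "AE y in M. k x y \<noteq> \<infinity>" by (intro nn_integral_PInf_AE) auto
    then show ?thesis by (auto simp: less_top)
  qed
  have "P (\<lambda>y. INF n. F n y) x = (\<integral>\<^sup>+y. (INF n. k x y * F n y) \<partial>M)"
    unfolding P_def
  proof (rule nn_integral_cong_AE, use kfin in eventually_elim)
    fix y assume fin: "k x y < \<infinity>"
    have dec: "decseq (\<lambda>n. F n y)" by (rule decseq_pointwise) fact
    have "(\<lambda>n. k x y * F n y) \<longlonglongrightarrow> k x y * (INF n. F n y)"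
      using fin dec by (intro ennreal_tendsto_cmult LIMSEQ_INF) auto
    moreover have "(\<lambda>n. k x y * F n y) \<longlonglongrightarrow> (INF n. k x y * F n y)"
      using dec by (intro LIMSEQ_INF decseq_SucI mult_left_mono decseq_SucD[OF dec]) auto
    ultimately show "k x y * (INF n. F n y) = (INF n. k x y * F n y)"
      by (rule LIMSEQ_unique)
  qed
  also have "\<dots> = (INF n. P (F n) x)"
    unfolding P_def
  proof (rule nn_integral_monotone_convergence_INF_decseq[where i=0])
    show "decseq (\<lambda>n y. k x y * F n y)"
      by (rule decseq_SucI, rule le_funI, rule mult_left_mono, rule decseq_SucD,
          rule decseq_pointwise, rule assms(1), simp)
    have "(\<integral>\<^sup>+y. k x y * F 0 y \<partial>M) \<le> (\<integral>\<^sup>+y. k x y * G y \<partial>M)"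
      by (intro nn_integral_mono mult_left_mono le) auto
    then show "(\<integral>\<^sup>+y. k x y * F 0 y \<partial>M) < \<infinity>" using kG_finite le_less_trans by blast
  qed (measurable)
  finally show ?thesis .
qed

lemma P_eq_0_iff:
  assumes [measurable]: "h \<in> borel_measurable M"
  shows "P h x = 0 \<longleftrightarrow> (\<integral>\<^sup>+y. h y \<partial>M) = 0"
proof -
  have "k x y \<noteq> 0" for y using k_pos[of x y] by auto
  then show ?thesis unfolding P_def by (simp add: nn_integral_0_iff_AE)
qed

lemma step_mono: "(\<And>x. f x \<le> h x) \<Longrightarrow> step f x \<le> step h x"
  unfolding step_def dual_def by (intro max.mono ennreal_divide_antimono P_mono) auto

lemma step_ge_1: "1 \<le> step f x"
  by (simp add: step_def)

lemma iter_ge_1: "1 \<le> iter n x"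
  by (cases n) (simp_all add: iter_0 iter_Suc step_ge_1)

lemma iter_le_Suc: "iter n x \<le> iter (Suc n) x"
proof (induction n arbitrary: x)
  case 0 then show ?case by (simp add: iter_0 iter_Suc step_ge_1)
next
  case (Suc n) then show ?case by (simp only: iter_Suc) (rule step_mono)
qed

lemma incseq_iter: "incseq iter"
  by (rule incseq_SucI) (simp add: le_fun_def iter_le_Suc)

lemma dual_le: "(\<And>x. 1 \<le> f x) \<Longrightarrow> dual f y \<le> G y"
  using ennreal_divide_antimono[OF P_ge_1, of f "G y" y] by (simp add: dual_def divide_ennreal_def)

lemma P_dual_finite: "(\<And>x. 1 \<le> f x) \<Longrightarrow> P (dual f) x < \<infinity>"
  using P_mono[of "dual f" G x, OF dual_le] kG_finite[of x] unfolding P_def by (rule le_less_trans)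

text \<open>The averages of the iterates could become infinite on the support of \<open>G\<close>, which would make the dual
potential vanish there.  Inductively this does not happen: \<open>f\<^sub>n\<^sub>+\<^sub>1 \<le> 1 + E / P g\<^sub>n\<close>, hence
\<open>\<integral> g\<^sub>n P f\<^sub>n\<^sub>+\<^sub>1 = \<integral> f\<^sub>n\<^sub>+\<^sub>1 P g\<^sub>n \<le> 2\<close>, and \<open>g\<^sub>n > 0\<close> where \<open>G > 0\<close>.\<close>

lemma P_iter_finite: "AE y in M. 0 < G y \<longrightarrow> P (iter n) y < \<infinity>"
proof (induction n)
  case 0 then show ?case by (simp add: iter_0 P_one)
next
  case (Suc n)
  let ?g = "dual (iter n)"
  have "(\<integral>\<^sup>+y. ?g y * P (iter (Suc n)) y \<partial>M) = (\<integral>\<^sup>+x. iter (Suc n) x * P ?g x \<partial>M)"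
    by (rule nn_integral_P_swap[symmetric]) measurable
  also have "\<dots> \<le> (\<integral>\<^sup>+x. 1 * P ?g x + E x \<partial>M)"
  proof (rule nn_integral_mono)
    fix x
    have "iter (Suc n) x * P ?g x \<le> (1 + E x / P ?g x) * P ?g x"
      unfolding iter_Suc step_def by (intro mult_right_mono) (auto simp: max_def)
    also have "\<dots> \<le> 1 * P ?g x + E x"
      unfolding distrib_right by (intro add_mono order_refl ennreal_divide_mult_le)
    finally show "iter (Suc n) x * P ?g x \<le> 1 * P ?g x + E x" .
  qed
  also have "\<dots> = (\<integral>\<^sup>+y. ?g y * P (\<lambda>_. 1) y \<partial>M) + 1"
    using nn_integral_P_swap[of "\<lambda>_. 1" ?g] by (subst nn_integral_add) (simp_all add: E_mass)
  also have "\<dots> \<le> (\<integral>\<^sup>+y. G y \<partial>M) + 1"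
    by (intro add_mono nn_integral_mono) (auto simp: P_one dual_le iter_ge_1)
  also have "\<dots> < \<infinity>" by (simp add: G_mass)
  finally have "AE y in M. ?g y * P (iter (Suc n)) y \<noteq> \<infinity>"
    by (intro nn_integral_PInf_AE) auto
  with Suc show ?case
  proof eventually_elim
    case (elim y)
    show ?case
    proof
      assume "0 < G y"
      then have "?g y \<noteq> 0" using elim(1) by (auto simp: dual_def ennreal_divide_eq_0_iff less_top)
      then show "P (iter (Suc n)) y < \<infinity>"
        using elim(2) by (auto simp: ennreal_mult_eq_top_iff less_top)
    qed
  qed
qed

lemma dual_mult_P:
  assumes "\<And>x. 1 \<le> f x" "0 < G y \<longrightarrow> P f y < \<infinity>"
  shows "dual f y * P f y = G y"
proof (cases "G y = 0")
  case False
  then show ?thesis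
    using assms P_ge_1[of f y] unfolding dual_def
    by (intro ennreal_divide_mult_cancel) (auto simp: zero_less_iff_neq_zero)
qed (simp add: dual_def)

lemma iter_mass: "(\<integral>\<^sup>+x. iter n x * P (dual (iter n)) x \<partial>M) = 1"
proof -
  have "(\<integral>\<^sup>+x. iter n x * P (dual (iter n)) x \<partial>M) = (\<integral>\<^sup>+y. dual (iter n) y * P (iter n) y \<partial>M)"
    by (rule nn_integral_P_swap) measurable
  also have "\<dots> = (\<integral>\<^sup>+y. G y \<partial>M)"
    using P_iter_finite[of n] by (intro nn_integral_cong_AE) (auto intro!: dual_mult_P iter_ge_1)
  finally show ?thesis by (simp add: G_mass)
qed

lemma dual_iter_mass: "(\<integral>\<^sup>+y. dual (iter n) y \<partial>M) \<noteq> 0"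
proof
  assume "(\<integral>\<^sup>+y. dual (iter n) y \<partial>M) = 0"
  then have "P (dual (iter n)) x = 0" for x by (subst P_eq_0_iff) auto
  then show False using iter_mass[of n] by simp
qed

lemma P_dual_iter_pos: "0 < P (dual (iter n)) x"
  using dual_iter_mass[of n] P_eq_0_iff[of "dual (iter n)" x] by (auto simp: zero_less_iff_neq_zero)

text \<open>Under the assumption the truncation at \<open>1\<close> is inactive, so \<open>f\<^sub>n\<^sub>+\<^sub>1 P g\<^sub>n = E\<close> has integral \<open>1\<close>, like
\<open>f\<^sub>n P g\<^sub>n\<close>.  As \<open>f\<^sub>n \<le> f\<^sub>n\<^sub>+\<^sub>1\<close>, the two iterates agree almost everywhere, and \<open>step\<close> sees only the
almost everywhere class of its argument.\<close>

lemma iter_stationary: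
  assumes "\<And>x. P (dual (iter n)) x < E x"
  shows "step (iter (Suc n)) = iter (Suc n)"
proof -
  let ?p = "P (dual (iter n))"
  have fin: "?p x < \<infinity>" for x by (rule P_dual_finite) (rule iter_ge_1)
  have eq: "iter (Suc n) x * ?p x = E x" for x
  proof -
    have "1 = ?p x / ?p x" using P_dual_iter_pos[of n x] fin[of x] by (simp add: ennreal_divide_self)
    also have "\<dots> \<le> E x / ?p x" using assms[of x] by (intro divide_right_mono_ennreal) simp
    finally have "iter (Suc n) x = E x / ?p x" by (simp add: iter_Suc step_def max_def)
    then show ?thesis using P_dual_iter_pos[of n x] fin[of x] by (simp add: ennreal_divide_mult_cancel)
  qed
  have "AE x in M. iter n x * ?p x = iter (Suc n) x * ?p x"
  proof (rule AE_eq_of_nn_integral_le)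
    show "AE x in M. iter n x * ?p x \<le> iter (Suc n) x * ?p x"
      by (intro AE_I2 mult_right_mono iter_le_Suc) simp
  qed (simp_all add: iter_mass eq E_mass)
  then have "AE x in M. iter n x = iter (Suc n) x"
  proof eventually_elim
    case (elim x)
    have "iter m x = iter m x * ?p x / ?p x" for m
      using P_dual_iter_pos[of n x] fin[of x] by (simp add: ennreal_mult_divide_eq)
    with elim show ?case by metis
  qed
  \<comment> \<open>From almost everywhere to everywhere: averaging does not see null sets.\<close>
  then have "P (iter n) = P (iter (Suc n))" by (rule P_cong_AE)
  then have "step (iter n) = step (iter (Suc n))" by (simp add: step_def[abs_def] dual_def[abs_def])
  then show ?thesis by (simp add: iter_Suc)
qed

definition limit :: "'a \<Rightarrow> ennreal" where
  "limit x = (SUP n. iter n x)"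

lemma limit_measurable[measurable]: "limit \<in> borel_measurable M"
  unfolding limit_def[abs_def] by measurable

lemma decseq_dual_iter: "decseq (\<lambda>n. dual (iter n))"
  by (intro decseq_SucI le_funI) (auto simp: dual_def intro!: ennreal_divide_antimono P_mono iter_le_Suc)

lemma dual_limit: "dual limit y = (INF n. dual (iter n) y)"
proof -
  have inc: "incseq (\<lambda>n. P (iter n) y)"
    using incseq_iter unfolding incseq_def le_fun_def by (auto intro!: P_mono)
  have "(\<lambda>n. P (iter n) y) \<longlonglongrightarrow> P limit y"
    unfolding limit_def[abs_def] using LIMSEQ_SUP[OF inc] by (subst P_SUP[OF incseq_iter]) auto
  then have "(\<lambda>n. dual (iter n) y) \<longlonglongrightarrow> dual limit y"
    unfolding dual_def by (intro ennreal_tendsto_divide_const G_finite)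
  moreover have "(\<lambda>n. dual (iter n) y) \<longlonglongrightarrow> (INF n. dual (iter n) y)"
    by (rule LIMSEQ_INF, rule decseq_pointwise, rule decseq_dual_iter)
  ultimately show ?thesis by (rule LIMSEQ_unique)
qed

text \<open>Every operation in \<open>step\<close> is continuous along the scheme: the averages of the iterates converge
monotonically from below, those of their duals monotonically from above.\<close>

lemma step_limit: "step limit = limit"
proof
  fix x
  have P: "P (dual limit) x = (INF n. P (dual (iter n)) x)"
    using P_INF[OF decseq_dual_iter, of x] by (simp add: dual_limit[abs_def] dual_le iter_ge_1)
  have "decseq (\<lambda>n. P (dual (iter n)) x)"
    by (rule decseq_SucI, rule P_mono, rule decseq_SucD[OF decseq_pointwise], rule decseq_dual_iter)
  from LIMSEQ_INF[OF this] have "(\<lambda>n. P (dual (iter n)) x) \<longlonglongrightarrow> P (dual limit) x" by (simp add: P)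
  then have "(\<lambda>n. step (iter n) x) \<longlonglongrightarrow> step limit x"
    unfolding step_def by (intro tendsto_max tendsto_const ennreal_tendsto_divide_const E_finite)
  moreover have "(\<lambda>n. step (iter n) x) \<longlonglongrightarrow> limit x"
  proof -
    have "incseq (\<lambda>n. iter n x)" using incseq_iter by (auto simp: incseq_def le_fun_def)
    from LIMSEQ_Suc[OF LIMSEQ_SUP[OF this]] show ?thesis by (simp add: iter_Suc limit_def)
  qed
  ultimately show "step limit x = limit x" by (rule LIMSEQ_unique)
qed

text \<open>By confinement each dual iterate has mass at least \<open>\<delta>\<close>, and this bound passes to the decreasing limit.\<close>

lemma dual_limit_mass:
  assumes "\<And>n. \<exists>x. E x \<le> P (dual (iter n)) x"
  shows "(\<integral>\<^sup>+y. dual limit y \<partial>M) \<noteq> 0"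
proof -
  have "\<delta> \<le> (\<integral>\<^sup>+y. dual (iter n) y \<partial>M)" for n
    using assms[of n] by (auto simp: P_def intro!: confined dual_le iter_ge_1)
  then have "\<delta> \<le> (INF n. \<integral>\<^sup>+y. dual (iter n) y \<partial>M)" by (intro INF_greatest)
  also have "\<dots> = (\<integral>\<^sup>+y. dual limit y \<partial>M)"
    unfolding dual_limit
  proof (rule nn_integral_monotone_convergence_INF_decseq[where i=0, symmetric])
    have "(\<integral>\<^sup>+y. dual (iter 0) y \<partial>M) \<le> (\<integral>\<^sup>+y. G y \<partial>M)"
      by (intro nn_integral_mono dual_le iter_ge_1)
    then show "(\<integral>\<^sup>+y. dual (iter 0) y \<partial>M) < \<infinity>" by (simp add: G_mass le_less_trans)
  qed (simp_all add: decseq_dual_iter)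
  finally show ?thesis using \<delta>_pos by auto
qed

text \<open>Either the truncation is active at some point for every iterate, and the limit of the scheme is the fixed
point, or it becomes inactive and the scheme is stationary from then on.  The predicate \<open>Q\<close> carries
properties such as log-convexity along the scheme.\<close>

theorem fixed_point_exists:
  assumes Q_one: "Q (\<lambda>_. 1)"
    and Q_step: "\<And>f. f \<in> borel_measurable M \<Longrightarrow> (\<And>x. 1 \<le> f x) \<Longrightarrow> Q f \<Longrightarrow> Q (step f)"
    and Q_SUP: "\<And>F. incseq F \<Longrightarrow> (\<And>n. Q (F n)) \<Longrightarrow> Q (\<lambda>x. SUP n. F n x)"
  shows "\<exists>f\<in>borel_measurable M. step f = f \<and> (\<integral>\<^sup>+y. dual f y \<partial>M) \<noteq> 0 \<and> Q f"
proof -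
  have Q_iter: "Q (iter n)" for n
    by (induction n) (simp_all add: iter_0 iter_Suc Q_one Q_step iter_ge_1)
  show ?thesis
  proof (cases "\<forall>n. \<exists>x. E x \<le> P (dual (iter n)) x")
    case True
    have "Q limit" unfolding limit_def[abs_def] by (intro Q_SUP incseq_iter Q_iter)
    then show ?thesis using True by (intro bexI[of _ limit]) (auto simp: step_limit dual_limit_mass)
  next
    case False
    then obtain n where "\<And>x. P (dual (iter n)) x < E x" by (auto simp: not_le)
    then have "step (iter (Suc n)) = iter (Suc n)" by (rule iter_stationary)
    then show ?thesis using dual_iter_mass[of "Suc n"] Q_iter[of "Suc n"]
      by (intro bexI[of _ "iter (Suc n)"]) auto
  qed
qed

context
  fixes f :: "'a \<Rightarrow> ennreal"
  assumes f_measurable[measurable]: "f \<in> borel_measurable M"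
    and fixed: "step f = f" and nonzero: "(\<integral>\<^sup>+y. dual f y \<partial>M) \<noteq> 0"
begin

lemma fixed_ge_1: "1 \<le> f x"
  using step_ge_1[of f x] by (simp add: fixed)

lemma P_dual_fixed_pos: "0 < P (dual f) x"
  using nonzero P_eq_0_iff[of "dual f" x] by (auto simp: zero_less_iff_neq_zero)

lemma fixed_eq: "f x = max 1 (E x / P (dual f) x)"
  by (subst fixed[symmetric]) (simp add: step_def)

lemma fixed_finite: "f x < \<infinity>"
proof -
  have "E x / P (dual f) x \<noteq> \<infinity>"
    using E_finite[of x] P_dual_fixed_pos[of x] by (auto simp: ennreal_divide_eq_top_iff)
  then have "E x / P (dual f) x < \<infinity>" by (simp add: less_top)
  then show ?thesis by (subst fixed_eq) (auto simp: max_def)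
qed

lemma fixed_mult_P_ge: "E x \<le> f x * P (dual f) x"
proof -
  have "E x = E x / P (dual f) x * P (dual f) x"
    using P_dual_fixed_pos[of x] P_dual_finite[of f x, OF fixed_ge_1] by (simp add: ennreal_divide_mult_cancel)
  also have "\<dots> \<le> f x * P (dual f) x"
    by (intro mult_right_mono) (subst fixed_eq, simp, simp)
  finally show ?thesis .
qed

text \<open>At a fixed point \<open>f P g \<ge> E\<close> and \<open>g P f \<le> G\<close>, while the integrals of the two left-hand sides coincide by
symmetry of the kernel and those of the two right-hand sides are both \<open>1\<close>.\<close>

lemma fixed_marginals:
  "AE x in M. f x * P (dual f) x = E x" "AE y in M. dual f y * P f y = G y"
proof -
  have swap: "(\<integral>\<^sup>+x. f x * P (dual f) x \<partial>M) = (\<integral>\<^sup>+y. dual f y * P f y \<partial>M)"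
    by (rule nn_integral_P_swap) measurable
  have le: "dual f y * P f y \<le> G y" for y
    unfolding dual_def by (rule ennreal_divide_mult_le)
  have 1: "(\<integral>\<^sup>+y. dual f y * P f y \<partial>M) \<le> 1"
    unfolding G_mass[symmetric] by (intro nn_integral_mono le)
  have 2: "1 \<le> (\<integral>\<^sup>+x. f x * P (dual f) x \<partial>M)"
    unfolding E_mass[symmetric] by (intro nn_integral_mono fixed_mult_P_ge)
  have "AE x in M. E x = f x * P (dual f) x"
    by (rule AE_eq_of_nn_integral_le) (use 1 swap in \<open>auto simp: fixed_mult_P_ge E_mass\<close>)
  then show "AE x in M. f x * P (dual f) x = E x" by eventually_elim simp
  show "AE y in M. dual f y * P f y = G y"
    by (rule AE_eq_of_nn_integral_le) (use 1 2 swap le in \<open>auto simp: G_mass intro: le_less_trans\<close>)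
qed

end

end

section \<open>The Gaussian measure and the Mehler kernel\<close>

definition gauss :: "'a::euclidean_space \<Rightarrow> real" where
  "gauss x = (\<Prod>b\<in>Basis. std_normal_density (x \<bullet> b))"

lemma gauss_eq: "gauss (x::'a::euclidean_space) = (1 / sqrt (2 * pi)) ^ DIM('a) * exp (- (norm x)\<^sup>2 / 2)"
proof -
  have "gauss x = (\<Prod>b\<in>Basis. 1 / sqrt (2 * pi) * exp (- (x \<bullet> b)\<^sup>2 / 2))"
    by (simp add: gauss_def std_normal_density_def)
  also have "\<dots> = (1 / sqrt (2 * pi)) ^ DIM('a) * exp (\<Sum>b\<in>Basis. - (x \<bullet> b)\<^sup>2 / 2)"
    by (simp only: prod.distrib exp_sum[OF finite_Basis] prod_constant)
  also have "(\<Sum>b\<in>Basis. - (x \<bullet> b)\<^sup>2 / 2) = - (norm x)\<^sup>2 / 2"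
    unfolding power2_norm_eq_inner euclidean_inner[of x x]
    by (simp add: sum_negf sum_divide_distrib[symmetric] power2_eq_square)
  finally show ?thesis .
qed

lemma gauss_pos: "0 < gauss x"
  by (simp add: gauss_eq)

lemma gauss_measurable[measurable]: "gauss \<in> borel_measurable borel"
  unfolding gauss_def[abs_def] by measurable

lemma std_gaussian_eq: "std_gaussian = density lborel (\<lambda>x. ennreal (gauss x))"
  by (simp add: std_gaussian_def gauss_def)

lemma sets_std_gaussian[measurable_cong]: "sets std_gaussian = sets borel"
  by (simp add: std_gaussian_def)

lemma space_std_gaussian: "space std_gaussian = UNIV"
  by (simp add: std_gaussian_def)

lemma nn_integral_std_gaussian:
  assumes [measurable]: "h \<in> borel_measurable borel"
  shows "(\<integral>\<^sup>+x. h x \<partial>std_gaussian) = (\<integral>\<^sup>+x. ennreal (gauss x) * h x \<partial>lborel)"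
  unfolding std_gaussian_eq by (subst nn_integral_density) auto

lemma AE_std_gaussian_iff:
  "(AE x in std_gaussian. Q x) \<longleftrightarrow> (AE x in lborel. Q x)"
  unfolding std_gaussian_eq by (subst AE_density) (auto simp: gauss_pos)

lemma prob_space_std_gaussian: "prob_space (std_gaussian :: 'a::euclidean_space measure)"
proof (rule prob_spaceI)
  have "(\<integral>\<^sup>+x. ennreal (std_normal_density x) \<partial>lborel) = 1"
  proof -
    have "emeasure (density lborel std_normal_density) (space (density lborel std_normal_density)) = 1"
      by (intro prob_space.emeasure_space_1 prob_space_normal_density) simp
    then show ?thesis by (simp add: emeasure_density)
  qed
  then have "(\<integral>\<^sup>+x. (\<Prod>b\<in>(Basis::'a set). ennreal (std_normal_density (x \<bullet> b))) \<partial>lborel) = 1"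
    by (subst nn_integral_lborel_prod) auto
  then have "(\<integral>\<^sup>+x. ennreal (gauss (x::'a)) \<partial>lborel) = 1"
    by (simp add: gauss_def prod_ennreal)
  then show "emeasure (std_gaussian :: 'a measure) (space std_gaussian) = 1"
    by (simp add: std_gaussian_eq emeasure_density)
qed

text \<open>With \<open>b\<^sup>2 = 1 - a\<^sup>2\<close>, this is the density of the normal law \<open>N(a x, b\<^sup>2 I)\<close> at \<open>y\<close>, divided by the standard
Gaussian density at \<open>y\<close>.\<close>

definition mehler :: "real \<Rightarrow> 'a::euclidean_space \<Rightarrow> 'a \<Rightarrow> real" where
  "mehler a x y = (1 / sqrt (1 - a\<^sup>2)) ^ DIM('a) *
     exp ((2 * a * (x \<bullet> y) - a\<^sup>2 * (norm x)\<^sup>2 - a\<^sup>2 * (norm y)\<^sup>2) / (2 * (1 - a\<^sup>2)))"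

lemma mehler_sym: "mehler a x y = mehler a y x"
  by (simp add: mehler_def inner_commute)

lemma mehler_measurable[measurable]: "(\<lambda>z. mehler a (fst z) (snd z)) \<in> borel_measurable (borel \<Otimes>\<^sub>M borel)"
  unfolding mehler_def by measurable

context
  fixes a b :: real
  assumes a: "0 < a" "a < 1" and b: "b = sqrt (1 - a\<^sup>2)"
begin

lemma mehler_sd_pos: "0 < b" and mehler_sd_sq: "b\<^sup>2 = 1 - a\<^sup>2"
proof -
  have "a\<^sup>2 < 1" using a by (simp add: power_less_one_iff abs_square_less_1)
  then show "0 < b" "b\<^sup>2 = 1 - a\<^sup>2" by (simp_all add: b)
qed

lemma mehler_eq:
  fixes x y :: "'a::euclidean_space"
  shows "mehler a x y = (1 / b) ^ DIM('a) *
    exp ((2 * a * (x \<bullet> y) - a\<^sup>2 * (norm x)\<^sup>2 - a\<^sup>2 * (norm y)\<^sup>2) / (2 * b\<^sup>2))"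
  by (simp add: mehler_def mehler_sd_sq flip: b)

lemma mehler_pos: "0 < mehler a x y"
  using mehler_sd_pos by (simp add: mehler_eq)

lemma gauss_mult_mehler:
  fixes x y :: "'a::euclidean_space"
  shows "gauss y * mehler a x y
    = (1 / b) ^ DIM('a) * ((1 / sqrt (2 * pi)) ^ DIM('a) * exp (- (norm (y - a *\<^sub>R x))\<^sup>2 / (2 * b\<^sup>2)))"
proof -
  have "- (norm y)\<^sup>2 / 2 + (2 * a * (x \<bullet> y) - a\<^sup>2 * (norm x)\<^sup>2 - a\<^sup>2 * (norm y)\<^sup>2) / (2 * b\<^sup>2)
      = (- (b\<^sup>2 + a\<^sup>2) * (norm y)\<^sup>2 + 2 * a * (x \<bullet> y) - a\<^sup>2 * (norm x)\<^sup>2) / (2 * b\<^sup>2)"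
    using mehler_sd_pos by (simp add: field_simps)
  also have "- (b\<^sup>2 + a\<^sup>2) * (norm y)\<^sup>2 + 2 * a * (x \<bullet> y) - a\<^sup>2 * (norm x)\<^sup>2 = - (norm (y - a *\<^sub>R x))\<^sup>2"
    unfolding mehler_sd_sq power2_norm_eq_inner
    by (simp add: inner_diff_left inner_diff_right inner_commute algebra_simps) (simp add: power2_eq_square)
  finally show ?thesis
    by (simp add: gauss_eq mehler_eq exp_add[symmetric] mult_ac)
qed

lemma gauss_mult_mehler_scaled:
  fixes x z :: "'a::euclidean_space"
  shows "b ^ DIM('a) * (gauss (a *\<^sub>R x + b *\<^sub>R z) * mehler a x (a *\<^sub>R x + b *\<^sub>R z)) = gauss z"
proof -
  have "- (norm (b *\<^sub>R z))\<^sup>2 / (2 * b\<^sup>2) = - (norm z)\<^sup>2 / 2"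
    using mehler_sd_pos by (simp add: power_mult_distrib)
  then show ?thesis
    unfolding gauss_mult_mehler using mehler_sd_pos by (simp add: gauss_eq power_divide)
qed

text \<open>The substitution \<open>y = a x + b z\<close>.\<close>

lemma nn_integral_mehler:
  fixes h :: "'a::euclidean_space \<Rightarrow> ennreal"
  assumes [measurable]: "h \<in> borel_measurable borel"
  shows "(\<integral>\<^sup>+y. ennreal (mehler a x y) * h y \<partial>std_gaussian) = (\<integral>\<^sup>+z. h (a *\<^sub>R x + b *\<^sub>R z) \<partial>std_gaussian)"
proof -
  have [measurable]: "(\<lambda>y. mehler a x y) \<in> borel_measurable borel"
    unfolding mehler_def by measurable
  let ?F = "\<lambda>y. ennreal (gauss y) * (ennreal (mehler a x y) * h y)"
  have "(\<integral>\<^sup>+y. ennreal (mehler a x y) * h y \<partial>std_gaussian) = (\<integral>\<^sup>+y. ?F y \<partial>lborel)"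
    by (subst nn_integral_std_gaussian) auto
  also have "\<dots> = (\<integral>\<^sup>+z. ennreal (b ^ DIM('a)) * ?F (a *\<^sub>R x + b *\<^sub>R z) \<partial>lborel)"
    using mehler_sd_pos by (subst lborel_affine[of b "a *\<^sub>R x"]) (simp_all add: nn_integral_density nn_integral_distr)
  also have "\<dots> = (\<integral>\<^sup>+z. ennreal (gauss z) * h (a *\<^sub>R x + b *\<^sub>R z) \<partial>lborel)"
  proof (rule nn_integral_cong)
    fix z
    show "ennreal (b ^ DIM('a)) * ?F (a *\<^sub>R x + b *\<^sub>R z) = ennreal (gauss z) * h (a *\<^sub>R x + b *\<^sub>R z)"
      unfolding gauss_mult_mehler_scaled[of x z, symmetric]
      using mehler_sd_pos less_imp_le[OF gauss_pos, of "a *\<^sub>R x + b *\<^sub>R z"] less_imp_le[OF mehler_pos, of x "a *\<^sub>R x + b *\<^sub>R z"]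
      by (simp add: ennreal_mult mult.assoc)
  qed
  also have "\<dots> = (\<integral>\<^sup>+z. h (a *\<^sub>R x + b *\<^sub>R z) \<partial>std_gaussian)"
    by (subst nn_integral_std_gaussian) auto
  finally show ?thesis .
qed

lemma mehler_markov: "(\<integral>\<^sup>+y. ennreal (mehler a x y) \<partial>std_gaussian) = 1"
  using nn_integral_mehler[of "\<lambda>_. 1" x] prob_space.emeasure_space_1[OF prob_space_std_gaussian] by simp

text \<open>A bound uniform in \<open>x\<close>: completing the square, \<open>2 a \<bar>x\<bar> r - a\<^sup>2 \<bar>x\<bar>\<^sup>2 \<le> r\<^sup>2\<close>.\<close>

lemma mehler_le:
  fixes x y :: "'a::euclidean_space"
  assumes "norm y \<le> r"
  shows "mehler a x y \<le> (1 / b) ^ DIM('a) * exp (r\<^sup>2 / (2 * b\<^sup>2))"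
proof -
  have "0 \<le> r" using assms norm_ge_zero order_trans by blast
  have "x \<bullet> y \<le> norm x * r"
    using assms by (intro order_trans[OF norm_cauchy_schwarz] mult_left_mono) auto
  then have "2 * a * (x \<bullet> y) \<le> 2 * a * (norm x * r)" using a by (intro mult_left_mono) auto
  moreover have "0 \<le> (r - a * norm x)\<^sup>2" "0 \<le> a\<^sup>2 * (norm y)\<^sup>2" by auto
  ultimately have "2 * a * (x \<bullet> y) - a\<^sup>2 * (norm x)\<^sup>2 - a\<^sup>2 * (norm y)\<^sup>2 \<le> r\<^sup>2"
    by (simp add: power2_eq_square algebra_simps)
  then show ?thesis
    unfolding mehler_eq using mehler_sd_pos by (intro mult_left_mono) (auto intro!: divide_right_mono)
qed

lemma reference_measure_eq:
  assumes \<epsilon>: "a = exp (- \<epsilon> / 2)"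
  shows "(reference_measure \<epsilon> :: ('a::euclidean_space \<times> 'a) measure)
    = density (std_gaussian \<Otimes>\<^sub>M std_gaussian) (\<lambda>(x, y). ennreal (mehler a x y))"
proof -
  interpret N: prob_space "std_gaussian :: 'a measure" by (rule prob_space_std_gaussian)
  interpret pair_sigma_finite "std_gaussian :: 'a measure" "std_gaussian :: 'a measure" ..
  have b': "sqrt (1 - exp (- \<epsilon>)) = b"
    by (simp add: b \<epsilon> power2_eq_square exp_add[symmetric])
  have sets_pair: "sets (std_gaussian \<Otimes>\<^sub>M std_gaussian :: ('a \<times> 'a) measure) = sets borel"
    by (simp add: borel_prod[symmetric] sets_std_gaussian cong: sets_pair_measure_cong)
  let ?\<phi> = "\<lambda>(x, y). (x, exp (- \<epsilon> / 2) *\<^sub>R x + sqrt (1 - exp (- \<epsilon>)) *\<^sub>R (y::'a))"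
  have \<phi>[measurable]: "?\<phi> \<in> std_gaussian \<Otimes>\<^sub>M std_gaussian \<rightarrow>\<^sub>M borel"
    unfolding borel_prod[symmetric] by measurable
  have [measurable]: "(\<lambda>(x::'a, y). ennreal (mehler a x y)) \<in> borel_measurable (std_gaussian \<Otimes>\<^sub>M std_gaussian)"
    unfolding case_prod_beta by measurable
  show ?thesis
  proof (rule measure_eqI)
    show "sets (reference_measure \<epsilon> :: ('a \<times> 'a) measure) =
        sets (density (std_gaussian \<Otimes>\<^sub>M std_gaussian) (\<lambda>(x, y). ennreal (mehler a x y)))"
      by (simp add: reference_measure_def sets_pair)
    fix A :: "('a \<times> 'a) set"
    assume "A \<in> sets (reference_measure \<epsilon>)"
    then have A[measurable]: "A \<in> sets (borel \<Otimes>\<^sub>M borel)"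
      unfolding borel_prod by (simp add: reference_measure_def)
    have A': "A \<in> sets borel" using A unfolding borel_prod .
    have "emeasure (reference_measure \<epsilon>) A = (\<integral>\<^sup>+w. indicator A w \<partial>reference_measure \<epsilon>)"
      using A' by (simp add: reference_measure_def)
    also have "\<dots> = (\<integral>\<^sup>+w. indicator A (?\<phi> w) \<partial>(std_gaussian \<Otimes>\<^sub>M std_gaussian))"
      unfolding reference_measure_def using A' by (subst nn_integral_distr) auto
    also have "\<dots> = (\<integral>\<^sup>+x. \<integral>\<^sup>+z. indicator A (x, a *\<^sub>R x + b *\<^sub>R z) \<partial>std_gaussian \<partial>std_gaussian)"
    proof -
      have "(\<lambda>w. indicator A (?\<phi> w) :: ennreal) \<in> borel_measurable (std_gaussian \<Otimes>\<^sub>M std_gaussian)"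
        using A' by measurable
      from N.nn_integral_fst[OF this, symmetric] show ?thesis by (simp add: \<epsilon> b')
    qed
    also have "\<dots> = (\<integral>\<^sup>+x. \<integral>\<^sup>+y. ennreal (mehler a x y) * indicator A (x, y) \<partial>std_gaussian \<partial>std_gaussian)"
      by (intro nn_integral_cong nn_integral_mehler[symmetric]) measurable
    also have "\<dots> = (\<integral>\<^sup>+w. (\<lambda>(x, y). ennreal (mehler a x y)) w * indicator A w \<partial>(std_gaussian \<Otimes>\<^sub>M std_gaussian))"
      by (subst N.nn_integral_fst[symmetric]) (auto simp: case_prod_beta)
    also have "\<dots> = emeasure (density (std_gaussian \<Otimes>\<^sub>M std_gaussian) (\<lambda>(x, y). ennreal (mehler a x y))) A"
      by (rule emeasure_density[symmetric]) auto
    finally show "emeasure (reference_measure \<epsilon>) A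
        = emeasure (density (std_gaussian \<Otimes>\<^sub>M std_gaussian) (\<lambda>(x, y). ennreal (mehler a x y))) A" .
  qed
qed

end

section \<open>Log-convexity and log-concavity under Gaussian averaging\<close>

text \<open>Log-concavity and log-convexity for functions that may take the value \<open>\<infinity>\<close>, which averages of
log-convex functions do.\<close>

definition log_concave_enn :: "('a::real_vector \<Rightarrow> ennreal) \<Rightarrow> bool" where
  "log_concave_enn F \<longleftrightarrow> (\<forall>u v x y. 0 < u \<longrightarrow> 0 < v \<longrightarrow> u + v = 1 \<longrightarrow>
     geo_mean_le u v (F x) (F y) (F (u *\<^sub>R x + v *\<^sub>R y)))"

definition log_convex_enn :: "('a::real_vector \<Rightarrow> ennreal) \<Rightarrow> bool" where
  "log_convex_enn F \<longleftrightarrow> (\<forall>u v x y A B. 0 < u \<longrightarrow> 0 < v \<longrightarrow> u + v = 1 \<longrightarrow> 0 < A \<longrightarrow> 0 < B \<longrightarrow>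
     F x \<le> ennreal A \<longrightarrow> F y \<le> ennreal B \<longrightarrow> F (u *\<^sub>R x + v *\<^sub>R y) \<le> ennreal (A powr u * B powr v))"

lemma log_convex_ennD:
  "log_convex_enn F \<Longrightarrow> 0 < u \<Longrightarrow> 0 < v \<Longrightarrow> u + v = 1 \<Longrightarrow> 0 < A \<Longrightarrow> 0 < B \<Longrightarrow>
     F x \<le> ennreal A \<Longrightarrow> F y \<le> ennreal B \<Longrightarrow> F (u *\<^sub>R x + v *\<^sub>R y) \<le> ennreal (A powr u * B powr v)"
  unfolding log_convex_enn_def by blast

lemma log_concave_ennD_strict:
  "log_concave_enn F \<Longrightarrow> 0 < u \<Longrightarrow> 0 < v \<Longrightarrow> u + v = 1 \<Longrightarrow> 0 < A \<Longrightarrow> 0 < B \<Longrightarrow>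
     ennreal A < F x \<Longrightarrow> ennreal B < F y \<Longrightarrow> ennreal (A powr u * B powr v) \<le> F (u *\<^sub>R x + v *\<^sub>R y)"
  unfolding log_concave_enn_def geo_mean_le_def by blast

text \<open>The strict bounds of the definition are relaxed by scaling \<open>A\<close> and \<open>B\<close> by \<open>t < 1\<close>, which scales the
geometric mean by \<open>t\<close>.\<close>

lemma log_concave_ennD:
  assumes "log_concave_enn F" "0 < u" "0 < v" "u + v = 1" "0 < A" "0 < B"
    and "ennreal A \<le> F x" "ennreal B \<le> F y"
  shows "ennreal (A powr u * B powr v) \<le> F (u *\<^sub>R x + v *\<^sub>R y)"
proof -
  let ?c = "A powr u * B powr v"
  have "ennreal (t * ?c) \<le> F (u *\<^sub>R x + v *\<^sub>R y)" if t: "0 < t" "t < 1" for t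
  proof -
    have "ennreal (t * A) < ennreal A" "ennreal (t * B) < ennreal B"
      using t assms by (simp_all add: ennreal_less_iff)
    then have "ennreal ((t * A) powr u * (t * B) powr v) \<le> F (u *\<^sub>R x + v *\<^sub>R y)"
      using t assms by (intro log_concave_ennD_strict[OF assms(1)]) (auto intro: less_le_trans)
    then show ?thesis using t assms by (simp add: powr_mult_powr_scale)
  qed
  moreover have "((\<lambda>t. ennreal (t * ?c)) \<longlongrightarrow> ennreal (1 * ?c)) (at_left 1)"
    by (intro tendsto_ennrealI tendsto_intros)
  moreover have "\<forall>\<^sub>F t in at_left (1::real). 0 < t \<and> t < 1"
    using eventually_at_left_real[of 0 1] by (auto elim: eventually_mono)
  ultimately have "ennreal (1 * ?c) \<le> F (u *\<^sub>R x + v *\<^sub>R y)"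
    by (intro tendsto_upperbound[where F = "at_left (1::real)"]) (auto elim: eventually_mono)
  then show ?thesis by simp
qed

lemma log_convex_enn_SUP: "(\<And>n. log_convex_enn (F n)) \<Longrightarrow> log_convex_enn (\<lambda>x. SUP n. F n x)"
  unfolding log_convex_enn_def SUP_le_iff by blast

lemma log_convex_enn_one: "log_convex_enn (\<lambda>_. 1)"
proof -
  have "ennreal 1 \<le> ennreal (A powr u * B powr v)"
    if "0 < u" "0 < v" "1 \<le> ennreal A" "1 \<le> ennreal B" for u v A B
  proof (rule ennreal_leI)
    have "1 \<le> A" "1 \<le> B" using that by (auto simp: one_le_ennreal_iff)
    then have "1 \<le> A powr u" "1 \<le> B powr v" using that by (auto intro: ge_one_powr_ge_zero)
    then show "1 \<le> A powr u * B powr v" using mult_mono[of 1 "A powr u" 1 "B powr v"] by simp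
  qed
  then show ?thesis by (simp add: log_convex_enn_def)
qed

lemma log_convex_enn_max: "log_convex_enn F \<Longrightarrow> log_convex_enn H \<Longrightarrow> log_convex_enn (\<lambda>x. max (F x) (H x))"
  unfolding log_convex_enn_def max.bounded_iff by blast

text \<open>Hoelder's inequality, obtained by integrating Young's inequality normalised by the bounds \<open>A\<close> and \<open>B\<close>.\<close>

lemma log_convex_enn_integral:
  fixes f :: "'a::real_vector \<Rightarrow> ennreal"
  assumes f: "log_convex_enn f" and ge: "\<And>x. 1 \<le> f x"
    and meas: "\<And>x. (\<lambda>z. f (a *\<^sub>R x + b *\<^sub>R z)) \<in> borel_measurable M"
  shows "log_convex_enn (\<lambda>x. \<integral>\<^sup>+z. f (a *\<^sub>R x + b *\<^sub>R z) \<partial>M)"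
  unfolding log_convex_enn_def
proof (intro allI impI)
  fix u v :: real and x y and A B :: real
  assume uv: "0 < u" "0 < v" "u + v = 1" and AB: "0 < A" "0 < B"
    and xA: "(\<integral>\<^sup>+z. f (a *\<^sub>R x + b *\<^sub>R z) \<partial>M) \<le> ennreal A"
    and yB: "(\<integral>\<^sup>+z. f (a *\<^sub>R y + b *\<^sub>R z) \<partial>M) \<le> ennreal B"
  note [measurable] = meas
  let ?c = "A powr u * B powr v"
  \<comment> \<open>Young's inequality for \<open>f s / A\<close> and \<open>f t / B\<close>; the integrals of the two terms add up to at most \<open>(u + v) A\<^sup>u B\<^sup>v\<close>.\<close>
  have pw: "f (u *\<^sub>R s + v *\<^sub>R t) \<le> ennreal (?c * u / A) * f s + ennreal (?c * v / B) * f t" for s t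
  proof (cases "f s = top \<or> f t = top")
    case True
    have "ennreal (?c * u / A) \<noteq> 0" "ennreal (?c * v / B) \<noteq> 0"
      using uv AB by (simp_all add: ennreal_eq_0_iff not_le)
    then have "ennreal (?c * u / A) * f s + ennreal (?c * v / B) * f t = top"
      using True by (auto simp: ennreal_mult_eq_top_iff)
    then show ?thesis by (metis top_greatest)
  next
    case False
    then obtain \<alpha> where \<alpha>: "f s = ennreal \<alpha>" "0 \<le> \<alpha>" by (cases "f s") auto
    from False obtain \<beta> where \<beta>: "f t = ennreal \<beta>" "0 \<le> \<beta>" by (cases "f t") auto
    have "1 \<le> \<alpha>" "1 \<le> \<beta>" using ge[of s] ge[of t] \<alpha> \<beta> by (simp_all add: one_le_ennreal_iff)
    then have pos: "0 < \<alpha>" "0 < \<beta>" by auto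
    have "f (u *\<^sub>R s + v *\<^sub>R t) \<le> ennreal (\<alpha> powr u * \<beta> powr v)"
      using log_convex_ennD[OF f uv pos] \<alpha> \<beta> by simp
    also have "\<dots> \<le> ennreal (?c * u / A * \<alpha> + ?c * v / B * \<beta>)"
    proof (rule ennreal_leI)
      have "(\<alpha> / A) powr u * (\<beta> / B) powr v \<le> u * (\<alpha> / A) + v * (\<beta> / B)"
        using uv AB pos by (intro Youngs_inequality_0) auto
      then have "?c * ((\<alpha> / A) powr u * (\<beta> / B) powr v) \<le> ?c * (u * (\<alpha> / A) + v * (\<beta> / B))"
        by (intro mult_left_mono) auto
      then show "\<alpha> powr u * \<beta> powr v \<le> ?c * u / A * \<alpha> + ?c * v / B * \<beta>"
        using AB pos by (simp add: powr_divide field_simps)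
    qed
    also have "\<dots> = ennreal (?c * u / A) * f s + ennreal (?c * v / B) * f t"
      using uv AB \<alpha> \<beta> by (simp add: ennreal_mult[symmetric])
    finally show ?thesis .
  qed
  have "(\<integral>\<^sup>+z. f (a *\<^sub>R (u *\<^sub>R x + v *\<^sub>R y) + b *\<^sub>R z) \<partial>M)
      \<le> (\<integral>\<^sup>+z. ennreal (?c * u / A) * f (a *\<^sub>R x + b *\<^sub>R z) + ennreal (?c * v / B) * f (a *\<^sub>R y + b *\<^sub>R z) \<partial>M)"
  proof (rule nn_integral_mono)
    fix z
    have "a *\<^sub>R (u *\<^sub>R x + v *\<^sub>R y) + b *\<^sub>R z = a *\<^sub>R (u *\<^sub>R x + v *\<^sub>R y) + (u + v) *\<^sub>R b *\<^sub>R z"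
      using uv by simp
    also have "\<dots> = u *\<^sub>R (a *\<^sub>R x + b *\<^sub>R z) + v *\<^sub>R (a *\<^sub>R y + b *\<^sub>R z)"
      by (simp add: algebra_simps)
    finally show "f (a *\<^sub>R (u *\<^sub>R x + v *\<^sub>R y) + b *\<^sub>R z)
        \<le> ennreal (?c * u / A) * f (a *\<^sub>R x + b *\<^sub>R z) + ennreal (?c * v / B) * f (a *\<^sub>R y + b *\<^sub>R z)"
      using pw by simp
  qed
  also have "\<dots> = ennreal (?c * u / A) * (\<integral>\<^sup>+z. f (a *\<^sub>R x + b *\<^sub>R z) \<partial>M)
      + ennreal (?c * v / B) * (\<integral>\<^sup>+z. f (a *\<^sub>R y + b *\<^sub>R z) \<partial>M)"
    by (simp add: nn_integral_add nn_integral_cmult)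
  also have "\<dots> \<le> ennreal (?c * u / A) * ennreal A + ennreal (?c * v / B) * ennreal B"
    using xA yB by (intro add_mono mult_left_mono) auto
  also have "\<dots> = ennreal (?c * u + ?c * v)"
    using uv AB by (simp add: ennreal_mult[symmetric] ennreal_plus[symmetric] del: ennreal_plus)
  also have "?c * u + ?c * v = ?c" using uv by (simp add: distrib_left[symmetric])
  finally show "(\<integral>\<^sup>+z. f (a *\<^sub>R (u *\<^sub>R x + v *\<^sub>R y) + b *\<^sub>R z) \<partial>M) \<le> ennreal ?c" .
qed

lemma ratio_le_ennreal:
  assumes "p \<le> ennreal A" "ennreal r \<le> q" "0 \<le> A" "0 < r"
  shows "p / q \<le> ennreal (A / r)"
proof -
  have "p / q \<le> ennreal A / ennreal r"
    using assms by (intro order_trans[OF divide_right_mono_ennreal ennreal_divide_antimono]) auto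
  then show ?thesis using assms by (simp add: divide_ennreal)
qed

lemma powr_ratio:
  fixes p q r s :: real
  assumes "0 < p" "0 < q" "0 < r" "0 < s"
  shows "(p powr u * q powr v) / (r powr u * s powr v) = (p / r) powr u * (q / s) powr v"
  using assms by (simp add: powr_divide)

lemma log_convex_enn_divide:
  fixes F H :: "'a::real_vector \<Rightarrow> ennreal"
  assumes F: "log_convex_enn F" "\<And>x. 0 < F x" "\<And>x. F x < \<infinity>" and H: "log_concave_enn H" "\<And>x. H x < \<infinity>"
  shows "log_convex_enn (\<lambda>x. F x / H x)"
  unfolding log_convex_enn_def
proof (intro allI impI)
  fix u v :: real and x y and A B :: real
  assume uv: "0 < u" "0 < v" "u + v = 1" and AB: "0 < A" "0 < B"
    and xA: "F x / H x \<le> ennreal A" and yB: "F y / H y \<le> ennreal B"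
  have *: "\<exists>p r. F x = ennreal p \<and> H x = ennreal r \<and> 0 < p \<and> 0 < r \<and> p / r \<le> A"
    if "F x / H x \<le> ennreal A" "0 < A" for x A
  proof -
    obtain p where p: "F x = ennreal p" "0 \<le> p" using F(3)[of x] by (cases "F x") auto
    obtain r where r: "H x = ennreal r" "0 \<le> r" using H(2)[of x] by (cases "H x") auto
    note pr = p r
    have "0 < p" using F(2)[of x] pr by simp
    moreover have "H x \<noteq> 0"
    proof
      assume "H x = 0"
      then have "F x / H x = top" using F(2)[of x] by (simp add: divide_ennreal_def ennreal_mult_eq_top_iff)
      then show False using that by (simp add: top_unique)
    qed
    then have "0 < r" using r by (cases "r = 0") auto
    ultimately show ?thesis using that pr by (auto simp: divide_ennreal)
  qed
  obtain p r where p: "F x = ennreal p" "H x = ennreal r" "0 < p" "0 < r" "p / r \<le> A"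
    using *[OF xA] AB by auto
  obtain q s where q: "F y = ennreal q" "H y = ennreal s" "0 < q" "0 < s" "q / s \<le> B"
    using *[OF yB] AB by auto
  have "F (u *\<^sub>R x + v *\<^sub>R y) / H (u *\<^sub>R x + v *\<^sub>R y) \<le> ennreal ((p powr u * q powr v) / (r powr u * s powr v))"
    using log_convex_ennD[OF F(1) uv, of p q x y] log_concave_ennD[OF H(1) uv, of r s x y] p q
    by (intro ratio_le_ennreal) auto
  also have "\<dots> \<le> ennreal (A powr u * B powr v)"
    unfolding powr_ratio[OF p(3) q(3) p(4) q(4)] using p q uv
    by (intro ennreal_leI mult_mono powr_mono2) auto
  finally show "F (u *\<^sub>R x + v *\<^sub>R y) / H (u *\<^sub>R x + v *\<^sub>R y) \<le> ennreal (A powr u * B powr v)" .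
qed

lemma log_concave_enn_divide:
  fixes F H :: "'a::real_vector \<Rightarrow> ennreal"
  assumes F: "log_concave_enn F" "\<And>x. F x < \<infinity>" and H: "log_convex_enn H" "\<And>x. 1 \<le> H x"
  shows "log_concave_enn (\<lambda>x. F x / H x)"
  unfolding log_concave_enn_def geo_mean_le_def
proof (intro allI impI)
  fix u v :: real and x y and A B :: real
  assume uv: "0 < u" "0 < v" "u + v = 1" and AB: "0 < A" "0 < B"
    and xA: "ennreal A < F x / H x" and yB: "ennreal B < F y / H y"
  have *: "\<exists>p r. F x = ennreal p \<and> H x = ennreal r \<and> 0 < p \<and> 0 < r \<and> A \<le> p / r"
    if "ennreal A < F x / H x" "0 < A" for x A
  proof -
    have "H x \<noteq> top" using that by (auto simp: divide_ennreal_def)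
    then obtain r where r: "H x = ennreal r" "0 \<le> r" by (cases "H x") auto
    obtain p where p: "F x = ennreal p" "0 \<le> p" using F(2)[of x] by (cases "F x") auto
    note pr = p r
    have "0 < r" using H(2)[of x] pr by (simp add: one_le_ennreal_iff)
    then have "A < p / r" using that pr by (simp add: divide_ennreal ennreal_less_iff)
    moreover have "0 < p" using \<open>A < p / r\<close> \<open>0 < r\<close> that pr by (cases "p = 0") auto
    ultimately show ?thesis using pr \<open>0 < r\<close> by (intro exI[of _ p] exI[of _ r]) auto
  qed
  obtain p r where p: "F x = ennreal p" "H x = ennreal r" "0 < p" "0 < r" "A \<le> p / r"
    using *[OF xA] AB by auto
  obtain q s where q: "F y = ennreal q" "H y = ennreal s" "0 < q" "0 < s" "B \<le> q / s"
    using *[OF yB] AB by auto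
  let ?z = "u *\<^sub>R x + v *\<^sub>R y"
  have "ennreal (A powr u * B powr v) \<le> ennreal ((p / r) powr u * (q / s) powr v)"
    using p q uv AB by (intro ennreal_leI mult_mono powr_mono2) auto
  also have "\<dots> = ennreal (p powr u * q powr v) / ennreal (r powr u * s powr v)"
    using p q by (simp add: powr_ratio[symmetric] divide_ennreal)
  also have "\<dots> \<le> F ?z / H ?z"
    using log_concave_ennD[OF F(1) uv, of p q x y] log_convex_ennD[OF H(1) uv, of r s x y] p q
    by (intro order_trans[OF divide_right_mono_ennreal ennreal_divide_antimono]) auto
  finally show "ennreal (A powr u * B powr v) \<le> F ?z / H ?z" .
qed

text \<open>With respect to Lebesgue measure the integrand is \<open>exp (- \<bar>y - a x\<bar>\<^sup>2 / (2 b\<^sup>2)) g(y)\<close> up to a constant, which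
is jointly log-concave in \<open>(x, y)\<close>; Prekopa-Leindler passes this on to the marginal.\<close>

lemma log_concave_enn_mehler:
  fixes g :: "'a::euclidean_space \<Rightarrow> ennreal"
  assumes a: "0 < a" "a < 1" and [measurable]: "g \<in> borel_measurable borel" and g: "log_concave_enn g"
  shows "log_concave_enn (\<lambda>x. \<integral>\<^sup>+y. ennreal (mehler a x y) * g y \<partial>std_gaussian)"
proof -
  define b where "b = sqrt (1 - a\<^sup>2)"
  define C where "C = (1 / b) ^ DIM('a) * ((1 / sqrt (2 * pi)) ^ DIM('a))"
  define K where "K x y = C * exp (- (norm (y - a *\<^sub>R x))\<^sup>2 / (2 * b\<^sup>2))" for x y :: 'a
  have b: "0 < b" by (rule mehler_sd_pos[OF a b_def])
  have C: "0 < C" using b by (simp add: C_def)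
  have K: "0 < K x y" for x y using C by (simp add: K_def)
  have [measurable]: "(\<lambda>y. K x y) \<in> borel_measurable borel" "(\<lambda>y. mehler a x y) \<in> borel_measurable borel" for x
    unfolding K_def mehler_def by measurable
  have eq: "(\<integral>\<^sup>+y. ennreal (mehler a x y) * g y \<partial>std_gaussian) = (\<integral>\<^sup>+y. ennreal (K x y) * g y \<partial>lborel)" for x
  proof -
    have "ennreal (gauss y) * ennreal (mehler a x y) = ennreal (K x y)" for y
      using gauss_mult_mehler[OF a b_def, of y x] less_imp_le[OF gauss_pos[of y]] less_imp_le[OF mehler_pos[OF a b_def, of x y]]
      by (simp add: ennreal_mult[symmetric] K_def C_def mult.assoc)
    then show ?thesis
      by (subst nn_integral_std_gaussian) (simp_all add: mult.assoc[symmetric])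
  qed
  \<comment> \<open>Convexity of the squared norm, applied to \<open>y - a x\<close>, which is linear in \<open>(x, y)\<close>.\<close>
  have K_conc: "K x y powr u * K x' y' powr v \<le> K (u *\<^sub>R x + v *\<^sub>R x') (u *\<^sub>R y + v *\<^sub>R y')"
    if uv: "0 < u" "0 < v" "u + v = 1" for u v x x' y y'
  proof -
    define s t where "s = y - a *\<^sub>R x" and "t = y' - a *\<^sub>R x'"
    have st: "(u *\<^sub>R y + v *\<^sub>R y') - a *\<^sub>R (u *\<^sub>R x + v *\<^sub>R x') = u *\<^sub>R s + v *\<^sub>R t"
      by (simp add: s_def t_def algebra_simps)
    have sq: "u * (norm s)\<^sup>2 + v * (norm t)\<^sup>2 - (norm (u *\<^sub>R s + v *\<^sub>R t))\<^sup>2 = u * v * (norm (s - t))\<^sup>2"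
    proof -
      have v: "v = 1 - u" using uv by simp
      show ?thesis unfolding v
        by (simp add: power2_norm_eq_inner inner_commute algebra_simps)
    qed
    have "(norm (u *\<^sub>R s + v *\<^sub>R t))\<^sup>2 \<le> u * (norm s)\<^sup>2 + v * (norm t)\<^sup>2"
    proof -
      have "0 \<le> u * v * (norm (s - t))\<^sup>2" using uv by simp
      then show ?thesis using sq by linarith
    qed
    have *: "(- (norm s)\<^sup>2 / (2 * b\<^sup>2)) * u + (- (norm t)\<^sup>2 / (2 * b\<^sup>2)) * v \<le> - (norm (u *\<^sub>R s + v *\<^sub>R t))\<^sup>2 / (2 * b\<^sup>2)"
    proof -
      have "- (u * (norm s)\<^sup>2 + v * (norm t)\<^sup>2) / (2 * b\<^sup>2) \<le> - (norm (u *\<^sub>R s + v *\<^sub>R t))\<^sup>2 / (2 * b\<^sup>2)"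
        using \<open>(norm (u *\<^sub>R s + v *\<^sub>R t))\<^sup>2 \<le> _\<close> by (intro divide_right_mono) auto
      then show ?thesis by (simp add: add_divide_distrib diff_divide_distrib mult.commute)
    qed
    have "K x y powr u * K x' y' powr v = C powr u * C powr v * exp ((- (norm s)\<^sup>2 / (2 * b\<^sup>2)) * u + (- (norm t)\<^sup>2 / (2 * b\<^sup>2)) * v)"
      using C by (simp add: K_def s_def t_def powr_mult exp_powr_real exp_add[symmetric])
    also have "C powr u * C powr v = C"
      using C uv by (simp add: powr_add[symmetric])
    also have "C * exp ((- (norm s)\<^sup>2 / (2 * b\<^sup>2)) * u + (- (norm t)\<^sup>2 / (2 * b\<^sup>2)) * v) \<le> C * exp (- (norm (u *\<^sub>R s + v *\<^sub>R t))\<^sup>2 / (2 * b\<^sup>2))"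
      using C * by (intro mult_left_mono) auto
    finally show ?thesis by (simp only: K_def st)
  qed
  show ?thesis
    unfolding log_concave_enn_def eq
  proof (intro allI impI prekopa_leindler)
    fix u v :: real and x x' y y' :: 'a
    assume uv: "0 < u" "0 < v" "u + v = 1"
    show "geo_mean_le u v (ennreal (K x y) * g y) (ennreal (K x' y') * g y')
      (ennreal (K (u *\<^sub>R x + v *\<^sub>R x') (u *\<^sub>R y + v *\<^sub>R y')) * g (u *\<^sub>R y + v *\<^sub>R y'))"
      unfolding geo_mean_le_def
    proof (intro allI impI)
      fix A B :: real
      assume AB: "0 < A" "0 < B" and xA: "ennreal A < ennreal (K x y) * g y" and yB: "ennreal B < ennreal (K x' y') * g y'"
      have *: "ennreal (A / K x y) \<le> g y" if "ennreal A < ennreal (K x y) * g y" "0 < A" for A x y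
      proof -
        have "ennreal A / ennreal (K x y) \<le> g y"
          using that K[of x y] by (intro divide_le_posI_ennreal) (auto simp: mult.commute)
        then show ?thesis using K[of x y] that by (simp add: divide_ennreal)
      qed
      have "ennreal ((A / K x y) powr u * (B / K x' y') powr v) \<le> g (u *\<^sub>R y + v *\<^sub>R y')"
        using *[OF xA] *[OF yB] AB K by (intro log_concave_ennD[OF g uv]) auto
      then have "ennreal (K x y powr u * K x' y' powr v) * ennreal ((A / K x y) powr u * (B / K x' y') powr v)
        \<le> ennreal (K (u *\<^sub>R x + v *\<^sub>R x') (u *\<^sub>R y + v *\<^sub>R y')) * g (u *\<^sub>R y + v *\<^sub>R y')"
        by (intro mult_mono ennreal_leI K_conc uv) auto
      also have "ennreal (K x y powr u * K x' y' powr v) * ennreal ((A / K x y) powr u * (B / K x' y') powr v)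
        = ennreal (A powr u * B powr v)"
        using AB K[of x y] K[of x' y'] by (simp add: ennreal_mult[symmetric] powr_divide)
      finally show "ennreal (A powr u * B powr v) \<le> ennreal (K (u *\<^sub>R x + v *\<^sub>R x') (u *\<^sub>R y + v *\<^sub>R y')) * g (u *\<^sub>R y + v *\<^sub>R y')" .
    qed
  qed measurable
qed

text \<open>The form in which log-convexity gives pointwise bounds from local averages.\<close>

lemma log_convex_enn_midpoint:
  assumes "log_convex_enn (\<lambda>x. ennreal (f x))" "\<And>x. 1 \<le> f x"
  shows "f x \<le> (f (x + z) + f (x - z)) / 2"
proof -
  have pos: "0 < f y" for y using assms(2)[of y] by simp
  have "ennreal (f ((1/2) *\<^sub>R (x + z) + (1/2) *\<^sub>R (x - z)))
      \<le> ennreal (f (x + z) powr (1/2) * f (x - z) powr (1/2))"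
    by (rule log_convex_ennD[OF assms(1)]) (simp_all add: pos)
  also have "(1/2) *\<^sub>R (x + z) + (1/2) *\<^sub>R (x - z) = x"
    by (simp add: scaleR_add_right scaleR_diff_right scaleR_add_left[symmetric])
  finally have "f x \<le> f (x + z) powr (1/2) * f (x - z) powr (1/2)"
    by (simp add: ennreal_le_iff)
  also have "\<dots> \<le> (1/2) * f (x + z) + (1/2) * f (x - z)"
    by (intro Youngs_inequality_0) (auto simp: pos)
  finally show ?thesis by simp
qed

lemma log_concave_enn_imp_log_concave:
  fixes g :: "'a::real_vector \<Rightarrow> real"
  assumes "log_concave_enn (\<lambda>y. ennreal (g y))" "\<And>y. 0 \<le> g y"
  shows "log_concave g"
  unfolding log_concave_def convex_ereal_def
proof (intro conjI allI impI)
  show "0 \<le> g x" for x by fact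
  fix x y :: 'a and u v :: real
  assume uv: "0 \<le> u" "0 \<le> v" "u + v = 1"
  let ?z = "u *\<^sub>R x + v *\<^sub>R y"
  show "- ln_ereal (g ?z) \<le> ereal u * - ln_ereal (g x) + ereal v * - ln_ereal (g y)"
  proof (cases "u = 0 \<or> v = 0")
    case True
    then show ?thesis using uv by (auto simp: one_ereal_def[symmetric] zero_ereal_def[symmetric])
  next
    case False
    then have uv': "0 < u" "0 < v" using uv by auto
    show ?thesis
    proof (cases "g x = 0 \<or> g y = 0")
      case True
      then show ?thesis using uv' by (auto simp: ln_ereal_def)
    next
      case False
      then have pos: "0 < g x" "0 < g y" using assms(2)[of x] assms(2)[of y] by auto
      have "ennreal (g x powr u * g y powr v) \<le> ennreal (g ?z)"
        by (rule log_concave_ennD[OF assms(1) uv' uv(3) pos]) auto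
      then have le: "g x powr u * g y powr v \<le> g ?z"
        using assms(2) by (simp add: ennreal_le_iff)
      moreover have "0 < g x powr u * g y powr v" using pos by simp
      ultimately have z: "0 < g ?z" by linarith
      have "u * ln (g x) + v * ln (g y) = ln (g x powr u * g y powr v)"
        using pos by (simp add: ln_mult ln_powr)
      also have "\<dots> \<le> ln (g ?z)" using le pos z by simp
      finally show ?thesis using pos z by (simp add: ln_ereal_def)
    qed
  qed
qed

lemma log_convex_enn_imp_log_convex:
  fixes f :: "'a::real_vector \<Rightarrow> real"
  assumes "log_convex_enn (\<lambda>x. ennreal (f x))" "\<And>x. 0 < f x"
  shows "log_convex f"
  unfolding log_convex_def convex_ereal_def
proof (intro conjI allI impI)
  show "0 \<le> f x" for x using assms(2)[of x] by simp
  fix x y :: 'a and u v :: real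
  assume uv: "0 \<le> u" "0 \<le> v" "u + v = 1"
  let ?z = "u *\<^sub>R x + v *\<^sub>R y"
  have pos: "0 < f x" "0 < f y" "0 < f ?z" by (rule assms(2))+
  show "ln_ereal (f ?z) \<le> ereal u * ln_ereal (f x) + ereal v * ln_ereal (f y)"
  proof (cases "u = 0 \<or> v = 0")
    case True
    then show ?thesis using uv by (auto simp: one_ereal_def[symmetric] zero_ereal_def[symmetric])
  next
    case False
    then have uv': "0 < u" "0 < v" using uv by auto
    have "ennreal (f ?z) \<le> ennreal (f x powr u * f y powr v)"
      by (rule log_convex_ennD[OF assms(1) uv' uv(3) pos(1,2)]) auto
    then have "f ?z \<le> f x powr u * f y powr v" by (simp add: ennreal_le_iff)
    then have "ln (f ?z) \<le> ln (f x powr u * f y powr v)" using pos by simp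
    also have "\<dots> = u * ln (f x) + v * ln (f y)" using pos by (simp add: ln_mult ln_powr)
    finally show ?thesis using pos by (simp add: ln_ereal_def)
  qed
qed

lemma log_convex_enn_exp_convex:
  assumes "convex_on UNIV V"
  shows "log_convex_enn (\<lambda>x. ennreal (exp (V x)))"
  unfolding log_convex_enn_def
proof (intro allI impI)
  fix u v :: real and x y and A B :: real
  assume uv: "0 < u" "0 < v" "u + v = 1" and AB: "0 < A" "0 < B"
    and x: "ennreal (exp (V x)) \<le> ennreal A" and y: "ennreal (exp (V y)) \<le> ennreal B"
  have "V (u *\<^sub>R x + v *\<^sub>R y) \<le> u * V x + v * V y"
    using assms uv unfolding convex_on_def by simp
  then have "exp (V (u *\<^sub>R x + v *\<^sub>R y)) \<le> exp (V x) powr u * exp (V y) powr v"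
    by (simp add: exp_powr_real exp_add[symmetric] mult.commute)
  also have "\<dots> \<le> A powr u * B powr v"
    using x y AB uv by (intro mult_mono powr_mono2) auto
  finally show "ennreal (exp (V (u *\<^sub>R x + v *\<^sub>R y))) \<le> ennreal (A powr u * B powr v)"
    by (rule ennreal_leI)
qed

lemma log_concave_enn_exp_concave:
  assumes "convex D" "convex_on D w"
  shows "log_concave_enn (\<lambda>x. ennreal (if x \<in> D then exp (- w x) else 0))"
  unfolding log_concave_enn_def geo_mean_le_def
proof (intro allI impI)
  fix u v :: real and x y and A B :: real
  assume uv: "0 < u" "0 < v" "u + v = 1" and AB: "0 < A" "0 < B"
    and x: "ennreal A < ennreal (if x \<in> D then exp (- w x) else 0)"
    and y: "ennreal B < ennreal (if y \<in> D then exp (- w y) else 0)"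
  have xD: "x \<in> D" "A \<le> exp (- w x)" and yD: "y \<in> D" "B \<le> exp (- w y)"
    using x y AB by (auto split: if_splits simp: ennreal_less_iff)
  have z: "u *\<^sub>R x + v *\<^sub>R y \<in> D" using assms(1) xD yD uv by (simp add: convex_def)
  have "w (u *\<^sub>R x + v *\<^sub>R y) \<le> u * w x + v * w y"
    using assms(2) xD yD uv unfolding convex_on_def by simp
  then have "exp (- w x) powr u * exp (- w y) powr v \<le> exp (- w (u *\<^sub>R x + v *\<^sub>R y))"
    by (simp add: exp_powr_real exp_add[symmetric] mult.commute)
  moreover have "A powr u * B powr v \<le> exp (- w x) powr u * exp (- w y) powr v"
    using xD yD AB uv by (intro mult_mono powr_mono2) auto
  ultimately show "ennreal (A powr u * B powr v) \<le> ennreal (if u *\<^sub>R x + v *\<^sub>R y \<in> D then exp (- w (u *\<^sub>R x + v *\<^sub>R y)) else 0)"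
    using z by (simp add: ennreal_leI)
qed

section \<open>Convex potentials\<close>

lemma exp_ereal_ereal[simp]: "exp_ereal (ereal r) = ennreal (exp r)"
  by (simp add: exp_ereal_def)

lemma exp_ereal_infty[simp]: "exp_ereal \<infinity> = \<infinity>" "exp_ereal (-\<infinity>) = 0"
  by (simp_all add: exp_ereal_def split: ereal.split)

lemma convex_erealD:
  assumes "convex_ereal F" "F x = ereal a" "F y = ereal b" "0 \<le> u" "0 \<le> v" "u + v = 1"
  shows "F (u *\<^sub>R x + v *\<^sub>R y) \<le> ereal (u * a + v * b)"
proof -
  have "F (u *\<^sub>R x + v *\<^sub>R y) \<le> ereal u * F x + ereal v * F y"
    using assms unfolding convex_ereal_def by blast
  then show ?thesis using assms by simp
qed

lemma convex_domain:
  assumes "convex_ereal F" "\<And>x. F x \<noteq> -\<infinity>"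
  shows "convex {x. F x < \<infinity>}"
  unfolding convex_def
proof (intro ballI allI impI)
  fix x y and u v :: real
  assume "x \<in> {x. F x < \<infinity>}" "y \<in> {x. F x < \<infinity>}" and uv: "0 \<le> u" "0 \<le> v" "u + v = 1"
  then have xy: "F x < \<infinity>" "F y < \<infinity>" by auto
  obtain a where a: "F x = ereal a" using assms(2)[of x] xy by (cases "F x") auto
  obtain b where b: "F y = ereal b" using assms(2)[of y] xy by (cases "F y") auto
  have "F (u *\<^sub>R x + v *\<^sub>R y) \<le> ereal (u * a + v * b)" by (rule convex_erealD[OF assms(1) a b uv])
  also have "\<dots> < \<infinity>" by simp
  finally show "u *\<^sub>R x + v *\<^sub>R y \<in> {x. F x < \<infinity>}" by simp
qed

lemma convex_on_real_of_ereal: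
  assumes F: "convex_ereal F" "\<And>x. F x \<noteq> -\<infinity>" and D: "convex D" "\<And>x. x \<in> D \<Longrightarrow> F x < \<infinity>"
  shows "convex_on D (\<lambda>x. real_of_ereal (F x))"
proof (rule convex_onI[OF _ D(1)])
  fix t :: real and x y assume t: "0 < t" "t < 1" and xy: "x \<in> D" "y \<in> D"
  obtain a where a: "F x = ereal a" using D(2)[OF xy(1)] F(2)[of x] by (cases "F x") auto
  obtain b where b: "F y = ereal b" using D(2)[OF xy(2)] F(2)[of y] by (cases "F y") auto
  have "F ((1 - t) *\<^sub>R x + t *\<^sub>R y) \<le> ereal ((1 - t) * a + t * b)"
    using t by (intro convex_erealD[OF F(1) a b]) auto
  then have "real_of_ereal (F ((1 - t) *\<^sub>R x + t *\<^sub>R y)) \<le> (1 - t) * a + t * b"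
    using F(2)[of "(1 - t) *\<^sub>R x + t *\<^sub>R y"] by (cases "F ((1 - t) *\<^sub>R x + t *\<^sub>R y)") auto
  then show "real_of_ereal (F ((1 - t) *\<^sub>R x + t *\<^sub>R y)) \<le> (1 - t) * real_of_ereal (F x) + t * real_of_ereal (F y)"
    by (simp add: a b)
qed

text \<open>A convex function is continuous in the interior of its domain.\<close>

lemma borel_measurable_real_of_ereal_interior:
  fixes F :: "'a::euclidean_space \<Rightarrow> ereal"
  assumes F: "convex_ereal F" "\<And>x. F x \<noteq> -\<infinity>"
  defines "D \<equiv> interior {x. F x < \<infinity>}"
  shows "(\<lambda>x. indicator D x *\<^sub>R real_of_ereal (F x)) \<in> borel_measurable borel"
proof -
  have "convex D" unfolding D_def by (intro convex_interior convex_domain F)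
  have sub: "x \<in> D \<Longrightarrow> F x < \<infinity>" for x using interior_subset unfolding D_def by blast
  have "continuous_on D (\<lambda>x. real_of_ereal (F x))"
    by (intro convex_on_continuous convex_on_real_of_ereal F \<open>convex D\<close> sub) (simp_all add: D_def)
  then show ?thesis
    by (intro borel_measurable_continuous_on_indicator) (auto simp: D_def)
qed

text \<open>The frontier of a convex set is negligible.\<close>

lemma AE_interior_domain:
  fixes F :: "'a::euclidean_space \<Rightarrow> ereal"
  assumes F: "convex_ereal F" "\<And>x. F x \<noteq> -\<infinity>"
  shows "AE x in lborel. F x < \<infinity> \<longrightarrow> x \<in> interior {x. F x < \<infinity>}"
proof -
  let ?S = "{x. F x < \<infinity>}"
  have "negligible (frontier ?S)" by (intro negligible_convex_frontier convex_domain F)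
  then have "frontier ?S \<in> null_sets lborel"
    by (simp add: negligible_iff_null_sets null_sets_completion_iff)
  then have "AE x in lborel. x \<notin> frontier ?S" by (rule AE_not_in)
  then show ?thesis
  proof eventually_elim
    case (elim x)
    then show ?case using closure_subset[of ?S] by (auto simp: frontier_def simp del: less_top)
  qed
qed

text \<open>A density with integral \<open>1\<close> is finite almost everywhere, so the domain of \<open>V\<close> is a convex set of full
measure.  Such a set is dense, and a convex set and its closure have the same interior.\<close>

lemma convex_density_finite:
  fixes V :: "'a::euclidean_space \<Rightarrow> ereal"
  assumes V: "convex_ereal V" "\<And>x. V x \<noteq> -\<infinity>"
    and P: "prob_space (density std_gaussian (\<lambda>x. exp_ereal (V x)))"
  shows "V x < \<infinity>"
proof -
  define D where "D = interior {x. V x < \<infinity>}"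
  define r where "r x = indicator D x *\<^sub>R real_of_ereal (V x)" for x
  have [measurable]: "r \<in> borel_measurable borel"
    unfolding r_def D_def by (intro borel_measurable_real_of_ereal_interior V)
  have [measurable]: "D \<in> sets borel" by (simp add: D_def)
  have conv: "convex D" unfolding D_def by (intro convex_interior convex_domain V)
  have sub: "x \<in> D \<Longrightarrow> V x < \<infinity>" for x using interior_subset unfolding D_def by blast
  define e where "e x = (if x \<in> D then ennreal (exp (r x)) else \<infinity>)" for x
  have [measurable]: "e \<in> borel_measurable borel" unfolding e_def by measurable
  have "AE x in lborel. exp_ereal (V x) = e x"
    using AE_interior_domain[OF V]
  proof eventually_elim
    case (elim x)
    show ?case
    proof (cases "x \<in> D")
      case True
      then obtain s where "V x = ereal s" using sub[of x] V(2)[of x] by (cases "V x") auto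
      then show ?thesis using True by (simp add: e_def r_def)
    next
      case False
      then have "V x = \<infinity>" using elim by (auto simp: D_def)
      then show ?thesis using False by (simp add: e_def)
    qed
  qed
  then have "AE x in std_gaussian. exp_ereal (V x) = e x" by (simp add: AE_std_gaussian_iff)
  from density_cong_AE[OF this] P have "prob_space (density std_gaussian e)" by simp
  then have "emeasure (density std_gaussian e) (space (density std_gaussian e)) = 1"
    by (rule prob_space.emeasure_space_1)
  then have "(\<integral>\<^sup>+x. e x \<partial>std_gaussian) \<noteq> \<infinity>" by (simp add: emeasure_density)
  then have "AE x in std_gaussian. e x \<noteq> \<infinity>" by (intro nn_integral_PInf_AE) auto
  then have "AE x in lborel. x \<in> D"
    unfolding AE_std_gaussian_iff by eventually_elim (auto simp: e_def split: if_splits)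
  then have "- D \<in> null_sets lborel" by (simp add: AE_iff_null_sets Compl_eq)
  then have "negligible (- D)" by (simp add: negligible_iff_null_sets null_sets_completion_iff)
  then have "negligible (- closure D)"
    by (rule negligible_subset) (use closure_subset in auto)
  then have "closure D = UNIV" using open_not_negligible[of "- closure D"] by auto
  then have "interior D = UNIV" using convex_interior_closure[OF conv] by simp
  then have "x \<in> D" using interior_subset by blast
  then show ?thesis by (rule sub)
qed

text \<open>Discarding the negligible frontier of the domain of \<open>W\<close> yields a density that is Borel and still
log-concave.\<close>

lemma concave_density_open_domain:
  fixes W :: "'a::euclidean_space \<Rightarrow> ereal"
  assumes W: "convex_ereal W" "\<And>x. W x \<noteq> -\<infinity>"
  shows "\<exists>D w. open D \<and> convex D \<and> convex_on D w \<and> (\<lambda>x. indicator D x *\<^sub>R w x) \<in> borel_measurable borel \<and>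
    density std_gaussian (\<lambda>x. exp_ereal (- W x)) = density std_gaussian (\<lambda>x. ennreal (if x \<in> D then exp (- w x) else 0))"
proof (intro exI conjI)
  let ?D = "interior {x. W x < \<infinity>}"
  let ?w = "\<lambda>x. real_of_ereal (W x)"
  have sub: "x \<in> ?D \<Longrightarrow> W x < \<infinity>" for x using interior_subset by blast
  show "open ?D" by simp
  show "convex ?D" by (intro convex_interior convex_domain W)
  then show "convex_on ?D ?w" by (intro convex_on_real_of_ereal W sub)
  show "(\<lambda>x. indicator ?D x *\<^sub>R ?w x) \<in> borel_measurable borel" by (rule borel_measurable_real_of_ereal_interior[OF W])
  show "density std_gaussian (\<lambda>x. exp_ereal (- W x)) = density std_gaussian (\<lambda>x. ennreal (if x \<in> ?D then exp (- ?w x) else 0))"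
  proof (rule density_cong_AE, unfold AE_std_gaussian_iff)
    show "AE x in lborel. exp_ereal (- W x) = ennreal (if x \<in> ?D then exp (- ?w x) else 0)"
      using AE_interior_domain[OF W]
    proof eventually_elim
      case (elim x)
      show ?case
      proof (cases "x \<in> ?D")
        case True
        then obtain s where "W x = ereal s" using sub[of x] W(2)[of x] by (cases "W x") auto
        then show ?thesis using True by simp
      next
        case False
        then have "W x = \<infinity>" using elim by auto
        then show ?thesis using False by simp
      qed
    qed
  qed
qed

text \<open>If \<open>c\<close> is the centre of a ball on which \<open>w \<le> B\<close>, then \<open>c\<close> is a convex combination of \<open>y\<close> and a point \<open>y'\<close>
of that ball, with a weight of \<open>y\<close> that depends only on the radii.  Convexity bounds \<open>w c\<close> by the values at
\<open>y\<close> and \<open>y'\<close>, hence \<open>w y\<close> from below.\<close>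

lemma convex_bounded_below:
  fixes w :: "'a::euclidean_space \<Rightarrow> real"
  assumes D: "open D" "D \<noteq> {}" and w: "convex_on D w"
  shows "\<exists>m. \<forall>y\<in>D. norm y \<le> r \<longrightarrow> m \<le> w y"
proof -
  obtain c where c: "c \<in> D" using D by auto
  then obtain s where s: "0 < s" "cball c s \<subseteq> D" using D open_contains_cball by blast
  have "continuous_on (cball c s) w"
    using convex_on_continuous[OF D(1) w] s continuous_on_subset by blast
  then have "bdd_above (w ` cball c s)"
    by (intro bounded_imp_bdd_above compact_imp_bounded compact_continuous_image) auto
  then obtain B where "\<forall>y\<in>w ` cball c s. y \<le> B" unfolding bdd_above_def by blast
  then have B: "\<And>x. x \<in> cball c s \<Longrightarrow> w x \<le> B" by blast
  define R where "R = \<bar>r\<bar> + norm c"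
  \<comment> \<open>The weight for which the reflected point \<open>y'\<close> lies at distance at most \<open>s\<close> from \<open>c\<close>.\<close>
  define l where "l = s / (s + R)"
  have R: "0 \<le> R" by (simp add: R_def)
  have l: "0 < l" "l \<le> 1" "(1 - l) * s = l * R" using s R by (auto simp: l_def field_simps)
  have "(w c - (1 - l) * \<bar>B\<bar>) / l \<le> w y" if y: "y \<in> D" "norm y \<le> r" for y
  proof (cases "l = 1")
    case True
    then have "R = 0" using l s by simp
    then have "\<bar>r\<bar> = 0" "norm c = 0" using norm_ge_zero[of c] unfolding R_def by linarith+
    then have "c = 0" "norm y \<le> 0" using y by auto
    then show ?thesis using True by simp
  next
    case False
    then have l1: "l < 1" using l by simp
    define y' where "y' = c - (l / (1 - l)) *\<^sub>R (y - c)"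
    have "norm (y - c) \<le> R" unfolding R_def using norm_triangle_ineq4[of y c] y by linarith
    then have "l / (1 - l) * norm (y - c) \<le> l / (1 - l) * R"
      using l l1 by (intro mult_left_mono) auto
    also have "\<dots> = s" using l(3) l1 by (simp add: field_simps)
    finally have y': "y' \<in> cball c s" using l l1 by (simp add: y'_def dist_norm)
    have "(1 - l) *\<^sub>R y' = (1 - l) *\<^sub>R c - l *\<^sub>R (y - c)"
      using l1 by (simp add: y'_def scaleR_diff_right)
    then have c_eq: "c = (1 - l) *\<^sub>R y' + l *\<^sub>R y" by (simp add: algebra_simps)
    have "w c \<le> (1 - l) * w y' + l * w y"
      using convex_onD[OF w, of l y' y] y y' s l c_eq by auto
    also have "\<dots> \<le> (1 - l) * \<bar>B\<bar> + l * w y"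
      using B[OF y'] l by (intro add_right_mono mult_left_mono) auto
    finally show ?thesis using l by (simp add: field_simps)
  qed
  then show ?thesis by blast
qed

section \<open>The Schroedinger potentials of convex data\<close>

lemma borel_measurable_std_gaussian: "borel_measurable std_gaussian = borel_measurable borel"
  by (rule measurable_cong_sets) (simp_all add: sets_std_gaussian)

lemma sets_std_gaussian_pair:
  "sets (std_gaussian \<Otimes>\<^sub>M std_gaussian :: ('a::euclidean_space \<times> 'a) measure) = sets borel"
  by (simp add: borel_prod[symmetric] sets_std_gaussian cong: sets_pair_measure_cong)

text \<open>The data after regularisation: \<open>V\<close> is real-valued on the whole space and the density of \<open>\<nu>\<close> is supported in
an open convex set \<open>D\<close>.  The parameter \<open>a\<close> stands for \<open>exp (- \<epsilon> / 2)\<close>.\<close>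

locale convex_data =
  fixes a c r :: real and V :: "'a::euclidean_space \<Rightarrow> real" and D :: "'a set" and w :: "'a \<Rightarrow> real"
  assumes a: "0 < a" "a < 1"
    and V_convex: "convex_on UNIV V" and V_ge: "c \<le> V x"
    and V_mass: "(\<integral>\<^sup>+x. ennreal (exp (V x)) \<partial>std_gaussian) = 1"
    and V_moment: "(\<integral>\<^sup>+x. ennreal (exp (V x)) * ennreal ((norm x)\<^sup>2) \<partial>std_gaussian) < \<infinity>"
    and D: "open D" "convex D" and w_convex: "convex_on D w"
    and w_mass: "(\<integral>\<^sup>+y. ennreal (if y \<in> D then exp (- w y) else 0) \<partial>std_gaussian) = 1"
    and w_supp: "AE y in std_gaussian. y \<in> D \<longrightarrow> norm y \<le> r"
begin

definition b :: real where "b = sqrt (1 - a\<^sup>2)"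

definition E :: "'a \<Rightarrow> ennreal" where "E x = ennreal (exp (V x))"

definition G :: "'a \<Rightarrow> ennreal" where "G y = ennreal (if y \<in> D then exp (- w y) else 0)"

text \<open>Upper bound of the Mehler kernel when one argument ranges over the ball of radius \<open>r\<close>.\<close>

definition m :: real where "m = (1 / b) ^ DIM('a) * exp (r\<^sup>2 / (2 * b\<^sup>2))"

lemmas b_pos = mehler_sd_pos[OF a b_def]
lemmas mehler_pos = mehler_pos[OF a b_def]

lemma mehler_measurable2[measurable]: "(\<lambda>(x, y). ennreal (mehler a x y)) \<in> borel_measurable (std_gaussian \<Otimes>\<^sub>M std_gaussian)"
  unfolding case_prod_beta by measurable

lemma V_measurable[measurable]: "V \<in> borel_measurable borel"
  using convex_on_continuous[OF open_UNIV V_convex] by (rule borel_measurable_continuous_onI)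

lemma E_measurable[measurable]: "E \<in> borel_measurable borel"
  unfolding E_def[abs_def] by measurable

lemma w_measurable[measurable]: "(\<lambda>y. indicator D y *\<^sub>R w y) \<in> borel_measurable borel"
  using convex_on_continuous[OF D(1) w_convex] D(1)
  by (intro borel_measurable_continuous_on_indicator) auto

lemma D_measurable[measurable]: "D \<in> sets borel"
  using D(1) by simp

lemma G_measurable[measurable]: "G \<in> borel_measurable borel"
proof -
  have "G = (\<lambda>y. ennreal (if y \<in> D then exp (- (indicator D y *\<^sub>R w y)) else 0))"
    by (auto simp: G_def fun_eq_iff)
  also have "\<dots> \<in> borel_measurable borel" by measurable
  finally show ?thesis .
qed

lemma m_pos: "0 < m"
  using b_pos by (simp add: m_def)

lemma mehler_integral_le:
  assumes [measurable]: "h \<in> borel_measurable borel" and "\<And>y. h y \<le> G y"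
  shows "(\<integral>\<^sup>+y. ennreal (mehler a x y) * h y \<partial>std_gaussian) \<le> ennreal m * (\<integral>\<^sup>+y. h y \<partial>std_gaussian)"
proof -
  have "(\<integral>\<^sup>+y. ennreal (mehler a x y) * h y \<partial>std_gaussian) \<le> (\<integral>\<^sup>+y. ennreal m * h y \<partial>std_gaussian)"
  proof (rule nn_integral_mono_AE, use w_supp in eventually_elim)
    case (elim y)
    show ?case
    proof (cases "y \<in> D")
      case True
      then show ?thesis using mehler_le[OF a b_def, of y r x] elim
        by (intro mult_right_mono ennreal_leI) (auto simp: m_def)
    next
      case False
      then have "h y = 0" using assms(2)[of y] by (simp add: G_def)
      then show ?thesis by simp
    qed
  qed
  then show ?thesis by (simp add: nn_integral_cmult borel_measurable_std_gaussian)
qed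

text \<open>Confinement: if \<open>E x \<le> P h x\<close> with \<open>h \<le> G\<close>, then \<open>exp c \<le> E x \<le> m \<integral> h\<close>.\<close>

sublocale schroedinger "std_gaussian :: 'a measure" "\<lambda>x y. ennreal (mehler a x y)" E G "ennreal (exp c / m)"
proof (intro schroedinger.intro schroedinger_axioms.intro prob_space_std_gaussian)
  show "0 < E x" "E x < \<infinity>" "G y < \<infinity>" "0 < ennreal (exp c / m)" "0 < ennreal (mehler a x y)" for x y
    using m_pos by (simp_all add: E_def G_def mehler_pos)
  have "(\<integral>\<^sup>+y. ennreal (mehler a x y) * G y \<partial>std_gaussian) \<le> ennreal m * 1" for x
    using mehler_integral_le[of G x] w_mass by (simp add: G_def)
  then show "(\<integral>\<^sup>+y. ennreal (mehler a x y) * G y \<partial>std_gaussian) < \<infinity>" for x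
    by (rule le_less_trans) simp
  show "ennreal (exp c / m) \<le> (\<integral>\<^sup>+y. h y \<partial>std_gaussian)"
    if h: "h \<in> borel_measurable std_gaussian" "\<And>y. h y \<le> G y"
      and le: "E x \<le> (\<integral>\<^sup>+y. ennreal (mehler a x y) * h y \<partial>std_gaussian)" for h x
  proof -
    have "ennreal (exp c) \<le> E x" unfolding E_def using V_ge[of x] by (intro ennreal_leI) simp
    also note le
    also have "(\<integral>\<^sup>+y. ennreal (mehler a x y) * h y \<partial>std_gaussian) \<le> ennreal m * (\<integral>\<^sup>+y. h y \<partial>std_gaussian)"
      using h by (intro mehler_integral_le) (simp_all add: borel_measurable_std_gaussian)
    finally have "ennreal (exp c) / ennreal m \<le> (\<integral>\<^sup>+y. h y \<partial>std_gaussian)"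
      using m_pos by (intro divide_le_posI_ennreal) auto
    then show ?thesis using m_pos by (simp add: divide_ennreal)
  qed
qed (use mehler_markov[OF a b_def] V_mass w_mass in
    \<open>auto simp: space_std_gaussian mehler_sym E_def[symmetric] G_def[symmetric] borel_measurable_std_gaussian\<close>)

lemma P_eq: "h \<in> borel_measurable borel \<Longrightarrow> P h x = (\<integral>\<^sup>+z. h (a *\<^sub>R x + b *\<^sub>R z) \<partial>std_gaussian)"
  unfolding P_def by (rule nn_integral_mehler[OF a b_def])

lemma log_concave_enn_dual:
  assumes f: "f \<in> borel_measurable std_gaussian" "\<And>x. 1 \<le> f x" "log_convex_enn f"
  shows "log_concave_enn (dual f)"
proof -
  have fm: "f \<in> borel_measurable borel" using f by (simp add: borel_measurable_std_gaussian)
  have "log_convex_enn (P f)"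
    unfolding P_eq[OF fm, abs_def]
    by (intro log_convex_enn_integral f) (use fm in \<open>simp add: borel_measurable_std_gaussian\<close>)
  then show ?thesis
    unfolding dual_def[abs_def] using log_concave_enn_exp_concave[OF D(2) w_convex]
    by (intro log_concave_enn_divide G_finite P_ge_1 f) (simp_all add: G_def[abs_def])
qed

lemma log_convex_enn_step:
  assumes f: "f \<in> borel_measurable std_gaussian" "\<And>x. 1 \<le> f x" "log_convex_enn f"
  shows "log_convex_enn (step f)"
proof -
  have dm: "dual f \<in> borel_measurable borel" using dual_measurable[OF f(1)] by (simp add: borel_measurable_std_gaussian)
  have "log_concave_enn (dual f)" using f by (rule log_concave_enn_dual)
  then have "log_concave_enn (P (dual f))"
    unfolding P_def[abs_def] by (intro log_concave_enn_mehler a dm)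
  then show ?thesis
    unfolding step_def[abs_def] using log_convex_enn_exp_convex[OF V_convex]
    by (intro log_convex_enn_max log_convex_enn_one log_convex_enn_divide E_pos E_finite P_dual_finite f) (simp_all add: E_def[abs_def])
qed

theorem real_schroedinger_solution:
  "\<exists>f g :: 'a \<Rightarrow> real. f \<in> borel_measurable borel \<and> g \<in> borel_measurable borel \<and>
     (\<forall>x. 1 \<le> f x) \<and> (\<forall>y. 0 \<le> g y) \<and> log_convex_enn (\<lambda>x. ennreal (f x)) \<and> log_concave_enn (\<lambda>y. ennreal (g y)) \<and>
     (AE x in std_gaussian. ennreal (f x) * P (\<lambda>y. ennreal (g y)) x = E x) \<and>
     (AE y in std_gaussian. ennreal (g y) * P (\<lambda>x. ennreal (f x)) y = G y)"
proof -
  obtain F where F: "F \<in> borel_measurable std_gaussian" "step F = F"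
      "(\<integral>\<^sup>+y. dual F y \<partial>std_gaussian) \<noteq> 0" "log_convex_enn F"
    using fixed_point_exists[of log_convex_enn] log_convex_enn_one log_convex_enn_step log_convex_enn_SUP by metis
  note ge1 = fixed_ge_1[OF F(1-3)]
  have Fm[measurable]: "F \<in> borel_measurable borel" using F by (simp add: borel_measurable_std_gaussian)
  have dm[measurable]: "dual F \<in> borel_measurable borel"
    using dual_measurable[OF F(1)] by (simp add: borel_measurable_std_gaussian)
  define f where "f x = enn2real (F x)" for x
  define g where "g y = enn2real (dual F y)" for y
  have f: "ennreal (f x) = F x" for x
    unfolding f_def using fixed_finite[OF F(1-3), of x] by simp
  have g: "ennreal (g y) = dual F y" for y
    unfolding g_def using dual_le[of F y, OF ge1] G_finite[of y] by (intro ennreal_enn2real) (auto intro: le_less_trans)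
  have "log_concave_enn (dual F)" by (rule log_concave_enn_dual[OF F(1) ge1 F(4)])
  moreover have "1 \<le> f x" for x using ge1[of x] f[of x] by (metis one_le_ennreal_iff)
  moreover have "f \<in> borel_measurable borel" "g \<in> borel_measurable borel"
    unfolding f_def[abs_def] g_def[abs_def] by measurable
  ultimately show ?thesis
    using F(4) fixed_marginals[OF F(1-3)] by (intro exI[of _ f] exI[of _ g]) (simp add: f g, simp add: g_def)
qed

end

section \<open>Integrability of the logarithmic potentials\<close>

text \<open>A solution of the Schroedinger system whose first potential is log-convex, together with the measures
and the plan that it defines.\<close>

locale factorization = convex_data +
  fixes f g :: "'a \<Rightarrow> real"
  assumes f_measurable[measurable]: "f \<in> borel_measurable borel"
    and g_measurable[measurable]: "g \<in> borel_measurable borel"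
    and f_ge_1: "1 \<le> f x" and g_nonneg: "0 \<le> g y"
    and f_lconv: "log_convex_enn (\<lambda>x. ennreal (f x))"
    and first_eq: "AE x in std_gaussian. ennreal (f x) * P (\<lambda>y. ennreal (g y)) x = E x"
    and second_eq: "AE y in std_gaussian. ennreal (g y) * P (\<lambda>x. ennreal (f x)) y = G y"
begin

abbreviation Pf :: "'a \<Rightarrow> ennreal" where "Pf \<equiv> P (\<lambda>x. ennreal (f x))"
abbreviation Pg :: "'a \<Rightarrow> ennreal" where "Pg \<equiv> P (\<lambda>y. ennreal (g y))"

lemma f_pos: "0 < f x"
  using f_ge_1[of x] by simp

lemma Pf_measurable[measurable]: "Pf \<in> borel_measurable borel"
  using P_measurable[of "\<lambda>x. ennreal (f x)"] by (simp add: borel_measurable_std_gaussian)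

lemma Pg_measurable[measurable]: "Pg \<in> borel_measurable borel"
  using P_measurable[of "\<lambda>x. ennreal (g x)"] by (simp add: borel_measurable_std_gaussian)

definition dens :: "'a \<times> 'a \<Rightarrow> real" where
  "dens z = mehler a (fst z) (snd z) * (f (fst z) * g (snd z))"

definition plan :: "('a \<times> 'a) measure" where
  "plan = density (std_gaussian \<Otimes>\<^sub>M std_gaussian) (\<lambda>z. ennreal (dens z))"

lemma dens_measurable[measurable]: "dens \<in> borel_measurable (std_gaussian \<Otimes>\<^sub>M std_gaussian)"
  unfolding dens_def[abs_def] by measurable

lemma dens_nonneg: "0 \<le> dens z"
  using f_pos[of "fst z"] g_nonneg[of "snd z"] mehler_pos[of "fst z" "snd z"] by (simp add: dens_def)

lemma sets_plan: "sets plan = sets borel"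
  by (simp add: plan_def sets_std_gaussian_pair)

lemma ennreal_dens: "ennreal (dens (x, y)) = ennreal (f x) * (ennreal (mehler a x y) * ennreal (g y))"
  using less_imp_le[OF f_pos[of x]] g_nonneg[of y] less_imp_le[OF mehler_pos[of x y]]
  by (simp add: dens_def ennreal_mult[symmetric] mult_ac)

lemma nn_integral_plan:
  assumes h: "h \<in> borel_measurable borel"
  shows "(\<integral>\<^sup>+z. h z \<partial>plan) = (\<integral>\<^sup>+x. \<integral>\<^sup>+y. ennreal (dens (x, y)) * h (x, y) \<partial>std_gaussian \<partial>std_gaussian)"
proof -
  have [measurable]: "h \<in> borel_measurable (std_gaussian \<Otimes>\<^sub>M std_gaussian)"
    using h by (simp add: measurable_cong_sets[OF sets_std_gaussian_pair refl])
  show ?thesis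
    unfolding plan_def by (simp add: nn_integral_density nn_integral_fst[symmetric])
qed

lemma nn_integral_plan_fst:
  assumes [measurable]: "h \<in> borel_measurable borel"
  shows "(\<integral>\<^sup>+z. h (fst z) \<partial>plan) = (\<integral>\<^sup>+x. E x * h x \<partial>std_gaussian)"
proof -
  have "(\<integral>\<^sup>+z. h (fst z) \<partial>plan) = (\<integral>\<^sup>+x. \<integral>\<^sup>+y. ennreal (dens (x, y)) * h x \<partial>std_gaussian \<partial>std_gaussian)"
    by (subst nn_integral_plan) (simp_all flip: borel_prod)
  also have "\<dots> = (\<integral>\<^sup>+x. \<integral>\<^sup>+y. (ennreal (f x) * h x) * (ennreal (mehler a x y) * ennreal (g y)) \<partial>std_gaussian \<partial>std_gaussian)"
    by (simp add: ennreal_dens mult_ac)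
  also have "\<dots> = (\<integral>\<^sup>+x. (ennreal (f x) * h x) * Pg x \<partial>std_gaussian)"
    unfolding P_def by (intro nn_integral_cong nn_integral_cmult) measurable
  also have "\<dots> = (\<integral>\<^sup>+x. E x * h x \<partial>std_gaussian)"
    using first_eq by (intro nn_integral_cong_AE) (auto simp: mult_ac)
  finally show ?thesis .
qed

lemma nn_integral_plan_snd:
  assumes [measurable]: "h \<in> borel_measurable borel"
  shows "(\<integral>\<^sup>+z. h (snd z) \<partial>plan) = (\<integral>\<^sup>+y. G y * h y \<partial>std_gaussian)"
proof -
  interpret N: pair_sigma_finite "std_gaussian :: 'a measure" "std_gaussian :: 'a measure" ..
  have "(\<integral>\<^sup>+z. h (snd z) \<partial>plan) = (\<integral>\<^sup>+x. \<integral>\<^sup>+y. ennreal (dens (x, y)) * h y \<partial>std_gaussian \<partial>std_gaussian)"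
    by (subst nn_integral_plan) (simp_all flip: borel_prod)
  also have "\<dots> = (\<integral>\<^sup>+y. \<integral>\<^sup>+x. ennreal (dens (x, y)) * h y \<partial>std_gaussian \<partial>std_gaussian)"
    by (rule N.Fubini'[symmetric]) measurable
  also have "\<dots> = (\<integral>\<^sup>+y. \<integral>\<^sup>+x. (ennreal (g y) * h y) * (ennreal (mehler a y x) * ennreal (f x)) \<partial>std_gaussian \<partial>std_gaussian)"
    by (simp add: ennreal_dens mehler_sym mult_ac)
  also have "\<dots> = (\<integral>\<^sup>+y. (ennreal (g y) * h y) * Pf y \<partial>std_gaussian)"
    unfolding P_def by (intro nn_integral_cong nn_integral_cmult) measurable
  also have "\<dots> = (\<integral>\<^sup>+y. G y * h y \<partial>std_gaussian)"
    using second_eq by (intro nn_integral_cong_AE) (auto simp: mult_ac)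
  finally show ?thesis .
qed

definition \<mu> :: "'a measure" where "\<mu> = density std_gaussian E"
definition \<nu> :: "'a measure" where "\<nu> = density std_gaussian G"

lemma sets_\<mu>[measurable_cong]: "sets \<mu> = sets borel" and sets_\<nu>[measurable_cong]: "sets \<nu> = sets borel"
  by (simp_all add: \<mu>_def \<nu>_def sets_std_gaussian)

lemma nn_integral_\<mu>: "h \<in> borel_measurable borel \<Longrightarrow> (\<integral>\<^sup>+x. h x \<partial>\<mu>) = (\<integral>\<^sup>+x. E x * h x \<partial>std_gaussian)"
  unfolding \<mu>_def by (rule nn_integral_density) (simp_all add: borel_measurable_std_gaussian)

lemma nn_integral_\<nu>: "h \<in> borel_measurable borel \<Longrightarrow> (\<integral>\<^sup>+x. h x \<partial>\<nu>) = (\<integral>\<^sup>+x. G x * h x \<partial>std_gaussian)"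
  unfolding \<nu>_def by (rule nn_integral_density) (simp_all add: borel_measurable_std_gaussian)

lemma fst_snd_plan[measurable]: "fst \<in> plan \<rightarrow>\<^sub>M borel" "snd \<in> plan \<rightarrow>\<^sub>M borel"
  by (simp_all add: measurable_cong_sets[OF sets_plan refl] flip: borel_prod)

lemma distr_plan_fst: "distr plan borel fst = \<mu>"
proof (rule measure_eqI)
  fix A assume "A \<in> sets (distr plan borel fst)"
  then have [measurable]: "A \<in> sets borel" by simp
  have "emeasure (distr plan borel fst) A = (\<integral>\<^sup>+x. indicator A x \<partial>distr plan borel fst)" by simp
  also have "\<dots> = (\<integral>\<^sup>+z. indicator A (fst z) \<partial>plan)" by (rule nn_integral_distr) measurable
  also have "\<dots> = emeasure \<mu> A"
    by (subst nn_integral_plan_fst) (auto simp: nn_integral_\<mu>[symmetric] \<mu>_def sets_std_gaussian)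
  finally show "emeasure (distr plan borel fst) A = emeasure \<mu> A" .
qed (simp add: \<mu>_def sets_std_gaussian)

lemma distr_plan_snd: "distr plan borel snd = \<nu>"
proof (rule measure_eqI)
  fix A assume "A \<in> sets (distr plan borel snd)"
  then have [measurable]: "A \<in> sets borel" by simp
  have "emeasure (distr plan borel snd) A = (\<integral>\<^sup>+x. indicator A x \<partial>distr plan borel snd)" by simp
  also have "\<dots> = (\<integral>\<^sup>+z. indicator A (snd z) \<partial>plan)" by (rule nn_integral_distr) measurable
  also have "\<dots> = emeasure \<nu> A"
    by (subst nn_integral_plan_snd) (auto simp: nn_integral_\<nu>[symmetric] \<nu>_def sets_std_gaussian)
  finally show "emeasure (distr plan borel snd) A = emeasure \<nu> A" .
qed (simp add: \<nu>_def sets_std_gaussian)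

lemma prob_space_plan: "prob_space plan"
proof (rule prob_spaceI)
  have "emeasure plan (space plan) = (\<integral>\<^sup>+z. (\<lambda>_. 1) (fst z) \<partial>plan)" by simp
  also have "\<dots> = 1" by (subst nn_integral_plan_fst) (simp_all add: E_mass)
  finally show "emeasure plan (space plan) = 1" .
qed

lemma Pf_ge_1: "1 \<le> Pf y"
  by (rule P_ge_1) (simp add: one_le_ennreal_iff f_ge_1)

lemma second_eq_\<nu>: "AE y in \<nu>. 0 < g y \<and> Pf y < \<infinity>"
  unfolding \<nu>_def
proof (subst AE_density)
  show "AE y in std_gaussian. 0 < G y \<longrightarrow> 0 < g y \<and> Pf y < \<infinity>"
    using second_eq
  proof eventually_elim
    case (elim y)
    show ?case
    proof
      assume "0 < G y"
      then have "ennreal (g y) * Pf y \<noteq> 0" "ennreal (g y) * Pf y \<noteq> \<infinity>"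
        using elim G_finite[of y] by auto
      then show "0 < g y \<and> Pf y < \<infinity>"
        using g_nonneg[of y] by (auto simp: ennreal_mult_eq_top_iff less_top)
    qed
  qed
qed (simp add: borel_measurable_std_gaussian)

lemma first_eq_\<mu>: "AE x in \<mu>. 0 < Pg x \<and> Pg x < \<infinity> \<and> Pg x = ennreal (exp (V x) / f x)"
  unfolding \<mu>_def
proof (subst AE_density)
  show "AE x in std_gaussian. 0 < E x \<longrightarrow> 0 < Pg x \<and> Pg x < \<infinity> \<and> Pg x = ennreal (exp (V x) / f x)"
    using first_eq
  proof eventually_elim
    case (elim x)
    have "Pg x = ennreal (exp (V x)) / ennreal (f x)"
      using f_pos[of x] elim by (metis E_def ennreal_mult_divide_eq ennreal_neq_top mult.commute ennreal_eq_0_iff not_le)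
    then have "Pg x = ennreal (exp (V x) / f x)" using f_pos[of x] by (simp add: divide_ennreal)
    then show ?case using f_pos[of x] by simp
  qed
qed (simp add: borel_measurable_std_gaussian)

lemma prob_space_\<mu>: "prob_space \<mu>"
  by (rule prob_spaceI) (simp add: \<mu>_def emeasure_density E_mass borel_measurable_std_gaussian space_std_gaussian)

lemma prob_space_\<nu>: "prob_space \<nu>"
  by (rule prob_spaceI) (simp add: \<nu>_def emeasure_density G_mass borel_measurable_std_gaussian space_std_gaussian)

lemma Pf_finite_somewhere: "\<exists>y. Pf y < \<infinity>"
proof -
  interpret N: prob_space \<nu> by (rule prob_space_\<nu>)
  have "AE y in \<nu>. Pf y < \<infinity>" using second_eq_\<nu> by eventually_elim simp
  then show ?thesis using N.AE_False by (metis (mono_tags, lifting) AE_cong eventually_mono)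
qed

text \<open>Fix \<open>y\<^sub>0\<close> with \<open>P f (y\<^sub>0)\<close> finite.  The midpoint inequality bounds \<open>f x\<close> by its average over the unit ball
around \<open>x\<close>.  There the Lebesgue density of the law that \<open>P f (y\<^sub>0)\<close> averages over is at least \<open>C exp (- (\<bar>x\<bar> + s)\<^sup>2 / (2 b\<^sup>2))\<close>, so this average
is at most \<open>P f (y\<^sub>0)\<close> divided by that quantity.\<close>

lemma ln_f_growth: "\<exists>A B. 0 \<le> A \<and> 0 \<le> B \<and> (\<forall>x. ln (f x) \<le> A + B * (norm x)\<^sup>2)"
proof -
  obtain y0 where y0: "Pf y0 < \<infinity>" using Pf_finite_somewhere by blast
  define s where "s = 1 + norm (a *\<^sub>R y0)"
  define C where "C = (1 / b) ^ DIM('a) * ((1 / sqrt (2 * pi)) ^ DIM('a))"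
  define k where "k x = C * exp (- (norm x + s)\<^sup>2 / (2 * b\<^sup>2))" for x :: 'a
  have C: "0 < C" using b_pos by (simp add: C_def)
  have k: "0 < k x" for x using C by (simp add: k_def)
  define \<beta> where "\<beta> = measure lborel (ball (0::'a) 1)"
  have \<beta>: "emeasure lborel (ball (0::'a) 1) = ennreal \<beta>" "0 < \<beta>"
    unfolding \<beta>_def using content_ball_pos[of 1 "0::'a"]
    using emeasure_lborel_ball_finite[of "0::'a" 1] by (auto intro!: emeasure_eq_ennreal_measure)
  obtain q where q: "Pf y0 = ennreal q" "0 \<le> q" using y0 by (cases "Pf y0") auto
  have [measurable]: "ball x 1 \<in> sets borel" for x :: 'a by simp
  \<comment> \<open>The function \<open>k\<close> is a lower bound, on the unit ball around \<open>x\<close>, of the density of \<open>N(a y\<^sub>0, b\<^sup>2 I)\<close>.\<close>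
  have local: "ennreal (k x) * (\<integral>\<^sup>+z. indicator (ball x 1) z * ennreal (f z) \<partial>lborel) \<le> Pf y0" for x
  proof -
    have "ennreal (k x) * (\<integral>\<^sup>+z. indicator (ball x 1) z * ennreal (f z) \<partial>lborel)
        = (\<integral>\<^sup>+z. ennreal (k x) * (indicator (ball x 1) z * ennreal (f z)) \<partial>lborel)"
      by (rule nn_integral_cmult[symmetric]) measurable
    also have "\<dots> \<le> (\<integral>\<^sup>+z. ennreal (gauss z) * (ennreal (mehler a y0 z) * ennreal (f z)) \<partial>lborel)"
    proof (rule nn_integral_mono)
      fix z
      have "ennreal (k x) \<le> ennreal (gauss z) * ennreal (mehler a y0 z)" if z: "z \<in> ball x 1"
      proof -
        have "norm (z - a *\<^sub>R y0) \<le> norm x + norm (z - x) + norm (a *\<^sub>R y0)"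
          using norm_triangle_ineq4[of z "a *\<^sub>R y0"] norm_triangle_ineq[of x "z - x"] by simp
        also have "\<dots> \<le> norm x + s" using z by (simp add: s_def dist_norm norm_minus_commute)
        finally have "(norm (z - a *\<^sub>R y0))\<^sup>2 \<le> (norm x + s)\<^sup>2" by (intro power_mono) auto
        then have "- (norm x + s)\<^sup>2 / (2 * b\<^sup>2) \<le> - (norm (z - a *\<^sub>R y0))\<^sup>2 / (2 * b\<^sup>2)"
          by (intro divide_right_mono) auto
        then have "k x \<le> gauss z * mehler a y0 z"
          unfolding gauss_mult_mehler[OF a b_def] k_def C_def mult.assoc[symmetric]
          using C b_pos by (intro mult_left_mono) (auto simp: C_def)
        then show ?thesis
          using less_imp_le[OF gauss_pos[of z]] less_imp_le[OF mehler_pos[of y0 z]]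
          by (simp add: ennreal_mult[symmetric] ennreal_leI)
      qed
      then show "ennreal (k x) * (indicator (ball x 1) z * ennreal (f z))
          \<le> ennreal (gauss z) * (ennreal (mehler a y0 z) * ennreal (f z))"
        by (cases "z \<in> ball x 1") (auto simp: mult.assoc[symmetric] intro!: mult_right_mono)
    qed
    also have "\<dots> = Pf y0"
      unfolding P_def by (subst nn_integral_std_gaussian) (auto simp: mehler_def)
    finally show ?thesis .
  qed
  have bound: "k x * (f x * \<beta>) \<le> q" for x
  proof -
    have "ennreal (f x) * ennreal \<beta> = (\<integral>\<^sup>+z. ennreal (f x) * indicator (ball (0::'a) 1) z \<partial>lborel)"
      by (subst nn_integral_cmult) (simp_all add: \<beta>)
    also have "\<dots> \<le> (\<integral>\<^sup>+z. ennreal (1/2) * (indicator (ball x 1) (x + z) * ennreal (f (x + z)))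
        + ennreal (1/2) * (indicator (ball x 1) (x - z) * ennreal (f (x - z))) \<partial>lborel)"
    proof (rule nn_integral_mono)
      fix z
      have "f x \<le> 1/2 * f (x + z) + 1/2 * f (x - z)" using log_convex_enn_midpoint[OF f_lconv f_ge_1, of x z] by simp
      then have "ennreal (f x) \<le> ennreal (1/2 * f (x + z) + 1/2 * f (x - z))" by (rule ennreal_leI)
      also have "\<dots> = ennreal (1/2 * f (x + z)) + ennreal (1/2 * f (x - z))"
        using f_pos[of "x + z"] f_pos[of "x - z"] by (intro ennreal_plus) auto
      also have "\<dots> = ennreal (1/2) * ennreal (f (x + z)) + ennreal (1/2) * ennreal (f (x - z))"
        by (intro arg_cong2[where f="(+)"] ennreal_mult') auto
      finally have "ennreal (f x) \<le> ennreal (1/2) * ennreal (f (x + z)) + ennreal (1/2) * ennreal (f (x - z))" .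
      then show "ennreal (f x) * indicator (ball 0 1) z \<le> ennreal (1/2) * (indicator (ball x 1) (x + z) * ennreal (f (x + z)))
        + ennreal (1/2) * (indicator (ball x 1) (x - z) * ennreal (f (x - z)))"
        by (cases "z \<in> ball 0 1") (auto simp: dist_norm)
    qed
    also have "\<dots> = ennreal (1/2) * (\<integral>\<^sup>+z. indicator (ball x 1) (x + z) * ennreal (f (x + z)) \<partial>lborel)
        + ennreal (1/2) * (\<integral>\<^sup>+z. indicator (ball x 1) (x - z) * ennreal (f (x - z)) \<partial>lborel)"
      by (subst nn_integral_add) (simp_all add: nn_integral_cmult)
    also have "\<dots> = (ennreal (1/2) + ennreal (1/2)) * (\<integral>\<^sup>+z. indicator (ball x 1) z * ennreal (f z) \<partial>lborel)"
      by (subst nn_integral_lborel_translate(1)[where h="\<lambda>z. indicator (ball x 1) z * ennreal (f z)"], measurable,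
          subst nn_integral_lborel_translate(2)[where h="\<lambda>z. indicator (ball x 1) z * ennreal (f z)"], measurable)
         (simp only: distrib_right)
    also have "ennreal (1/2) + ennreal (1/2) = 1"
      using ennreal_plus[of "1/2" "1/2"] by simp
    finally have "ennreal (k x) * (ennreal (f x) * ennreal \<beta>) \<le> ennreal (k x) * (\<integral>\<^sup>+z. indicator (ball x 1) z * ennreal (f z) \<partial>lborel)"
      by (intro mult_left_mono) auto
    also have "\<dots> \<le> ennreal q" using local[of x] q by simp
    finally show ?thesis
      using k[of x] f_pos[of x] \<beta> q by (simp add: ennreal_mult[symmetric] ennreal_le_iff)
  qed
  have q1: "0 < q"
    using bound[of 0] k[of 0] f_pos[of 0] \<beta> by (intro less_le_trans[OF _ bound[of 0]]) simp
  define Q where "Q = q / (C * \<beta>)"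
  have Q: "0 < Q" using q1 C \<beta> by (simp add: Q_def)
  have "ln (f x) \<le> (\<bar>ln Q\<bar> + s\<^sup>2 / b\<^sup>2) + (1 / b\<^sup>2) * (norm x)\<^sup>2" for x
  proof -
    have "f x \<le> Q * exp ((norm x + s)\<^sup>2 / (2 * b\<^sup>2))"
      using bound[of x] C \<beta> by (simp add: k_def Q_def exp_minus field_simps)
    then have "ln (f x) \<le> ln (Q * exp ((norm x + s)\<^sup>2 / (2 * b\<^sup>2)))"
      using f_pos[of x] Q by simp
    also have "\<dots> = ln Q + (norm x + s)\<^sup>2 / (2 * b\<^sup>2)" using Q by (simp add: ln_mult)
    also have "(norm x + s)\<^sup>2 \<le> 2 * (norm x)\<^sup>2 + 2 * s\<^sup>2"
      using zero_le_power2[of "norm x - s"] by (simp add: power2_eq_square algebra_simps)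
    then have "(norm x + s)\<^sup>2 / (2 * b\<^sup>2) \<le> (2 * (norm x)\<^sup>2 + 2 * s\<^sup>2) / (2 * b\<^sup>2)"
      by (intro divide_right_mono) auto
    finally show ?thesis by (simp add: add_divide_distrib)
  qed
  then show ?thesis
    by (intro exI[of _ "\<bar>ln Q\<bar> + s\<^sup>2 / b\<^sup>2"] exI[of _ "1 / b\<^sup>2"]) auto
qed

lemma nn_integral_ln_f: "(\<integral>\<^sup>+x. ennreal (ln (f x)) \<partial>\<mu>) < \<infinity>"
proof -
  obtain A B where AB: "0 \<le> A" "0 \<le> B" "\<And>x. ln (f x) \<le> A + B * (norm x)\<^sup>2"
    using ln_f_growth by blast
  have "(\<integral>\<^sup>+x. ennreal (ln (f x)) \<partial>\<mu>) \<le> (\<integral>\<^sup>+x. ennreal A + ennreal B * ennreal ((norm x)\<^sup>2) \<partial>\<mu>)"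
    using AB by (intro nn_integral_mono) (simp add: ennreal_mult[symmetric] ennreal_plus[symmetric] ennreal_leI del: ennreal_plus)
  also have "\<dots> = ennreal A * emeasure \<mu> (space \<mu>) + ennreal B * (\<integral>\<^sup>+x. ennreal ((norm x)\<^sup>2) \<partial>\<mu>)"
    by (subst nn_integral_add) (simp_all add: \<mu>_def borel_measurable_std_gaussian nn_integral_cmult)
  also have "\<dots> < \<infinity>"
    using V_moment prob_space.emeasure_space_1[OF prob_space_\<mu>]
    by (simp add: nn_integral_\<mu> E_def ennreal_mult_less_top)
  finally show ?thesis .
qed

lemma AE_plan_fst: "AE x in \<mu>. Q x \<Longrightarrow> AE z in plan. Q (fst z)"
  unfolding distr_plan_fst[symmetric] by (rule AE_distrD) measurable

lemma AE_plan_snd: "AE y in \<nu>. Q y \<Longrightarrow> AE z in plan. Q (snd z)"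
  unfolding distr_plan_snd[symmetric] by (rule AE_distrD) measurable

lemma \<nu>_support: "AE y in \<nu>. y \<in> D \<and> norm y \<le> r"
  unfolding \<nu>_def
proof (subst AE_density)
  show "AE y in std_gaussian. 0 < G y \<longrightarrow> y \<in> D \<and> norm y \<le> r"
    using w_supp by eventually_elim (simp add: G_def)
qed (simp add: borel_measurable_std_gaussian)

lemma first_mass: "(\<integral>\<^sup>+x. ennreal (f x) * Pg x \<partial>std_gaussian) = 1"
  using nn_integral_cong_AE[OF first_eq] by (simp add: E_mass)

lemma second_mass: "(\<integral>\<^sup>+y. ennreal (g y) * Pf y \<partial>std_gaussian) = 1"
  using nn_integral_cong_AE[OF second_eq] by (simp add: G_mass)

text \<open>Almost everywhere for the plan, \<open>ln (P f (y)) = ln t + ln r(x,y) - ln (P g (x))\<close> with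
\<open>t = P f (y) P g (x) / r(x,y)\<close>.  Here \<open>ln t \<le> t\<close>, the kernel \<open>r\<close> is bounded on the support, and
\<open>- ln (P g (x)) = ln (f x) - V x\<close> is at most \<open>ln (f x) - c\<close>, an integrable function of \<open>x\<close>.\<close>

lemma nn_integral_ln_Pf: "(\<integral>\<^sup>+y. ennreal (ln (enn2real (Pf y))) \<partial>\<nu>) < \<infinity>"
proof -
  define p where "p x = enn2real (Pg x)" for x
  define q where "q y = enn2real (Pf y)" for y
  have [measurable]: "p \<in> borel_measurable borel" "q \<in> borel_measurable borel"
    unfolding p_def[abs_def] q_def[abs_def] by measurable
  define t where "t z = q (snd z) * p (fst z) / mehler a (fst z) (snd z)" for z
  have t_measurable[measurable]: "t \<in> borel_measurable (borel \<Otimes>\<^sub>M borel)"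
    unfolding t_def by measurable
  have t: "(\<integral>\<^sup>+z. ennreal (t z) \<partial>plan) \<le> 1"
  proof -
    have "(\<integral>\<^sup>+z. ennreal (t z) \<partial>plan) = (\<integral>\<^sup>+x. \<integral>\<^sup>+y. ennreal (dens (x, y)) * ennreal (t (x, y)) \<partial>std_gaussian \<partial>std_gaussian)"
      by (rule nn_integral_plan) (use t_measurable in \<open>simp add: borel_prod\<close>)
    also have "\<dots> \<le> (\<integral>\<^sup>+x. \<integral>\<^sup>+y. (ennreal (f x) * Pg x) * (ennreal (g y) * Pf y) \<partial>std_gaussian \<partial>std_gaussian)"
    proof (intro nn_integral_mono)
      fix x y
      have "ennreal (dens (x, y)) * ennreal (t (x, y)) = ennreal (dens (x, y) * t (x, y))"
        by (rule ennreal_mult'[symmetric]) (rule dens_nonneg)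
      also have "dens (x, y) * t (x, y) = (f x * p x) * (g y * q y)"
        using mehler_pos[of x y] by (simp add: dens_def t_def)
      also have "ennreal \<dots> = (ennreal (f x) * ennreal (p x)) * (ennreal (g y) * ennreal (q y))"
        using less_imp_le[OF f_pos[of x]] g_nonneg[of y] by (simp add: ennreal_mult p_def q_def)
      also have "\<dots> \<le> (ennreal (f x) * Pg x) * (ennreal (g y) * Pf y)"
        unfolding p_def q_def by (intro mult_mono order_refl ennreal_enn2real_le) auto
      finally show "ennreal (dens (x, y)) * ennreal (t (x, y)) \<le> (ennreal (f x) * Pg x) * (ennreal (g y) * Pf y)" .
    qed
    also have "\<dots> = (\<integral>\<^sup>+x. (ennreal (f x) * Pg x) * (\<integral>\<^sup>+y. ennreal (g y) * Pf y \<partial>std_gaussian) \<partial>std_gaussian)"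
      by (intro nn_integral_cong nn_integral_cmult) measurable
    also have "\<dots> = 1" by (simp add: first_mass second_mass)
    finally show ?thesis .
  qed
  define K where "K = \<bar>ln m\<bar> + \<bar>c\<bar>"
  have "(\<integral>\<^sup>+y. ennreal (ln (q y)) \<partial>\<nu>) = (\<integral>\<^sup>+z. ennreal (ln (q (snd z))) \<partial>plan)"
    by (subst nn_integral_plan_snd) (simp_all add: nn_integral_\<nu>)
  also have "\<dots> \<le> (\<integral>\<^sup>+z. ennreal (t z) + (ennreal K + ennreal (ln (f (fst z)))) \<partial>plan)"
  proof (rule nn_integral_mono_AE)
    show "AE z in plan. ennreal (ln (q (snd z))) \<le> ennreal (t z) + (ennreal K + ennreal (ln (f (fst z))))"
      using AE_plan_snd[OF second_eq_\<nu>] AE_plan_snd[OF \<nu>_support] AE_plan_fst[OF first_eq_\<mu>]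
    proof eventually_elim
      case (elim z)
      let ?x = "fst z" and ?y = "snd z"
      let ?\<rho> = "mehler a ?x ?y"
      have \<rho>: "0 < ?\<rho>" "?\<rho> \<le> m"
        using mehler_pos mehler_le[OF a b_def, of ?y r ?x] elim by (auto simp: m_def)
      have p: "p ?x = exp (V ?x) / f ?x" "0 < p ?x"
        using elim f_pos[of ?x] by (simp_all add: p_def)
      obtain s where s: "Pf ?y = ennreal s" "0 \<le> s" using elim by (cases "Pf ?y") auto
      have q: "1 \<le> q ?y" using Pf_ge_1[of ?y] s by (simp add: q_def one_le_ennreal_iff)
      have tpos: "0 < t z"
        unfolding t_def using \<rho> p(2) q by (intro divide_pos_pos mult_pos_pos) auto
      have "q ?y = t z * ?\<rho> / p ?x" using \<rho>(1) p(2) by (simp add: t_def)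
      then have "ln (q ?y) = ln (t z) + ln ?\<rho> - ln (p ?x)"
        using tpos \<rho>(1) p(2) by (simp add: ln_mult ln_div)
      also have "ln (p ?x) = V ?x - ln (f ?x)"
        using p f_pos[of ?x] by (simp add: ln_div)
      also have "ln (t z) + ln ?\<rho> - (V ?x - ln (f ?x)) \<le> t z + (K + ln (f ?x))"
      proof -
        have "ln (t z) \<le> t z" using ln_le_minus_one[OF tpos] by simp
        moreover have "ln ?\<rho> \<le> ln m" using \<rho> by simp
        ultimately show ?thesis using V_ge[of ?x] unfolding K_def by linarith
      qed
      finally show ?case
        using tpos f_ge_1[of ?x] by (simp add: K_def ennreal_plus[symmetric] ennreal_leI del: ennreal_plus)
    qed
  qed
  also have "\<dots> = (\<integral>\<^sup>+z. ennreal (t z) \<partial>plan) + ((\<integral>\<^sup>+z. ennreal K \<partial>plan) + (\<integral>\<^sup>+z. ennreal (ln (f (fst z))) \<partial>plan))"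
  proof -
    have [measurable]: "t \<in> borel_measurable plan"
      using t_measurable by (simp add: borel_prod measurable_cong_sets[OF sets_plan refl])
    have [measurable]: "(\<lambda>z. ennreal (ln (f (fst z)))) \<in> borel_measurable plan" by measurable
    show ?thesis by (simp add: nn_integral_add)
  qed
  also have "\<dots> < \<infinity>"
  proof -
    have "(\<integral>\<^sup>+z. ennreal (ln (f (fst z))) \<partial>plan) = (\<integral>\<^sup>+x. ennreal (ln (f x)) \<partial>\<mu>)"
      by (subst nn_integral_plan_fst) (simp_all add: nn_integral_\<mu>)
    then show ?thesis
      using t nn_integral_ln_f prob_space.emeasure_space_1[OF prob_space_plan]
      by (auto simp: less_top[symmetric] top_unique)
  qed
  finally show ?thesis by (simp add: q_def)
qed

text \<open>The negative part of \<open>w\<close> is bounded on the support, and \<open>exp (- w) max 0 w \<le> 1\<close> takes care of the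
positive part.\<close>

lemma nn_integral_abs_w: "(\<integral>\<^sup>+y. ennreal \<bar>indicator D y *\<^sub>R w y\<bar> \<partial>\<nu>) < \<infinity>"
proof -
  interpret N: prob_space \<nu> by (rule prob_space_\<nu>)
  have "D \<noteq> {}"
    using w_mass by auto
  then obtain M where M: "\<And>y. y \<in> D \<Longrightarrow> norm y \<le> r \<Longrightarrow> M \<le> w y"
    using convex_bounded_below[OF D(1) _ w_convex] by blast
  let ?w = "\<lambda>y. indicator D y *\<^sub>R w y"
  have pos: "(\<integral>\<^sup>+y. ennreal (max 0 (?w y)) \<partial>\<nu>) \<le> 1"
  proof -
    have "(\<integral>\<^sup>+y. ennreal (max 0 (?w y)) \<partial>\<nu>) = (\<integral>\<^sup>+y. G y * ennreal (max 0 (?w y)) \<partial>std_gaussian)"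
      by (rule nn_integral_\<nu>) measurable
    also have "\<dots> \<le> (\<integral>\<^sup>+y. 1 \<partial>(std_gaussian :: 'a measure))"
    proof (rule nn_integral_mono)
      fix y
      have "exp (- w y) * max 0 (w y) \<le> 1"
      proof -
        have "max 0 (w y) \<le> exp (w y)" using exp_ge_add_one_self[of "w y"] exp_ge_zero[of "w y"] by linarith
        then have "exp (- w y) * max 0 (w y) \<le> exp (- w y) * exp (w y)" by (intro mult_left_mono) auto
        then show ?thesis by (simp add: exp_minus)
      qed
      then have "ennreal (exp (- w y)) * ennreal (max 0 (w y)) \<le> 1"
        by (subst ennreal_mult[symmetric]) (simp_all only: ennreal_le_1 exp_ge_zero max.cobounded1)
      then show "G y * ennreal (max 0 (?w y)) \<le> 1"
        by (cases "y \<in> D") (simp_all add: G_def)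
    qed
    also have "\<dots> = 1" by (simp add: emeasure_space_1)
    finally show ?thesis .
  qed
  have "(\<integral>\<^sup>+y. ennreal \<bar>?w y\<bar> \<partial>\<nu>) \<le> (\<integral>\<^sup>+y. ennreal (max 0 (?w y)) + ennreal \<bar>M\<bar> \<partial>\<nu>)"
  proof (rule nn_integral_mono_AE, use \<nu>_support in eventually_elim)
    case (elim y)
    then have "\<bar>?w y\<bar> \<le> max 0 (?w y) + \<bar>M\<bar>" using M[of y] by simp
    then have "ennreal \<bar>?w y\<bar> \<le> ennreal (max 0 (?w y) + \<bar>M\<bar>)" by (rule ennreal_leI)
    also have "\<dots> = ennreal (max 0 (?w y)) + ennreal \<bar>M\<bar>" by (rule ennreal_plus) auto
    finally show ?case .
  qed
  also have "\<dots> = (\<integral>\<^sup>+y. ennreal (max 0 (?w y)) \<partial>\<nu>) + ennreal \<bar>M\<bar>"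
  proof -
    have "(\<integral>\<^sup>+y. ennreal (max 0 (?w y)) + ennreal \<bar>M\<bar> \<partial>\<nu>)
        = (\<integral>\<^sup>+y. ennreal (max 0 (?w y)) \<partial>\<nu>) + (\<integral>\<^sup>+y. ennreal \<bar>M\<bar> \<partial>\<nu>)"
      by (rule nn_integral_add) measurable
    then show ?thesis by (simp add: N.emeasure_space_1)
  qed
  also have "\<dots> < \<infinity>" using pos by (auto simp: less_top[symmetric] top_unique)
  finally show ?thesis .
qed

lemma integrable_ln_f: "integrable \<mu> (\<lambda>x. ln (f x))"
proof (rule integrableI_bounded)
  show "(\<lambda>x. ln (f x)) \<in> borel_measurable \<mu>" by (simp add: \<mu>_def borel_measurable_std_gaussian)
  show "(\<integral>\<^sup>+x. ennreal (norm (ln (f x))) \<partial>\<mu>) < \<infinity>" using nn_integral_ln_f f_ge_1 by simp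
qed

lemma integrable_ln_g: "integrable \<nu> (\<lambda>y. ln (g y))"
proof (rule integrableI_bounded)
  show "(\<lambda>y. ln (g y)) \<in> borel_measurable \<nu>" by (simp add: \<nu>_def borel_measurable_std_gaussian)
  let ?w = "\<lambda>y. indicator D y *\<^sub>R w y"
  have eq: "AE y in \<nu>. ennreal (g y) * Pf y = G y"
    unfolding \<nu>_def using second_eq by (subst AE_density) (auto simp: borel_measurable_std_gaussian)
  have "(\<integral>\<^sup>+y. ennreal (norm (ln (g y))) \<partial>\<nu>) \<le> (\<integral>\<^sup>+y. ennreal \<bar>?w y\<bar> + ennreal (ln (enn2real (Pf y))) \<partial>\<nu>)"
  proof (rule nn_integral_mono_AE)
    show "AE y in \<nu>. ennreal (norm (ln (g y))) \<le> ennreal \<bar>?w y\<bar> + ennreal (ln (enn2real (Pf y)))"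
      using eq \<nu>_support second_eq_\<nu>
    proof eventually_elim
      case (elim y)
      obtain s where s: "Pf y = ennreal s" "0 \<le> s" using elim by (cases "Pf y") auto
      have s1: "1 \<le> s" using Pf_ge_1[of y] s by (simp add: one_le_ennreal_iff)
      have "ennreal (g y * s) = ennreal (exp (- w y))"
        using elim s by (simp add: G_def ennreal_mult)
      then have "g y * s = exp (- w y)" using elim s by (subst (asm) ennreal_inj) auto
      then have "g y = exp (- w y) / s" using s1 by (simp add: field_simps)
      then have "ln (g y) = - w y - ln s" using s1 by (simp add: ln_div)
      then have "\<bar>ln (g y)\<bar> \<le> \<bar>w y\<bar> + ln s" using ln_ge_zero[OF s1] by linarith
      then show ?case using elim s s1 by (simp add: ennreal_plus[symmetric] ennreal_leI del: ennreal_plus)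
    qed
  qed
  also have "\<dots> = (\<integral>\<^sup>+y. ennreal \<bar>?w y\<bar> \<partial>\<nu>) + (\<integral>\<^sup>+y. ennreal (ln (enn2real (Pf y))) \<partial>\<nu>)"
    by (rule nn_integral_add) measurable
  also have "\<dots> < \<infinity>" using nn_integral_abs_w nn_integral_ln_Pf by simp
  finally show "(\<integral>\<^sup>+y. ennreal (norm (ln (g y))) \<partial>\<nu>) < \<infinity>" .
qed

end

section \<open>Minimal relative entropy\<close>

text \<open>The negative part of the entropy is always finite because \<open>- k ln k \<le> 1\<close>, so the entropy is either the
Bochner integral of \<open>ln k\<close> or \<open>\<infinity>\<close>.\<close>

lemma relative_entropy_density:
  fixes k :: "'a \<Rightarrow> real"
  assumes R: "prob_space R" and k[measurable]: "k \<in> borel_measurable R" "\<And>z. 0 \<le> k z"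
  shows "relative_entropy (density R (\<lambda>z. ennreal (k z))) R =
    (if integrable (density R (\<lambda>z. ennreal (k z))) (\<lambda>z. ln (k z))
     then ereal (\<integral>z. ln (k z) \<partial>density R (\<lambda>z. ennreal (k z))) else \<infinity>)"
proof -
  interpret R: prob_space R by fact
  let ?P = "density R (\<lambda>z. ennreal (k z))"
  have "AE z in R. RN_deriv R ?P z = ennreal (k z)"
    using R.RN_deriv_unique[of "\<lambda>z. ennreal (k z)" ?P] by (auto elim: eventually_mono)
  then have ed: "AE z in ?P. entropy_density (exp 1) R ?P z = ln (k z)"
    by (subst AE_density) (auto simp: entropy_density_def k(2) log_def elim!: eventually_mono)
  have ac: "absolutely_continuous R ?P"
    by (rule absolutely_continuousI_density) simp
  have pos: "(\<integral>\<^sup>+z. ennreal (entropy_density (exp 1) R ?P z) \<partial>?P) = (\<integral>\<^sup>+z. ennreal (ln (k z)) \<partial>?P)"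
    and neg: "(\<integral>\<^sup>+z. ennreal (- entropy_density (exp 1) R ?P z) \<partial>?P) = (\<integral>\<^sup>+z. ennreal (- ln (k z)) \<partial>?P)"
    using ed by (auto intro!: nn_integral_cong_AE elim!: eventually_mono)
  have "(\<integral>\<^sup>+z. ennreal (- ln (k z)) \<partial>?P) = (\<integral>\<^sup>+z. ennreal (k z) * ennreal (- ln (k z)) \<partial>R)"
    by (rule nn_integral_density) measurable
  also have "\<dots> \<le> (\<integral>\<^sup>+z. 1 \<partial>R)"
  proof (rule nn_integral_mono)
    fix z
    have "k z * (- ln (k z)) \<le> 1"
    proof (cases "k z = 0")
      case False
      then have kz: "0 < k z" using k(2)[of z] by simp
      have "- ln (k z) \<le> 1 / k z" using ln_le_minus_one[of "1 / k z"] kz by (simp add: ln_div)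
      then have "k z * (- ln (k z)) \<le> k z * (1 / k z)" using kz by (intro mult_left_mono) auto
      then show ?thesis using kz by simp
    qed simp
    then show "ennreal (k z) * ennreal (- ln (k z)) \<le> 1"
      using k(2)[of z] by (simp add: ennreal_mult'[symmetric] ennreal_le_1)
  qed
  finally have neg_fin: "(\<integral>\<^sup>+z. ennreal (- ln (k z)) \<partial>?P) \<noteq> \<infinity>"
    by (auto simp: R.emeasure_space_1 top_unique)
  show ?thesis
  proof (cases "(\<integral>\<^sup>+z. ennreal (ln (k z)) \<partial>?P) = \<infinity>")
    case True
    then have "\<not> integrable ?P (\<lambda>z. ln (k z))"
      by (auto simp: real_integrable_def)
    moreover have "relative_entropy ?P R = \<infinity>"
      unfolding relative_entropy_def pos neg using ac True by simp
    ultimately show ?thesis by simp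
  next
    case False
    have int: "integrable ?P (\<lambda>z. ln (k z))"
      using False neg_fin by (simp add: real_integrable_def)
    obtain A where A: "(\<integral>\<^sup>+z. ennreal (ln (k z)) \<partial>?P) = ennreal A" "0 \<le> A"
      using False by (cases "\<integral>\<^sup>+z. ennreal (ln (k z)) \<partial>?P") auto
    obtain B where B: "(\<integral>\<^sup>+z. ennreal (- ln (k z)) \<partial>?P) = ennreal B" "0 \<le> B"
      using neg_fin by (cases "\<integral>\<^sup>+z. ennreal (- ln (k z)) \<partial>?P") auto
    have "(\<integral>z. ln (k z) \<partial>?P) = A - B"
      using real_lebesgue_integral_def[OF int] A B by simp
    moreover have "relative_entropy ?P R = ereal (A - B)"
      unfolding relative_entropy_def pos neg A B using ac A B by simp
    ultimately show ?thesis using int by simp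
  qed
qed

text \<open>Integrate \<open>ln (h / k) \<le> h / k - 1\<close> against \<open>k R\<close>.  Equality forces \<open>h = k\<close> wherever \<open>k > 0\<close>, thus \<open>k \<le> h\<close>
almost everywhere, and equal masses leave no room for a difference.\<close>

lemma gibbs_inequality:
  fixes h k :: "'a \<Rightarrow> real"
  assumes h[measurable]: "h \<in> borel_measurable R" "\<And>z. 0 \<le> h z"
    and k[measurable]: "k \<in> borel_measurable R" "\<And>z. 0 \<le> k z"
    and P: "prob_space (density R (\<lambda>z. ennreal (h z)))" and Q: "prob_space (density R (\<lambda>z. ennreal (k z)))"
    and pos: "AE z in density R (\<lambda>z. ennreal (k z)). 0 < h z"
    and int_k: "integrable (density R (\<lambda>z. ennreal (k z))) (\<lambda>z. ln (k z))"
    and int_h: "integrable (density R (\<lambda>z. ennreal (k z))) (\<lambda>z. ln (h z))"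
  defines "H \<equiv> \<integral>z. ln (h z) \<partial>density R (\<lambda>z. ennreal (k z))"
    and "K \<equiv> \<integral>z. ln (k z) \<partial>density R (\<lambda>z. ennreal (k z))"
  shows "H \<le> K" and "K = H \<Longrightarrow> density R (\<lambda>z. ennreal (k z)) = density R (\<lambda>z. ennreal (h z))"
proof -
  let ?Q = "density R (\<lambda>z. ennreal (k z))"
  interpret Q: prob_space ?Q by fact
  have h_mass: "(\<integral>\<^sup>+z. ennreal (h z) \<partial>R) = 1"
    using prob_space.emeasure_space_1[OF P] by (simp add: emeasure_density)
  have k_mass: "(\<integral>\<^sup>+z. ennreal (k z) \<partial>R) = 1"
    using Q.emeasure_space_1 by (simp add: emeasure_density)
  have k_pos: "AE z in ?Q. 0 < k z"
    by (subst AE_density) auto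
  have ratio: "(\<integral>\<^sup>+z. ennreal (h z / k z) \<partial>?Q) \<le> 1"
  proof -
    have "(\<integral>\<^sup>+z. ennreal (h z / k z) \<partial>?Q) = (\<integral>\<^sup>+z. ennreal (k z) * ennreal (h z / k z) \<partial>R)"
      by (rule nn_integral_density) measurable
    also have "\<dots> \<le> (\<integral>\<^sup>+z. ennreal (h z) \<partial>R)"
      using h(2) k(2) by (intro nn_integral_mono) (auto simp: ennreal_mult'[symmetric] intro!: ennreal_leI)
    finally show ?thesis by (simp add: h_mass)
  qed
  have int_r: "integrable ?Q (\<lambda>z. h z / k z)"
    using ratio h(2) k(2) by (intro integrableI_bounded) (auto intro: le_less_trans)
  have r_le: "(\<integral>z. h z / k z \<partial>?Q) \<le> 1"
  proof -
    have "ennreal (\<integral>z. h z / k z \<partial>?Q) \<le> 1"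
      using ratio h(2) k(2) by (subst nn_integral_eq_integral[OF int_r, symmetric]) auto
    then show ?thesis by (simp add: ennreal_le_1)
  qed
  let ?d = "\<lambda>z. ln (k z) - ln (h z) - 1 + h z / k z"
  have int_d: "integrable ?Q ?d"
    by (intro Bochner_Integration.integrable_add Bochner_Integration.integrable_diff int_k int_h int_r) simp
  have d: "(\<integral>z. ?d z \<partial>?Q) = K - H - 1 + (\<integral>z. h z / k z \<partial>?Q)"
    using int_k int_h int_r by (simp add: H_def K_def Q.prob_space[simplified])
  have d_nonneg: "AE z in ?Q. 0 \<le> ?d z"
    using k_pos pos
  proof eventually_elim
    case (elim z)
    then show ?case using ln_le_minus_one[of "h z / k z"] by (simp add: ln_div)
  qed
  have "0 \<le> (\<integral>z. ?d z \<partial>?Q)" by (rule integral_nonneg_AE) fact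
  then show "H \<le> K" using d r_le by simp
  show "?Q = density R (\<lambda>z. ennreal (h z))" if "K = H"
  proof -
    have "(\<integral>z. ?d z \<partial>?Q) = 0"
      using that d r_le \<open>0 \<le> (\<integral>z. ?d z \<partial>?Q)\<close> by simp
    then have "AE z in ?Q. ?d z = 0"
      using integral_nonneg_eq_0_iff_AE[OF int_d d_nonneg] by simp
    then have "AE z in ?Q. k z = h z"
      using k_pos pos
    proof eventually_elim
      case (elim z)
      then have "ln (h z / k z) = h z / k z - 1" by (simp add: ln_div)
      then have "h z / k z = 1" using elim by (intro ln_eq_minus_one) auto
      then show ?case using elim by simp
    qed
    then have "AE z in R. 0 < k z \<longrightarrow> k z = h z"
      by (subst (asm) AE_density) auto
    then have "AE z in R. ennreal (k z) \<le> ennreal (h z)"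
    proof eventually_elim
      case (elim z)
      then show ?case using h(2)[of z] k(2)[of z] by (cases "k z = 0") (auto intro!: ennreal_leI)
    qed
    then have "AE z in R. ennreal (k z) = ennreal (h z)"
      by (intro AE_eq_of_nn_integral_le) (simp_all add: h_mass k_mass)
    then show ?thesis by (rule density_cong_AE)
  qed
qed

section \<open>The optimal coupling\<close>

context factorization
begin

text \<open>For every coupling the integral of \<open>ln (f(x) g(y))\<close> equals \<open>S\<close>, which is also the entropy of the plan.
Gibbs' inequality compares the entropy of any other coupling with this common value.\<close>

lemma optimal_plan:
  assumes \<epsilon>: "a = exp (- \<epsilon> / 2)"
  defines "S \<equiv> (\<integral>x. ln (f x) \<partial>\<mu>) + (\<integral>y. ln (g y) \<partial>\<nu>)"
  shows "plan = density (reference_measure \<epsilon>) (\<lambda>(x, y). ennreal (f x * g y))" (is ?eq)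
    and "optimal_coupling \<epsilon> \<mu> \<nu> plan"
    and "optimal_coupling \<epsilon> \<mu> \<nu> \<pi> \<Longrightarrow> \<pi> = plan"
    and "relative_entropy plan (reference_measure \<epsilon>) = ereal S"
proof -
  define R where "R = (reference_measure \<epsilon> :: ('a \<times> 'a) measure)"
  have R_eq: "R = density (std_gaussian \<Otimes>\<^sub>M std_gaussian) (\<lambda>(x, y). ennreal (mehler a x y))"
    unfolding R_def by (rule reference_measure_eq[OF a b_def \<epsilon>])
  have sets_R[measurable_cong]: "sets R = sets borel" by (simp add: R_eq sets_std_gaussian_pair)
  define h where "h z = f (fst z) * g (snd z)" for z
  have h_borel: "h \<in> borel_measurable (borel \<Otimes>\<^sub>M borel)" unfolding h_def by measurable
  have h[measurable]: "h \<in> borel_measurable R"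
    using h_borel by (simp add: borel_prod measurable_cong_sets[OF sets_R refl])
  have h_nonneg: "0 \<le> h z" for z using f_pos[of "fst z"] g_nonneg[of "snd z"] by (simp add: h_def)
  have plan_h: "plan = density R (\<lambda>z. ennreal (h z))"
  proof -
    have "density R (\<lambda>z. ennreal (h z)) = density (std_gaussian \<Otimes>\<^sub>M std_gaussian)
        (\<lambda>z. (\<lambda>(x, y). ennreal (mehler a x y)) z * ennreal (h z))"
      unfolding R_eq
    proof (rule density_density_eq)
      show "(\<lambda>z. ennreal (h z)) \<in> borel_measurable (std_gaussian \<Otimes>\<^sub>M std_gaussian)"
        using h_borel by (simp add: borel_prod measurable_cong_sets[OF sets_std_gaussian_pair refl])
    qed measurable
    also have "\<dots> = plan"
      unfolding plan_def
      by (simp add: case_prod_beta dens_def h_def ennreal_mult'[OF less_imp_le[OF mehler_pos]])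
    finally show ?thesis ..
  qed
  then show ?eq by (simp add: R_def h_def case_prod_unfold)
  have R: "prob_space R"
  proof (rule prob_spaceI)
    have "emeasure R (space R) = (\<integral>\<^sup>+z. (\<lambda>(x::'a, y). ennreal (mehler a x y)) z \<partial>(std_gaussian \<Otimes>\<^sub>M std_gaussian))"
      by (simp add: R_eq emeasure_density)
    also have "\<dots> = (\<integral>\<^sup>+x. \<integral>\<^sup>+y. ennreal (mehler a x y) \<partial>std_gaussian \<partial>(std_gaussian :: 'a measure))"
      by (subst nn_integral_fst[symmetric]) auto
    also have "\<dots> = 1" by (simp add: mehler_markov[OF a b_def] emeasure_space_1)
    finally show "emeasure R (space R) = 1" .
  qed
  interpret R: prob_space R by (rule R)

  \<comment> \<open>The potentials separate the variables, so only the marginals enter.\<close>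
  have coupling: "(AE z in \<pi>. 0 < h z) \<and> integrable \<pi> (\<lambda>z. ln (h z)) \<and> (\<integral>z. ln (h z) \<partial>\<pi>) = S"
    if \<pi>: "\<pi> \<in> couplings \<mu> \<nu>" for \<pi>
  proof -
    have sets_\<pi>: "sets \<pi> = sets borel" and d1: "distr \<pi> borel fst = \<mu>" and d2: "distr \<pi> borel snd = \<nu>"
      using \<pi> by (auto simp: couplings_def)
    have [measurable]: "fst \<in> \<pi> \<rightarrow>\<^sub>M borel" "snd \<in> \<pi> \<rightarrow>\<^sub>M borel"
      by (simp_all add: measurable_cong_sets[OF sets_\<pi> refl] flip: borel_prod)
    have h\<pi>[measurable]: "h \<in> borel_measurable \<pi>"
      using h_borel by (simp add: borel_prod measurable_cong_sets[OF sets_\<pi> refl])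
    have "AE y in distr \<pi> borel snd. 0 < g y"
      unfolding d2 using second_eq_\<nu> by eventually_elim simp
    then have g_pos: "AE z in \<pi>. 0 < g (snd z)" by (rule AE_distrD[rotated]) measurable
    have ln_h: "AE z in \<pi>. ln (f (fst z)) + ln (g (snd z)) = ln (h z)"
      using g_pos
    proof eventually_elim
      case (elim z)
      then show ?case using f_pos[of "fst z"] by (simp add: h_def ln_mult)
    qed
    have i1: "integrable \<pi> (\<lambda>z. ln (f (fst z)))"
      using integrable_ln_f unfolding d1[symmetric] by (subst (asm) integrable_distr_eq) measurable
    have i2: "integrable \<pi> (\<lambda>z. ln (g (snd z)))"
      using integrable_ln_g unfolding d2[symmetric] by (subst (asm) integrable_distr_eq) measurable
    have e1: "(\<integral>z. ln (f (fst z)) \<partial>\<pi>) = (\<integral>x. ln (f x) \<partial>\<mu>)"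
      unfolding d1[symmetric] by (rule integral_distr[symmetric]) measurable
    have e2: "(\<integral>z. ln (g (snd z)) \<partial>\<pi>) = (\<integral>x. ln (g x) \<partial>\<nu>)"
      unfolding d2[symmetric] by (rule integral_distr[symmetric]) measurable
    have "integrable \<pi> (\<lambda>z. ln (h z))"
      by (rule integrable_cong_AE_imp[OF Bochner_Integration.integrable_add[OF i1 i2] _ ln_h]) measurable
    moreover have "(\<integral>z. ln (h z) \<partial>\<pi>) = (\<integral>z. ln (f (fst z)) + ln (g (snd z)) \<partial>\<pi>)"
      using ln_h by (intro integral_cong_AE) (auto elim: eventually_mono)
    moreover have "AE z in \<pi>. 0 < h z"
      using g_pos by eventually_elim (use f_pos in \<open>simp add: h_def\<close>)
    ultimately show ?thesis by (simp add: i1 i2 e1 e2 S_def)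
  qed
  have plan_coupling: "plan \<in> couplings \<mu> \<nu>"
    using prob_space_plan by (simp add: couplings_def sets_plan distr_plan_fst distr_plan_snd)
  show plan_entropy: "relative_entropy plan (reference_measure \<epsilon>) = ereal S"
    using relative_entropy_density[OF R h h_nonneg] coupling[OF plan_coupling]
    by (simp add: plan_h R_def)
  have minimal: "ereal S \<le> relative_entropy \<pi> R \<and> (relative_entropy \<pi> R = ereal S \<longrightarrow> \<pi> = plan)"
    if \<pi>: "\<pi> \<in> couplings \<mu> \<nu>" for \<pi>
  proof (cases "absolutely_continuous R \<pi>")
    case False
    then show ?thesis by (simp add: relative_entropy_def)
  next
    case True
    interpret \<pi>: prob_space \<pi> using \<pi> by (simp add: couplings_def)
    have sets_\<pi>: "sets \<pi> = sets R" using \<pi> by (simp add: couplings_def sets_R)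
    define k where "k z = enn2real (RN_deriv R \<pi> z)" for z
    have [measurable]: "k \<in> borel_measurable R" unfolding k_def by measurable
    have "AE z in R. RN_deriv R \<pi> z \<noteq> \<infinity>"
      by (rule R.RN_deriv_finite) (simp_all add: True sets_\<pi> \<pi>.sigma_finite_measure_axioms)
    then have "AE z in R. ennreal (k z) = RN_deriv R \<pi> z"
      by eventually_elim (simp add: k_def less_top)
    then have "density R (\<lambda>z. ennreal (k z)) = density R (RN_deriv R \<pi>)"
      by (rule density_cong_AE)
    also have "\<dots> = \<pi>" by (rule R.density_RN_deriv[OF True sets_\<pi>])
    finally have \<pi>_k: "density R (\<lambda>z. ennreal (k z)) = \<pi>" .
    have ent: "relative_entropy \<pi> R = (if integrable \<pi> (\<lambda>z. ln (k z)) then ereal (\<integral>z. ln (k z) \<partial>\<pi>) else \<infinity>)"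
      by (rule relative_entropy_density[OF R \<open>k \<in> borel_measurable R\<close>, unfolded \<pi>_k]) (simp add: k_def)
    show ?thesis
    proof (cases "integrable \<pi> (\<lambda>z. ln (k z))")
      case False
      then show ?thesis by (simp add: ent)
    next
      case int: True
      note gibbs = gibbs_inequality[OF h h_nonneg \<open>k \<in> borel_measurable R\<close>, unfolded \<pi>_k plan_h[symmetric]]
      have "(\<integral>z. ln (h z) \<partial>\<pi>) \<le> (\<integral>z. ln (k z) \<partial>\<pi>)"
        using coupling[OF \<pi>] int prob_space_plan \<pi>.prob_space_axioms by (intro gibbs(1)) (auto simp: k_def)
      moreover have "\<pi> = plan" if "(\<integral>z. ln (k z) \<partial>\<pi>) = (\<integral>z. ln (h z) \<partial>\<pi>)"
        using coupling[OF \<pi>] int prob_space_plan \<pi>.prob_space_axioms that by (intro gibbs(2)) (auto simp: k_def)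
      ultimately show ?thesis using coupling[OF \<pi>] int by (simp add: ent)
    qed
  qed
  have cost: "entropic_cost \<epsilon> \<mu> \<nu> = ereal S"
    unfolding entropic_cost_def
  proof (rule antisym)
    show "(INF \<pi>\<in>couplings \<mu> \<nu>. relative_entropy \<pi> (reference_measure \<epsilon>)) \<le> ereal S"
      using plan_entropy plan_coupling by (metis INF_lower)
    show "ereal S \<le> (INF \<pi>\<in>couplings \<mu> \<nu>. relative_entropy \<pi> (reference_measure \<epsilon>))"
      using minimal by (intro INF_greatest) (auto simp: R_def)
  qed
  show "optimal_coupling \<epsilon> \<mu> \<nu> plan"
    using plan_coupling plan_entropy cost by (simp add: optimal_coupling_def)
  show "\<pi> = plan" if "optimal_coupling \<epsilon> \<mu> \<nu> \<pi>"
    using that minimal[of \<pi>] cost by (simp add: optimal_coupling_def R_def)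
qed

end

theorem theorem8:
  fixes \<epsilon> :: real
    and \<mu> \<nu> :: "'a::euclidean_space measure"
    and V W :: "'a \<Rightarrow> ereal"
  assumes "\<epsilon> > 0"
    and "\<And>x. V x \<noteq> -\<infinity>" and "convex_ereal V"
    and "\<exists>c::real. \<forall>x. ereal c \<le> V x"
    and "\<And>x. W x \<noteq> -\<infinity>" and "convex_ereal W"
    and "prob_space \<mu>" and "\<mu> = density std_gaussian (\<lambda>x. exp_ereal (V x))"
    and "integrable \<mu> (\<lambda>x. (norm x)\<^sup>2)"
    and "prob_space \<nu>" and "\<nu> = density std_gaussian (\<lambda>y. exp_ereal (- W y))"
    and "compactly_supported \<nu>"
  shows "\<exists>f g :: 'a \<Rightarrow> real. \<exists>\<pi>.
      f \<in> borel_measurable borel \<and> (\<forall>x. 1 \<le> f x) \<and> log_convex f \<and>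
      g \<in> borel_measurable borel \<and> (\<forall>y. 0 \<le> g y) \<and> log_concave g \<and>
      optimal_coupling \<epsilon> \<mu> \<nu> \<pi> \<and> (\<forall>\<pi>'. optimal_coupling \<epsilon> \<mu> \<nu> \<pi>' \<longrightarrow> \<pi>' = \<pi>) \<and>
      \<pi> = density (reference_measure \<epsilon>) (\<lambda>(x, y). ennreal (f x * g y)) \<and>
      integrable \<mu> (\<lambda>x. ln (f x)) \<and>
      (AE y in \<nu>. 0 < g y) \<and> integrable \<nu> (\<lambda>y. ln (g y)) \<and>
      entropic_cost \<epsilon> \<mu> \<nu> = relative_entropy \<pi> (reference_measure \<epsilon>) \<and>
      relative_entropy \<pi> (reference_measure \<epsilon>) =
        ereal ((\<integral>x. ln (f x) \<partial>\<mu>) + (\<integral>y. ln (g y) \<partial>\<nu>))"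
proof -
  define a where "a = exp (- \<epsilon> / 2)"
  have a: "0 < a" "a < 1" using assms(1) by (simp_all add: a_def)
  obtain c where c: "\<And>x. ereal c \<le> V x" using assms(4) by blast
  define V0 where "V0 x = real_of_ereal (V x)" for x
  have fin: "V x < \<infinity>" for x
    using convex_density_finite[OF assms(3,2)] assms(7,8) by simp
  have V0: "V x = ereal (V0 x)" for x
    using fin[of x] assms(2)[of x] unfolding V0_def by (cases "V x") auto
  have V0_convex: "convex_on UNIV V0"
    unfolding V0_def by (intro convex_on_real_of_ereal assms fin) auto
  have [measurable]: "V0 \<in> borel_measurable borel"
    using convex_on_continuous[OF open_UNIV V0_convex] by (rule borel_measurable_continuous_onI)
  have \<mu>: "\<mu> = density std_gaussian (\<lambda>x. ennreal (exp (V0 x)))"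
    unfolding assms(8) by (simp add: V0)
  obtain D w where D: "open D" "convex D" "convex_on D w"
      and w[measurable]: "(\<lambda>x. indicator D x *\<^sub>R w x) \<in> borel_measurable borel"
      and \<nu>': "density std_gaussian (\<lambda>x. exp_ereal (- W x)) = density std_gaussian (\<lambda>x. ennreal (if x \<in> D then exp (- w x) else 0))"
    using concave_density_open_domain[OF assms(6,5)] by blast
  define G0 where "G0 y = ennreal (if y \<in> D then exp (- w y) else 0)" for y
  have \<nu>: "\<nu> = density std_gaussian G0" using assms(11) \<nu>' by (simp add: G0_def[abs_def])
  have [measurable]: "D \<in> sets borel" using D by simp
  have [measurable]: "G0 \<in> borel_measurable borel"
  proof -
    have "G0 = (\<lambda>y. ennreal (if y \<in> D then exp (- (indicator D y *\<^sub>R w y)) else 0))"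
      by (auto simp: G0_def fun_eq_iff)
    also have "\<dots> \<in> borel_measurable borel" by measurable
    finally show ?thesis .
  qed
  obtain K where K: "compact K" "emeasure \<nu> (- K) = 0"
    using assms(12) by (auto simp: compactly_supported_def)
  obtain r where r: "\<And>y. y \<in> K \<Longrightarrow> norm y \<le> r"
    using compact_imp_bounded[OF K(1)] by (auto simp: bounded_iff)
  interpret convex_data a c r V0 D w
  proof
    show "c \<le> V0 x" for x using c[of x] by (simp add: V0)
    show "(\<integral>\<^sup>+x. ennreal (exp (V0 x)) \<partial>std_gaussian) = 1"
      using prob_space.emeasure_space_1[OF assms(7)]
      by (simp add: \<mu> emeasure_density borel_measurable_std_gaussian space_std_gaussian)
    show "(\<integral>\<^sup>+y. ennreal (if y \<in> D then exp (- w y) else 0) \<partial>std_gaussian) = 1"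
    proof -
      have "(\<integral>\<^sup>+y. G0 y \<partial>std_gaussian) = 1"
        using prob_space.emeasure_space_1[OF assms(10)]
        by (simp add: \<nu> emeasure_density borel_measurable_std_gaussian space_std_gaussian)
      then show ?thesis by (simp add: G0_def)
    qed
    have "(\<integral>\<^sup>+x. ennreal (norm ((norm x)\<^sup>2)) \<partial>\<mu>) < \<infinity>"
      using assms(9) by (simp only: integrable_iff_bounded)
    then show "(\<integral>\<^sup>+x. ennreal (exp (V0 x)) * ennreal ((norm x)\<^sup>2) \<partial>std_gaussian) < \<infinity>"
      unfolding \<mu> by (subst (asm) nn_integral_density) (simp_all add: borel_measurable_std_gaussian)
    have "- K \<in> sets borel" using compact_imp_closed[OF K(1)] by auto
    then have "- K \<in> null_sets \<nu>" using K(2) by (auto simp: null_sets_def \<nu> sets_std_gaussian)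
    then have "AE y in \<nu>. y \<notin> - K" by (rule AE_not_in)
    then have "AE y in std_gaussian. 0 < G0 y \<longrightarrow> y \<notin> - K"
      unfolding \<nu> by (subst (asm) AE_density) (simp_all add: borel_measurable_std_gaussian)
    then show "AE y in std_gaussian. y \<in> D \<longrightarrow> norm y \<le> r"
      by eventually_elim (use r in \<open>auto simp: G0_def\<close>)
  qed (use a D V0_convex in auto)
  obtain f g :: "'a \<Rightarrow> real" where fg: "f \<in> borel_measurable borel" "g \<in> borel_measurable borel"
      "\<And>x. 1 \<le> f x" "\<And>y. 0 \<le> g y" "log_convex_enn (\<lambda>x. ennreal (f x))" "log_concave_enn (\<lambda>y. ennreal (g y))"
      "AE x in std_gaussian. ennreal (f x) * P (\<lambda>y. ennreal (g y)) x = E x"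
      "AE y in std_gaussian. ennreal (g y) * P (\<lambda>x. ennreal (f x)) y = G y"
    using real_schroedinger_solution by blast
  interpret F: factorization a c r V0 D w f g
    by unfold_locales (fact fg)+
  have \<mu>': "F.\<mu> = \<mu>" by (simp add: F.\<mu>_def \<mu> E_def[abs_def])
  have \<nu>'': "F.\<nu> = \<nu>" by (simp add: F.\<nu>_def \<nu> G_def[abs_def] G0_def[abs_def])
  note opt = F.optimal_plan[OF a_def, unfolded \<mu>' \<nu>'']
  have "AE y in \<nu>. 0 < g y" using F.second_eq_\<nu> unfolding \<nu>'' by eventually_elim simp
  moreover have "log_convex f" by (rule log_convex_enn_imp_log_convex[OF fg(5) F.f_pos])
  moreover have "log_concave g" by (rule log_concave_enn_imp_log_concave[OF fg(6,4)])
  moreover have "entropic_cost \<epsilon> \<mu> \<nu> = relative_entropy F.plan (reference_measure \<epsilon>)"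
    using opt(2) by (simp add: optimal_coupling_def)
  moreover note fg(1-4) opt F.integrable_ln_f[unfolded \<mu>'] F.integrable_ln_g[unfolded \<nu>'']
  ultimately show ?thesis by blast
qed

end
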